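(* Let $d\ge 1$, let $G_0\subset\mathbb{R}^d$ be a bounded open interval if $d=1$, or a bounded $C^{1,1}$ open set if $d\geq 2$. Let $R_1,\dots,R_N$ be similitudes of $\mathbb{R}^d$ with coefficients $r_1,\dots,r_N>0$ satisfying $\sum_{j=1}^N r_j^d<1<\sum_{j=1}^N r_j^{d-1}$, let $$G=\bigg(\bigcup_{n=1}^\infty\ \bigcup_{(j_1,\dots,j_n)\in\{1,\dots,N\}^n}R_{j_1}\circ\cdots\circ R_{j_n}(G_0)\bigg)\cup G_0,$$ and assume that the sets $R_1G,\dots,R_NG,G_0$ are pairwise disjoint. Let $\mathfrak{b}\in(d-1,d)$ be the unique number with $\sum_{j=1}^N r_j^{\mathfrak{b}}=1$, and let $\alpha\in(0,d-\mathfrak{b})$. Then $$\lim_{t\to 0}\frac{|G|-\tilde{Q}_{G}^{(\alpha)}(t)}{t}= \frac{\alpha}{2\Gamma(1-\frac{\alpha}{2})}\int_{0}^{\infty}\big(|G|-Q_{G}^{(2)}(u)\big)\,u^{-1-\frac{\alpha}{2}}du.$$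
   Context: A map $R:\mathbb{R}^d\to\mathbb{R}^d$ is a similitude with coefficient $r>0$ if $|Rx-Ry|=r|x-y|$ for all $x,y\in\mathbb{R}^d$. $|A|$ denotes the $d$-dimensional Lebesgue measure of a set $A$; $\Gamma$ is the Gamma function. The set $G$ satisfies $G=(\bigcup_{j=1}^N R_jG)\cup G_0$ and has finite volume. Let $W=\{W_t\}_{t\ge0}$ be Brownian motion in $\mathbb{R}^d$, with $\mathbb{P}_x$ the law under which it starts at $x$, and let $S^{(\alpha/2)}=\{S^{(\alpha/2)}_t\}_{t\ge0}$ be an $(\alpha/2)$-stable subordinator (started at $0$), independent of $W$, with $\mathbb{E}[e^{-\lambda S_t^{(\alpha/2)}}]=e^{-t\lambda^{\alpha/2}}$ for $\lambda>0$. For an open set $D\subset\mathbb{R}^d$ put $\tau_D^{(2)}=\inf\{t>0: W_t\notin D\}$. The spectral heat content of $D$ for Brownian motion is $Q_D^{(2)}(t)=\int_D\mathbb{P}_x(\tau_D^{(2)}>t)\,dx$, and the spectral heat content of $D$ for the subordinate killed Brownian motion is $$\tilde{Q}_{D}^{(\alpha)}(t)=\int_{D}\mathbb{P}_{x}\big(\tau_{D}^{(2)} > S_{t}^{(\alpha/2)}\big)dx.$$ *)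

theory Defs
  imports "HOL-Probability.Probability"
begin

definition similitude :: "('a::euclidean_space \<Rightarrow> 'a) \<Rightarrow> real \<Rightarrow> bool" where
  "similitude R r \<longleftrightarrow> r > 0 \<and> (\<forall>x y. norm (R x - R y) = r * norm (x - y))"

definition compose_word :: "(nat \<Rightarrow> 'a \<Rightarrow> 'a) \<Rightarrow> nat list \<Rightarrow> 'a \<Rightarrow> 'a" where
  "compose_word R js = foldr (\<lambda>j f. R j \<circ> f) js id"

definition self_similar_set ::
    "(nat \<Rightarrow> 'a \<Rightarrow> 'a) \<Rightarrow> nat \<Rightarrow> 'a set \<Rightarrow> 'a set" where
  "self_similar_set R N G0 =
     (\<Union>n\<in>{1..}. \<Union>js\<in>{js. length js = n \<and> set js \<subseteq> {1..N}}. compose_word R js ` G0) \<union> G0"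

(* The orthonormal coordinate system at a boundary point z is represented by the unit vector e
   of its last axis: a point y has last coordinate (y - z) \<bullet> e, and its first d - 1
   coordinates are represented by the component of y - z in the hyperplane H orthogonal to e.
   The function phi, defined on R^(d-1) in coordinates, lives on H; g is its gradient. *)
definition C11_open_set :: "'a::euclidean_space set \<Rightarrow> bool" where
  "C11_open_set D \<longleftrightarrow> open D \<and>
     (\<exists>\<rho>>0. \<exists>L>0. \<forall>z\<in>frontier D. \<exists>e \<phi> g. let H = {v. v \<bullet> e = 0} in
        norm e = 1 \<and> \<phi> 0 = (0::real) \<and> g 0 = 0 \<and>
        (\<forall>v\<in>H. g v \<in> H \<and> norm (g v) \<le> L \<and>
           (\<phi> has_derivative (\<lambda>h. g v \<bullet> h)) (at v within H)) \<and>
        L-lipschitz_on H g \<and>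
        D \<inter> ball z \<rho> =
          {y \<in> ball z \<rho>. (y - z) \<bullet> e > \<phi> ((y - z) - ((y - z) \<bullet> e) *\<^sub>R e)})"

definition independent_increments ::
    "'w measure \<Rightarrow> (real \<Rightarrow> 'w \<Rightarrow> 'a::euclidean_space) \<Rightarrow> bool" where
  "independent_increments M X \<longleftrightarrow>
     (\<forall>(s::nat \<Rightarrow> real) n. 0 \<le> s 0 \<and> mono_on {..n} s \<longrightarrow>
        prob_space.indep_vars M (\<lambda>_. borel) (\<lambda>i \<omega>. X (s (Suc i)) \<omega> - X (s i) \<omega>) {..<n})"

(* Brownian motion started at x, with covariance matrix c * t * I at time t. Standard Brownian
   motion is c = 1; c = 2 is the normalization with generator the Laplacian, for which the
   subordinated process has characteristic function exp (- t * norm xi powr alpha).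
   Paths are continuous for every sample point, so that exit times are measurable without
   completing M. *)
definition brownian_motion ::
    "'w measure \<Rightarrow> real \<Rightarrow> 'a::euclidean_space \<Rightarrow> (real \<Rightarrow> 'w \<Rightarrow> 'a) \<Rightarrow> bool" where
  "brownian_motion M c x W \<longleftrightarrow>
     prob_space M \<and>
     (\<forall>t\<ge>0. W t \<in> borel_measurable M) \<and>
     (AE \<omega> in M. W 0 \<omega> = x) \<and>
     (\<forall>\<omega>\<in>space M. continuous_on {0..} (\<lambda>t. W t \<omega>)) \<and>
     independent_increments M W \<and>
     (\<forall>s t. 0 \<le> s \<and> s < t \<longrightarrow>
        distributed M lborel (\<lambda>\<omega>. W t \<omega> - W s \<omega>)
          (\<lambda>y. ennreal (\<Prod>i\<in>Basis. normal_density 0 (sqrt (c * (t - s))) (y \<bullet> i))))"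

definition stable_subordinator ::
    "'w measure \<Rightarrow> real \<Rightarrow> (real \<Rightarrow> 'w \<Rightarrow> real) \<Rightarrow> bool" where
  "stable_subordinator M \<beta> S \<longleftrightarrow>
     prob_space M \<and>
     (\<forall>t\<ge>0. S t \<in> borel_measurable M) \<and>
     (AE \<omega> in M. S 0 \<omega> = 0) \<and>
     (\<forall>\<omega>\<in>space M. mono_on {0..} (\<lambda>t. S t \<omega>) \<and>
        (\<forall>t\<ge>0. continuous (at_right t) (\<lambda>t. S t \<omega>))) \<and>
     independent_increments M S \<and>
     (\<forall>s t. 0 \<le> s \<and> s \<le> t \<longrightarrow>
        distr M borel (\<lambda>\<omega>. S t \<omega> - S s \<omega>) = distr M borel (S (t - s))) \<and>
     (\<forall>t\<ge>0. \<forall>l>0. prob_space.expectation M (\<lambda>\<omega>. exp (- l * S t \<omega>)) = exp (- t * l powr \<beta>))"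

(* Independence of the sigma-algebras generated by the two processes; the library's indep_var
   requires both variables to have the same value type. *)
definition independent_processes ::
    "'w measure \<Rightarrow> (real \<Rightarrow> 'w \<Rightarrow> 'a::euclidean_space) \<Rightarrow> (real \<Rightarrow> 'w \<Rightarrow> 'b::euclidean_space) \<Rightarrow> bool"
  where
  "independent_processes M X Y \<longleftrightarrow>
     prob_space.indep_set M
       (sets (vimage_algebra (space M) (\<lambda>\<omega>. \<lambda>t\<in>{0..}. X t \<omega>) (PiM {0..} (\<lambda>_. borel))))
       (sets (vimage_algebra (space M) (\<lambda>\<omega>. \<lambda>t\<in>{0..}. Y t \<omega>) (PiM {0..} (\<lambda>_. borel))))"

definition exit_time :: "'a set \<Rightarrow> (real \<Rightarrow> 'a) \<Rightarrow> ereal" where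
  "exit_time D w = Inf {ereal t |t. t > 0 \<and> w t \<notin> D}"

(* P x is the law under which W starts at x. *)
definition spectral_heat_content ::
    "('a::euclidean_space \<Rightarrow> 'w measure) \<Rightarrow> (real \<Rightarrow> 'w \<Rightarrow> 'a) \<Rightarrow> 'a set \<Rightarrow> real \<Rightarrow> real" where
  "spectral_heat_content P W D t =
     (LINT x:D|lebesgue.
        measure (P x) {\<omega> \<in> space (P x). exit_time D (\<lambda>s. W s \<omega>) > ereal t})"

definition subordinate_heat_content ::
    "('a::euclidean_space \<Rightarrow> 'w measure) \<Rightarrow> (real \<Rightarrow> 'w \<Rightarrow> 'a) \<Rightarrow> (real \<Rightarrow> 'w \<Rightarrow> real) \<Rightarrow>
      'a set \<Rightarrow> real \<Rightarrow> real" where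
  "subordinate_heat_content P W S D t =
     (LINT x:D|lebesgue.
        measure (P x) {\<omega> \<in> space (P x). exit_time D (\<lambda>s. W s \<omega>) > ereal (S t \<omega>)})"

end

theory Submission
  imports Defs
begin

text \<open>
  Write \<open>\<beta> = \<alpha> / 2\<close> and let \<open>\<tau>\<close> be the exit time of \<open>G\<close>. Since \<open>S\<close> is independent of \<open>W\<close>,
  the heat loss \<open>|G| - Q(t)\<close> of the subordinate process is the integral of \<open>H\<^sub>t(\<tau>)\<close> over \<open>G\<close> and
  Wiener space, where \<open>H\<^sub>t(v)\<close> is the probability of \<open>S\<^sub>t \<ge> v\<close>. The Laplace transform of \<open>S\<^sub>t\<close> gives
  \<open>H\<^sub>t(v) \<le> C t v\<^sup>-\<^sup>\<beta>\<close> and, by Karamata's Tauberian argument, \<open>H\<^sub>t(v) / t \<rightarrow> v\<^sup>-\<^sup>\<beta> / \<Gamma>(1 - \<beta>)\<close>, so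
  dominated convergence and Tonelli yield the limit once \<open>\<tau>\<^sup>-\<^sup>\<beta>\<close> is integrable.

  For a starting point at distance \<open>\<delta>\<close> from the complement of an open subset of \<open>G\<close>, the expectation
  of \<open>\<tau>\<^sup>-\<^sup>\<beta>\<close> is at most a constant times \<open>\<delta>\<^sup>-\<^sup>\<alpha>\<close>. Taking for the subset a copy of \<open>G\<^sub>0\<close> of ratio \<open>\<rho>\<close>
  inside \<open>G\<close>, the integral of \<open>\<delta>\<^sup>-\<^sup>\<alpha>\<close> over the copy is \<open>\<rho>\<close> to the power \<open>d - \<alpha>\<close> times the one over
  \<open>G\<^sub>0\<close>, which is finite because \<open>\<alpha> < 1\<close> and the boundary collars of \<open>G\<^sub>0\<close> have linear volume.
  Summing over all words gives a geometric series, whose ratio is less than 1 because \<open>d - \<alpha> > b\<close>.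
\<close>

section \<open>Similitudes\<close>

text \<open>The laws \<open>P x\<close> are unrelated for different \<open>x\<close>: nothing says
  that \<open>P x\<close> depends measurably on \<open>x\<close> or that one law is a translate of
  another. Tonelli over \<open>G\<close> and Wiener space therefore runs on the single law
  \<open>P 0\<close>, with the path from \<open>x\<close> realised as \<open>x + W s - W 0\<close>.
  The price is two uniqueness statements: this path has the same exit law under \<open>P x\<close>
  and \<open>P 0\<close>, and \<open>S t\<close> has the same tail under both.

  A crude exit estimate suffices, P(\<tau> \<le> u) \<le> K (u / \<delta>^2)^2: any power above
  \<beta> is integrable against u^(-1-\<beta>) at 0, and fourth moments of increments give the power
  2. Above the Brownian time scale \<delta>^2 the trivial bound 1 takes over, and this is where
  \<delta>^(-2\<beta>) = \<delta>^(-\<alpha>) comes from.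

  The constant in the limit arises because \<tau>^(-\<beta>) is \<beta> times the integral of
  u^(-1-\<beta>) over u \<ge> \<tau>. Averaging turns this into \<beta> times the integral of (|G| -
  Q(u)) u^(-1-\<beta>), and \<beta> / Gamma(1-\<beta>) is \<alpha> / (2
  Gamma(1-\<alpha>/2)).\<close>

lemma similitude_pos: "similitude R r \<Longrightarrow> r > 0"
  by (simp add: similitude_def)

lemma similitude_dist: "similitude R r \<Longrightarrow> dist (R x) (R y) = r * dist x y"
  by (simp add: similitude_def dist_norm)

text \<open>Recentred at 0 and rescaled, \<open>R\<close> is an isometry fixing the origin, hence
  linear and orthogonal. This supplies surjectivity, which the definition of a similitude does not
  ask for.\<close>

lemma similitude_bij:
  fixes R :: "'a::euclidean_space \<Rightarrow> 'a"
  assumes "similitude R r"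
  shows "bij R"
proof -
  define f where "f x = (1 / r) *\<^sub>R (R x - R 0)" for x
  have r: "r > 0" using assms by (rule similitude_pos)
  have "dist (f x) (f y) = dist x y" for x y
  proof -
    have "f x - f y = (1 / r) *\<^sub>R (R x - R y)"
      by (simp add: f_def algebra_simps)
    then show ?thesis
      using assms r by (simp add: dist_norm similitude_def)
  qed
  then have "orthogonal_transformation f"
    unfolding orthogonal_transformation_isometry by (simp add: f_def)
  then have "bij f" by (rule orthogonal_transformation_bij)
  moreover have "R = (\<lambda>y. R 0 + r *\<^sub>R y) \<circ> f"
    using r by (auto simp: f_def)
  moreover have "bij (\<lambda>y. R 0 + r *\<^sub>R y :: 'a)"
    using r by (intro bijI' ) (auto intro!: exI[of _ "(1/r) *\<^sub>R (_ - R 0)"])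
  ultimately show ?thesis
    by (metis bij_comp)
qed

lemma similitude_comp:
  "similitude R r \<Longrightarrow> similitude Q q \<Longrightarrow> similitude (R \<circ> Q) (r * q)"
  by (simp add: similitude_def)

lemma similitude_continuous: "similitude R r \<Longrightarrow> continuous_on A R"
  by (rule lipschitz_on_continuous_on[of r])
    (auto simp: lipschitz_on_def similitude_dist dest: similitude_pos)

lemma similitude_borel_measurable:
  "similitude R r \<Longrightarrow> R \<in> borel_measurable borel"
  by (intro borel_measurable_continuous_onI similitude_continuous)

lemma similitude_image_ball:
  assumes "similitude R r"
  shows "R ` ball x s = ball (R x) (r * s)"
proof -
  have "y \<in> R ` ball x s" if "y \<in> ball (R x) (r * s)" for y
  proof -
    obtain z where z: "y = R z" using similitude_bij[OF assms] by (metis bij_pointE)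
    show ?thesis using that z similitude_pos[OF assms] by (auto simp: similitude_dist[OF assms])
  qed
  then show ?thesis using similitude_pos[OF assms] by (auto simp: similitude_dist[OF assms])
qed

lemma similitude_image_open:
  assumes "similitude R r" "open A"
  shows "open (R ` A)"
  unfolding open_contains_ball
proof
  fix y assume "y \<in> R ` A"
  then obtain x where x: "x \<in> A" "y = R x" by auto
  then obtain e where e: "e > 0" "ball x e \<subseteq> A" using assms(2) open_contains_ball by blast
  have "ball y (r * e) \<subseteq> R ` A"
    using e(2) similitude_image_ball[OF assms(1), of x e] x by blast
  then show "\<exists>e>0. ball y e \<subseteq> R ` A"
    using e(1) similitude_pos[OF assms(1)] by (intro exI[of _ "r * e"]) auto
qed

text \<open>Balls go to balls with radius scaled by \<open>r\<close>, so their volumes scale by the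
  right factor. Vitali's covering theorem fills \<open>A\<close> up to a null set with countably
  many disjoint balls, and the Lipschitz map \<open>R\<close> sends the null remainder to a null
  set.\<close>

lemma emeasure_similitude_image_open:
  fixes R :: "'a::euclidean_space \<Rightarrow> 'a"
  assumes R: "similitude R r" and A: "open A"
  shows "emeasure lborel (R ` A) = ennreal (r ^ DIM('a)) * emeasure lborel A"
proof -
  note r = similitude_pos[OF R]
  have inj: "inj R" using similitude_bij[OF R] by (simp add: bij_def)
  define K where "K = {(x::'a, s::real). s > 0 \<and> ball x s \<subseteq> A}"
  have "\<exists>i. i \<in> K \<and> x \<in> ball (fst i) (snd i) \<and> snd i < d" if "x \<in> A" "d > 0" for x d
  proof -
    obtain e where e: "e > 0" "ball x e \<subseteq> A" using A \<open>x \<in> A\<close> open_contains_ball by blast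
    have "ball x (min e (d/2)) \<subseteq> A" using e(2) subset_ball[of "min e (d/2)" e x] by auto
    then show ?thesis using e(1) \<open>d > 0\<close>
      by (intro exI[of _ "(x, min e (d / 2))"]) (auto simp: K_def)
  qed
  from Vitali_covering_theorem_balls[OF this]
  obtain C where C: "countable C" "C \<subseteq> K"
    "pairwise (\<lambda>i j. disjnt (ball (fst i) (snd i)) (ball (fst j) (snd j))) C"
    "negligible (A - (\<Union>i \<in> C. ball (fst i) (snd i)))"
    by blast
  define B where "B i = ball (fst i) (snd i)" for i :: "'a \<times> real"
  have "disjoint_family_on B C"
    using C(3) unfolding disjoint_family_on_def pairwise_def disjnt_def B_def by blast
  moreover have "(\<Union>i\<in>C. B i) \<subseteq> A"
    using C(2) unfolding B_def K_def by fastforce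
  moreover have "negligible (A - (\<Union>i \<in> C. B i))"
    using C(4) unfolding B_def .
  moreover have "B i \<in> sets borel" "R ` B i \<in> sets borel" for i
    by (auto simp: B_def similitude_image_ball[OF R])
  ultimately have B: "disjoint_family_on B C" "(\<Union>i\<in>C. B i) \<subseteq> A"
    "negligible (A - (\<Union>i \<in> C. B i))" "B i \<in> sets borel" "R ` B i \<in> sets borel" for i
    by blast+
  have "emeasure lborel (R ` B i) = ennreal (r ^ DIM('a)) * emeasure lborel (B i)" if "i \<in> C" for i
  proof -
    have "snd i > 0" using C that by (auto simp: K_def)
    then show ?thesis
      using r by (simp add: B_def similitude_image_ball[OF R] emeasure_ball power_mult_distrib
          mult_ac flip: ennreal_mult)
  qed
  note eq = this
  have ae: "emeasure lborel S = emeasure lborel T"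
    if "T \<subseteq> S" "negligible (S - T)" "S \<in> sets borel" "T \<in> sets borel" for S T :: "'a set"
  proof (rule emeasure_eq_AE)
    have "S - T \<in> null_sets lborel"
      using that by (simp add: negligible_iff_null_sets null_sets_def)
    then show "AE x in lborel. x \<in> S \<longleftrightarrow> x \<in> T"
      using that(1) by (auto dest!: AE_not_in elim!: eventually_mono)
  qed (use that in auto)
  have "negligible (R ` (A - (\<Union>i \<in> C. B i)))"
  proof (rule negligible_locally_Lipschitz_image[OF _ B(3)])
    show "\<exists>T K. open T \<and> x \<in> T \<and> (\<forall>y\<in>(A - \<Union> (B ` C)) \<inter> T. norm (R y - R x) \<le> K * norm (y - x))" for x
      using R by (intro exI[of _ UNIV] exI[of _ r]) (auto simp: similitude_def)
  qed simp
  then have "negligible (R ` A - (\<Union>i\<in>C. R ` B i))"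
    by (simp add: image_set_diff[OF inj] image_UN)
  then have "emeasure lborel (R ` A) = emeasure lborel (\<Union>i\<in>C. R ` B i)"
    using B(2) similitude_image_open[OF R A] C(1) B(4,5)
    by (intro ae) (auto intro!: sets.countable_UN')
  also have "\<dots> = (\<integral>\<^sup>+i. emeasure lborel (R ` B i) \<partial>count_space C)"
    using B(1,5) C(1) inj
    by (intro emeasure_UN_countable) (auto simp: disjoint_family_on_def image_Int[symmetric])
  also have "\<dots> = (\<integral>\<^sup>+i. ennreal (r ^ DIM('a)) * emeasure lborel (B i) \<partial>count_space C)"
    by (intro nn_integral_cong) (simp add: eq)
  also have "\<dots> = ennreal (r ^ DIM('a)) * emeasure lborel (\<Union>i\<in>C. B i)"
    using B(1,4) C(1) by (simp add: nn_integral_cmult emeasure_UN_countable)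
  also have "emeasure lborel (\<Union>i\<in>C. B i) = emeasure lborel A"
    using B A C(1) by (intro ae[symmetric]) (auto intro!: sets.countable_UN')
  finally show ?thesis .
qed

text \<open>Lebesgue measure is determined by its values on open boxes. The scaled push-forward
  under \<open>R\<close> has these values because the preimage of a box is open and \<open>R\<close>
  maps it back onto the box.\<close>

lemma nn_integral_similitude:
  fixes R :: "'a::euclidean_space \<Rightarrow> 'a"
  assumes R: "similitude R r" and [measurable]: "f \<in> borel_measurable borel"
  shows "(\<integral>\<^sup>+x. f x \<partial>lborel) = ennreal (r ^ DIM('a)) * (\<integral>\<^sup>+x. f (R x) \<partial>lborel)"
proof -
  have [measurable]: "R \<in> borel_measurable borel" using R by (rule similitude_borel_measurable)
  have "lborel = scale_measure (ennreal (r ^ DIM('a))) (distr lborel borel R)"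
  proof (rule lborel_eqI)
    fix l u :: 'a assume lu: "\<And>b. b \<in> Basis \<Longrightarrow> l \<bullet> b \<le> u \<bullet> b"
    have "open (R -` box l u)"
      by (intro open_vimage similitude_continuous[OF R]) auto
    then have "emeasure lborel (R ` (R -` box l u)) =
        ennreal (r ^ DIM('a)) * emeasure lborel (R -` box l u)"
      by (rule emeasure_similitude_image_open[OF R])
    moreover have "R ` (R -` box l u) = box l u"
      using similitude_bij[OF R] by (simp add: bij_is_surj)
    ultimately show "emeasure (scale_measure (ennreal (r ^ DIM('a))) (distr lborel borel R)) (box l u)
        = (\<Prod>b\<in>Basis. (u - l) \<bullet> b)"
      using lu by (simp add: emeasure_distr)
  qed simp
  then have "(\<integral>\<^sup>+x. f x \<partial>lborel) =
      (\<integral>\<^sup>+x. f x \<partial>scale_measure (ennreal (r ^ DIM('a))) (distr lborel borel R))" by simp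
  also have "\<dots> = ennreal (r ^ DIM('a)) * (\<integral>\<^sup>+x. f (R x) \<partial>lborel)"
    by (simp add: nn_integral_scale_measure nn_integral_distr)
  finally show ?thesis .
qed

lemma infdist_similitude:
  assumes "similitude R r"
  shows "infdist (R x) (R ` A) = r * infdist x A"
proof (cases "A = {}")
  case False
  note r = similitude_pos[OF assms]
  have "infdist (R x) (R ` A) / r \<le> dist x a" if "a \<in> A" for a
    using infdist_le[of "R a" "R ` A" "R x"] that r
    by (simp add: similitude_dist[OF assms] field_simps)
  then have "infdist (R x) (R ` A) / r \<le> infdist x A"
    using False by (simp add: infdist_def cINF_greatest)
  moreover have "r * infdist x A \<le> dist (R x) y" if "y \<in> R ` A" for y
    using that r infdist_le by (fastforce simp: similitude_dist[OF assms])
  then have "r * infdist x A \<le> infdist (R x) (R ` A)"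
    using False by (simp add: infdist_def[of "R x"] cINF_greatest)
  ultimately show ?thesis
    using r by (simp add: field_simps)
qed (simp add: infdist_def)

lemma ball_infdist_Compl_subset: "ball x (infdist x (- D)) \<subseteq> D"
proof
  fix y assume y: "y \<in> ball x (infdist x (- D))"
  show "y \<in> D"
  proof (rule ccontr)
    assume "y \<notin> D"
    then have "infdist x (- D) \<le> dist x y" by (intro infdist_le) simp
    then show False using y by simp
  qed
qed

section \<open>Boundary collars\<close>

lemma emeasure_lborel_translate:
  assumes "B \<in> sets borel"
  shows "emeasure lborel ((\<lambda>y::'a::euclidean_space. a + y) -` B) = emeasure lborel B"
  using emeasure_distr[of "(+) a" lborel borel B] assms by (simp add: lborel_distr_plus)

text \<open>No Fubini argument is needed: the translates of the layer \<open>B\<close> by multiples of \<open>\<kappa> *\<^sub>R e\<close> are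
  disjoint, and about \<open>\<rho> / \<kappa>\<close> of them fit into a ball of radius \<open>2 * \<rho>\<close>.\<close>

lemma emeasure_graph_layer_le:
  fixes z e :: "'a::euclidean_space" and \<psi> :: "'a \<Rightarrow> real"
  assumes e: "norm e = 1" and shift: "\<And>y s. \<psi> (y + s *\<^sub>R e) = \<psi> y + s"
    and [measurable]: "\<psi> \<in> borel_measurable borel" and pos: "\<rho> > 0" "\<kappa> > 0"
  shows "emeasure lborel {y \<in> ball z \<rho>. 0 < \<psi> y \<and> \<psi> y \<le> \<kappa>}
           \<le> ennreal (measure lborel (ball z (2 * \<rho>)) / \<rho> * \<kappa>)"
proof -
  define B where "B = {y \<in> ball z \<rho>. 0 < \<psi> y \<and> \<psi> y \<le> \<kappa>}"
  \<comment> \<open>One more than the integer part of \<rho> / \<kappa>: there are at least \<rho> /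
    \<kappa> copies, yet the largest shift, by n - 1 steps, is still at most \<rho>, so all copies
    stay in the ball of twice the radius.\<close>
  define n where "n = Suc (nat \<lfloor>\<rho> / \<kappa>\<rfloor>)"
  define T where "T k = (\<lambda>y. (- (real k * \<kappa>)) *\<^sub>R e + y) -` B" for k :: nat
  have [measurable]: "B \<in> sets borel" by (simp add: B_def)
  have T [measurable]: "T k \<in> sets borel" for k
    unfolding T_def by (rule measurable_sets_borel[OF _ \<open>B \<in> sets borel\<close>]) measurable
  have n: "\<rho> / \<kappa> \<le> real n" "real k * \<kappa> \<le> \<rho>" if "k < n" for k
  proof -
    show "\<rho> / \<kappa> \<le> real n" unfolding n_def by linarith
    have "real k \<le> \<rho> / \<kappa>" using that pos unfolding n_def
      by (smt (verit) divide_pos_pos less_Suc_eq_le nat_le_iff of_int_floor_le of_int_le_iff of_int_of_nat_eq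
          zero_le_floor of_nat_nat of_nat_le_iff)
    then show "real k * \<kappa> \<le> \<rho>" using pos by (simp add: field_simps)
  qed
  \<comment> \<open>A shift by k \<kappa> along \<open>e\<close> raises \<psi> by exactly that
    amount, so the copies lie in successive half-open slabs of \<psi>. This is what makes them
    disjoint.\<close>
  have psiT: "real k * \<kappa> < \<psi> y \<and> \<psi> y \<le> real (Suc k) * \<kappa>" if "y \<in> T k" for k y
    using that shift[of y "- (real k * \<kappa>)"] by (simp add: T_def B_def algebra_simps)
  have "disjoint_family_on T {..<n}"
  proof (unfold disjoint_family_on_def, intro ballI impI)
    fix i j :: nat assume "i \<noteq> j"
    have "False" if "y \<in> T i" "y \<in> T j" "i < j" for i j y
    proof -
      have "real (Suc i) * \<kappa> \<le> real j * \<kappa>"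
        using \<open>i < j\<close> pos by (intro mult_right_mono) auto
      with psiT[OF that(1)] psiT[OF that(2)] show False by linarith
    qed
    with \<open>i \<noteq> j\<close> show "T i \<inter> T j = {}" by (metis disjoint_iff linorder_neqE_nat)
  qed
  have "T k \<subseteq> ball z (2 * \<rho>)" if "k < n" for k
  proof
    fix y assume "y \<in> T k"
    then have "dist z (y - (real k * \<kappa>) *\<^sub>R e) < \<rho>" by (simp add: T_def B_def)
    moreover have "dist (y - (real k * \<kappa>) *\<^sub>R e) y \<le> \<rho>"
      using n(2)[OF that] e pos by (simp add: dist_norm)
    ultimately show "y \<in> ball z (2 * \<rho>)"
      using dist_triangle[of z y "y - (real k * \<kappa>) *\<^sub>R e"] by simp
  qed
  then have sub: "(\<Union>k<n. T k) \<subseteq> ball z (2 * \<rho>)" by auto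
  have "of_nat n * emeasure lborel B = (\<Sum>k<n. emeasure lborel (T k))"
    unfolding T_def emeasure_lborel_translate[OF \<open>B \<in> sets borel\<close>] by simp
  also have "\<dots> = emeasure lborel (\<Union>k<n. T k)"
    using \<open>disjoint_family_on T {..<n}\<close> by (intro sum_emeasure) auto
  also have "\<dots> \<le> emeasure lborel (ball z (2 * \<rho>))"
    using sub by (intro emeasure_mono) auto
  finally have le: "of_nat n * emeasure lborel B \<le> emeasure lborel (ball z (2 * \<rho>))" .
  have fin: "emeasure lborel B < \<infinity>"
    by (rule le_less_trans[OF emeasure_mono[of B "ball z \<rho>"] emeasure_lborel_ball_finite])
      (auto simp: B_def)
  then have B: "emeasure lborel B = ennreal (measure lborel B)"
    by (intro emeasure_eq_ennreal_measure) auto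
  have "emeasure lborel (ball z (2 * \<rho>)) = ennreal (measure lborel (ball z (2 * \<rho>)))"
    using emeasure_lborel_ball_finite[of z "2*\<rho>"] by (intro emeasure_eq_ennreal_measure) auto
  with le B have "ennreal (real n * measure lborel B) \<le> ennreal (measure lborel (ball z (2 * \<rho>)))"
    by (simp add: ennreal_mult' ennreal_of_nat_eq_real_of_nat)
  then have le': "real n * measure lborel B \<le> measure lborel (ball z (2 * \<rho>))"
    by (simp add: ennreal_le_iff)
  have "\<rho> / \<kappa> * measure lborel B \<le> real n * measure lborel B"
    using n(1)[of 0] by (intro mult_right_mono) (auto simp: n_def)
  with le' have "measure lborel B \<le> measure lborel (ball z (2 * \<rho>)) / \<rho> * \<kappa>"
    using pos by (simp add: pos_divide_le_eq pos_le_divide_eq field_simps) (meson mult_left_mono order_trans less_imp_le)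
  then show ?thesis
    using B unfolding B_def by (simp add: ennreal_leI)
qed

lemma norm_orthogonal_part_le:
  fixes e y :: "'a::euclidean_space"
  assumes "norm e = 1"
  shows "norm (y - (y \<bullet> e) *\<^sub>R e) \<le> norm y"
proof -
  have "e \<bullet> e = 1" using assms by (simp add: dot_square_norm)
  then have "(norm (y - (y \<bullet> e) *\<^sub>R e))\<^sup>2 = (norm y)\<^sup>2 - (y \<bullet> e)\<^sup>2"
    unfolding power2_norm_eq_inner
    by (simp add: inner_diff_left inner_diff_right inner_commute[of e y] power2_eq_square)
  then show ?thesis
    by (metis diff_ge_0_iff_ge le_add_same_cancel1 norm_ge_zero power2_le_imp_le diff_add_cancel zero_le_power2)
qed

text \<open>A segment from \<open>x\<close> to an almost nearest point outside \<open>D\<close> has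
  to cross the frontier, and the crossing point is no farther away.\<close>

lemma frontier_point_near:
  fixes D :: "'a::euclidean_space set"
  assumes x: "x \<in> D" and ne: "- D \<noteq> {}" and lt: "infdist x (- D) < \<epsilon>"
  obtains z where "z \<in> frontier D" "dist x z < \<epsilon>"
proof -
  have "(INF a\<in>-D. dist x a) < \<epsilon>" using lt ne by (simp add: infdist_def)
  then obtain y where y: "y \<notin> D" "dist x y < \<epsilon>"
    using ne by (subst (asm) cINF_less_iff) (auto intro!: bdd_belowI[of _ 0])
  have "closed_segment x y \<inter> frontier D \<noteq> {}"
    using x y(1) by (intro connected_Int_frontier) auto
  then obtain z where z: "z \<in> closed_segment x y" "z \<in> frontier D" by auto
  have "dist x z \<le> dist x y"
    using segment_bound1[OF z(1)] by (simp add: dist_norm norm_minus_commute)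
  then show ?thesis using z(2) y(2) that by fastforce
qed

text \<open>In one chart the gradient bound makes the graph function \<open>L\<close>-Lipschitz, so
  a point of \<open>D\<close> within \<epsilon> of an outside point has height at most (1 + L)
  \<epsilon> over the graph, and \<open>emeasure_graph_layer_le\<close> bounds the volume of that
  layer. Compactness of the frontier reduces the collar to finitely many charts.\<close>

lemma C11_collar:
  fixes D :: "'a::euclidean_space set"
  assumes bdd: "bounded D" and C11: "C11_open_set D"
  obtains C where "C \<ge> 0" "\<And>\<epsilon>. \<epsilon> > 0 \<Longrightarrow> emeasure lborel {x \<in> D. infdist x (- D) < \<epsilon>} \<le> ennreal (C * \<epsilon>)"
proof -
  have "open D" using C11 by (simp add: C11_open_set_def)
  have ne: "- D \<noteq> {}" using bdd not_bounded_UNIV by (metis Compl_empty_eq double_complement)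
  obtain \<rho> L where \<rho>: "\<rho> > 0" and L: "L > 0" and loc: "\<And>z. z \<in> frontier D \<Longrightarrow> \<exists>e \<phi> g. 
        norm e = 1 \<and> \<phi> 0 = (0::real) \<and> g 0 = 0 \<and>
        (\<forall>v\<in>{v. v \<bullet> e = 0}. g v \<in> {v. v \<bullet> e = 0} \<and> norm (g v) \<le> L \<and>
           (\<phi> has_derivative (\<lambda>h. g v \<bullet> h)) (at v within {v. v \<bullet> e = 0})) \<and>
        L-lipschitz_on {v. v \<bullet> e = 0} g \<and>
        D \<inter> ball z \<rho> =
          {y \<in> ball z \<rho>. (y - z) \<bullet> e > \<phi> ((y - z) - ((y - z) \<bullet> e) *\<^sub>R e)}"
    using C11 unfolding C11_open_set_def Let_def
    by (elim conjE exE) (rule that, assumption+, erule (1) bspec)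
  have layer: "\<exists>C\<ge>0. \<forall>\<epsilon>>0. emeasure lborel {x \<in> D \<inter> ball z \<rho>. \<exists>y\<in>ball z \<rho> - D. dist x y < \<epsilon>}
      \<le> ennreal (C * \<epsilon>)" if z: "z \<in> frontier D" for z
  proof -
    obtain e \<phi> g where e: "norm e = 1"
      and der: "\<And>v. v \<bullet> e = 0 \<Longrightarrow> norm (g v) \<le> L \<and>
           (\<phi> has_derivative (\<lambda>h. g v \<bullet> h)) (at v within {v. v \<bullet> e = 0})"
      and D: "D \<inter> ball z \<rho> = {y \<in> ball z \<rho>. (y - z) \<bullet> e > \<phi> ((y - z) - ((y - z) \<bullet> e) *\<^sub>R e)}"
      using loc[OF z] by blast
    define p where "p y = (y - z) - ((y - z) \<bullet> e) *\<^sub>R e" for y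
    \<comment> \<open>Signed height over the graph: inside the chart ball it is positive exactly on
      \<open>D\<close>, it has unit speed along \<open>e\<close>, and it is (1 +
      L)-Lipschitz.\<close>
    define \<psi> where "\<psi> y = (y - z) \<bullet> e - \<phi> (p y)" for y
    have ee: "e \<bullet> e = 1" using e by (simp add: dot_square_norm)
    have p: "p y \<bullet> e = 0" for y by (simp add: p_def inner_diff_left ee)
    have phi_lip: "norm (\<phi> v - \<phi> w) \<le> L * norm (v - w)" if "v \<bullet> e = 0" "w \<bullet> e = 0" for v w
    proof (rule differentiable_bound)
      show "convex {v. v \<bullet> e = 0}" using convex_hyperplane[of e 0] by (simp add: inner_commute)
      show "\<And>v. v \<in> {v. v \<bullet> e = 0} \<Longrightarrow> (\<phi> has_derivative (\<lambda>h. g v \<bullet> h)) (at v within {v. v \<bullet> e = 0})"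
        using der by blast
      show "onorm (\<lambda>h. g v \<bullet> h) \<le> L" if "v \<in> {v. v \<bullet> e = 0}" for v
      proof (rule onorm_bound)
        fix h
        have "\<bar>g v \<bullet> h\<bar> \<le> norm (g v) * norm h" by (rule Cauchy_Schwarz_ineq2)
        also have "\<dots> \<le> L * norm h" using der[of v] that by (intro mult_right_mono) auto
        finally show "norm (g v \<bullet> h) \<le> L * norm h" by simp
      qed (use L in simp)
    qed (use that in auto)
    have p_le: "norm (p y - p x) \<le> norm (y - x)" for x y
      using norm_orthogonal_part_le[OF e, of "y - x"] by (simp add: p_def algebra_simps)
    have phi: "\<bar>\<phi> (p y) - \<phi> (p x)\<bar> \<le> L * norm (y - x)" for x y
    proof -
      have "\<bar>\<phi> (p y) - \<phi> (p x)\<bar> \<le> L * norm (p y - p x)" using phi_lip[OF p p] by simp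
      also have "\<dots> \<le> L * norm (y - x)" using p_le L by (intro mult_left_mono) auto
      finally show ?thesis .
    qed
    have lip: "\<psi> y - \<psi> x \<le> (1 + L) * dist y x" for x y
    proof -
      have "\<bar>(y - x) \<bullet> e\<bar> \<le> norm (y - x)" using Cauchy_Schwarz_ineq2[of "y - x" e] e by simp
      then show ?thesis using phi[of y x] by (simp add: \<psi>_def dist_norm algebra_simps abs_le_iff)
    qed
    have "(1 + L)-lipschitz_on UNIV \<psi>"
    proof (rule lipschitz_onI)
      show "dist (\<psi> x) (\<psi> y) \<le> (1 + L) * dist x y" for x y
        using lip[of x y] lip[of y x] by (simp add: dist_real_def dist_commute abs_le_iff)
    qed (use L in simp)
    then have meas: "\<psi> \<in> borel_measurable borel"
      by (intro borel_measurable_continuous_onI lipschitz_on_continuous_on)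
    have shift: "\<psi> (y + s *\<^sub>R e) = \<psi> y + s" for y s
    proof -
      have "p (y + s *\<^sub>R e) = p y" by (simp add: p_def algebra_simps inner_add_left ee)
      then show ?thesis by (simp add: \<psi>_def inner_diff_left inner_add_left ee)
    qed
    define C where "C = measure lborel (ball z (2 * \<rho>)) / \<rho> * (1 + L)"
    have "emeasure lborel {x \<in> D \<inter> ball z \<rho>. \<exists>y\<in>ball z \<rho> - D. dist x y < \<epsilon>} \<le> ennreal (C * \<epsilon>)"
      if "\<epsilon> > 0" for \<epsilon>
    proof -
      have "{x \<in> D \<inter> ball z \<rho>. \<exists>y\<in>ball z \<rho> - D. dist x y < \<epsilon>}
          \<subseteq> {y \<in> ball z \<rho>. 0 < \<psi> y \<and> \<psi> y \<le> (1 + L) * \<epsilon>}"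
      proof safe
        fix x y assume xy: "x \<in> D" "x \<in> ball z \<rho>" "y \<in> ball z \<rho>" "y \<notin> D" "dist x y < \<epsilon>"
        have "y \<notin> D \<inter> ball z \<rho>" using xy by simp
        then have "\<psi> y \<le> 0" using xy(3) unfolding D \<psi>_def p_def by auto
        have "x \<in> D \<inter> ball z \<rho>" using xy by simp
        then show "0 < \<psi> x" unfolding D \<psi>_def p_def by auto
        have "(1 + L) * dist x y \<le> (1 + L) * \<epsilon>" using xy L by (intro mult_left_mono) auto
        then show "\<psi> x \<le> (1 + L) * \<epsilon>" using lip[of x y] \<open>\<psi> y \<le> 0\<close> by linarith
      qed
      then have "emeasure lborel {x \<in> D \<inter> ball z \<rho>. \<exists>y\<in>ball z \<rho> - D. dist x y < \<epsilon>}
          \<le> emeasure lborel {y \<in> ball z \<rho>. 0 < \<psi> y \<and> \<psi> y \<le> (1 + L) * \<epsilon>}"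
        using meas by (intro emeasure_mono) auto
      also have "\<dots> \<le> ennreal (measure lborel (ball z (2 * \<rho>)) / \<rho> * ((1 + L) * \<epsilon>))"
        using that L \<rho> by (intro emeasure_graph_layer_le[OF e shift meas]) auto
      finally show ?thesis by (simp add: C_def algebra_simps)
    qed
    moreover have "C \<ge> 0" using L \<rho> by (simp add: C_def)
    ultimately show ?thesis by blast
  qed
  then have "\<exists>C. \<forall>z\<in>frontier D. C z \<ge> 0 \<and> (\<forall>\<epsilon>>0.
      emeasure lborel {x \<in> D \<inter> ball z \<rho>. \<exists>y\<in>ball z \<rho> - D. dist x y < \<epsilon>} \<le> ennreal (C z * \<epsilon>))"
    by (intro bchoice ballI)
  then obtain C where C: "\<And>z. z \<in> frontier D \<Longrightarrow> C z \<ge> 0"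
    "\<And>z \<epsilon>. z \<in> frontier D \<Longrightarrow> \<epsilon> > 0 \<Longrightarrow>
      emeasure lborel {x \<in> D \<inter> ball z \<rho>. \<exists>y\<in>ball z \<rho> - D. dist x y < \<epsilon>} \<le> ennreal (C z * \<epsilon>)"
    by blast
  have "compact (frontier D)" using bdd by (rule compact_frontier_bounded)
  \<comment> \<open>Half the chart radius leaves room: for \<epsilon> < \<rho> / 2, a frontier point
    in such a ball and every point within \<epsilon> of it lie in the full chart ball. As
    \<open>D\<close> is open, the frontier point itself serves as the nearby point outside
    \<open>D\<close>.\<close>
  then obtain F where F: "F \<subseteq> frontier D" "finite F" "frontier D \<subseteq> (\<Union>z\<in>F. ball z (\<rho> / 2))"
    by (rule compactE_image[of _ "frontier D" "\<lambda>z. ball z (\<rho> / 2)"]) (use \<rho> in auto)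
  have [measurable]: "D \<in> sets borel" using \<open>open D\<close> by simp
  have layer_sets: "{x \<in> D \<inter> ball z \<rho>. \<exists>y\<in>ball z \<rho> - D. dist x y < \<epsilon>} \<in> sets borel" for z \<epsilon>
  proof -
    have "{x \<in> D \<inter> ball z \<rho>. \<exists>y\<in>ball z \<rho> - D. dist x y < \<epsilon>} =
        D \<inter> ball z \<rho> \<inter> (\<Union>y\<in>ball z \<rho> - D. ball y \<epsilon>)"
      by (auto simp: dist_commute)
    then show ?thesis using \<open>open D\<close> by (auto intro!: borel_open)
  qed
  have Dfin: "emeasure lborel D < \<infinity>" using bdd by (rule emeasure_bounded_finite)
  \<comment> \<open>The second summand is for \<epsilon> \<ge> \<rho> / 2, where the whole volume of
    \<open>D\<close> is already below 2 |D| \<epsilon> / \<rho>.\<close>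
  define K where "K = (\<Sum>z\<in>F. C z) + 2 * measure lborel D / \<rho>"
  have Csum: "(\<Sum>z\<in>F. C z) \<ge> 0" using C(1) F(1) by (intro sum_nonneg) auto
  have "emeasure lborel {x \<in> D. infdist x (- D) < \<epsilon>} \<le> ennreal (K * \<epsilon>)" if "\<epsilon> > 0" for \<epsilon>
  proof (cases "\<epsilon> < \<rho> / 2")
    case True
    have "{x \<in> D. infdist x (- D) < \<epsilon>} \<subseteq> (\<Union>z\<in>F. {x \<in> D \<inter> ball z \<rho>. \<exists>y\<in>ball z \<rho> - D. dist x y < \<epsilon>})"
    proof safe
      fix x assume x: "x \<in> D" "infdist x (- D) < \<epsilon>"
      obtain y where y: "y \<in> frontier D" "dist x y < \<epsilon>"
        using frontier_point_near[OF x(1) ne x(2)] .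
      then obtain z where z: "z \<in> F" "dist z y < \<rho> / 2" using F(3) by auto
      have "y \<notin> D" using y(1) \<open>open D\<close> by (simp add: frontier_def interior_open)
      moreover have "dist z x < \<rho>" using z y True dist_triangle[of z x y] by (simp add: dist_commute)
      moreover have "dist z y < \<rho>" using z \<rho> by simp
      ultimately have "x \<in> {x \<in> D \<inter> ball z \<rho>. \<exists>y\<in>ball z \<rho> - D. dist x y < \<epsilon>}"
        using x(1) y(2) by (auto intro!: bexI[of _ y])
      then show "x \<in> (\<Union>z\<in>F. {x \<in> D \<inter> ball z \<rho>. \<exists>y\<in>ball z \<rho> - D. dist x y < \<epsilon>})"
        using z(1) by (rule UN_I[rotated])
    qed
    then have "emeasure lborel {x \<in> D. infdist x (- D) < \<epsilon>} \<le>
        emeasure lborel (\<Union>z\<in>F. {x \<in> D \<inter> ball z \<rho>. \<exists>y\<in>ball z \<rho> - D. dist x y < \<epsilon>})"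
      using layer_sets F(2) by (intro emeasure_mono) (auto intro!: sets.finite_UN)
    also have "\<dots> \<le> (\<Sum>z\<in>F. emeasure lborel {x \<in> D \<inter> ball z \<rho>. \<exists>y\<in>ball z \<rho> - D. dist x y < \<epsilon>})"
      using layer_sets F(2) by (intro emeasure_subadditive_finite) auto
    also have "\<dots> \<le> (\<Sum>z\<in>F. ennreal (C z * \<epsilon>))"
      using C(2) F(1) that by (intro sum_mono) auto
    also have "\<dots> = ennreal ((\<Sum>z\<in>F. C z) * \<epsilon>)"
      using C(1) F(1) that by (subst sum_ennreal) (auto simp: sum_distrib_right)
    also have "\<dots> \<le> ennreal (K * \<epsilon>)"
      using that \<rho> by (intro ennreal_leI mult_right_mono) (auto simp: K_def)
    finally show ?thesis .
  next
    case False
    have "emeasure lborel {x \<in> D. infdist x (- D) < \<epsilon>} \<le> emeasure lborel D"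
      by (intro emeasure_mono) auto
    also have "\<dots> = ennreal (measure lborel D)"
      using Dfin by (intro emeasure_eq_ennreal_measure) auto
    also have "measure lborel D \<le> 2 * measure lborel D / \<rho> * \<epsilon>"
      using False \<rho> mult_left_mono[of "\<rho> / 2" \<epsilon> "measure lborel D"] by (simp add: field_simps)
    also have "\<dots> \<le> K * \<epsilon>"
      using that Csum by (intro mult_right_mono) (auto simp: K_def)
    finally show ?thesis by (simp add: ennreal_leI)
  qed
  moreover have "K \<ge> 0" using Csum \<rho> by (simp add: K_def)
  ultimately show ?thesis using that by blast
qed

text \<open>Dyadic layers of the distance: layer k carries values of order 2^(\<alpha> k) on a set
  of volume at most C 2^(-k), so the total is a geometric series of ratio 2^(\<alpha> - 1),
  convergent since \<alpha> < 1. Points at distance 1 or more contribute at most the volume of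
  \<open>D\<close>.\<close>

lemma nn_integral_infdist_powr_finite:
  fixes D :: "'a::euclidean_space set"
  assumes D: "open D" "emeasure lborel D < \<infinity>" and \<alpha>: "0 < \<alpha>" "\<alpha> < 1"
    and C: "C \<ge> 0" "\<And>\<epsilon>. \<epsilon> > 0 \<Longrightarrow> emeasure lborel {x \<in> D. infdist x (- D) < \<epsilon>} \<le> ennreal (C * \<epsilon>)"
  shows "(\<integral>\<^sup>+x\<in>D. ennreal (infdist x (- D) powr (- \<alpha>)) \<partial>lborel) < \<infinity>"
proof -
  define A where "A k = {x \<in> D. infdist x (- D) < (1/2) ^ k}" for k :: nat
  have ne: "- D \<noteq> {}"
  proof
    assume "- D = {}"
    then have "D = UNIV" by auto
    then show False using D(2) by simp
  qed
  have [measurable]: "D \<in> sets borel" using D(1) by simp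
  have "(\<lambda>x. infdist x (- D)) \<in> borel_measurable borel"
    by (intro borel_measurable_continuous_onI continuous_intros)
  then have [measurable]: "A k \<in> sets borel" for k
    unfolding A_def by measurable
  \<comment> \<open>On \<open>A k\<close> outside \<open>A (Suc k)\<close> the distance is at least
    2^(-(k+1)), hence \<open>Suc k\<close> in the exponent. The least m with 2^(-m) below the
    distance is this k + 1.\<close>
  define c where "c k = 2 powr (\<alpha> * real (Suc k))" for k
  have bound: "ennreal (infdist x (- D) powr (- \<alpha>)) * indicator D x
      \<le> indicator D x + (\<Sum>k. ennreal (c k) * indicator (A k) x)" for x
  proof (cases "x \<in> D \<and> infdist x (- D) < 1")
    case False
    have "infdist x (- D) powr (- \<alpha>) \<le> 1 powr (- \<alpha>)" if "infdist x (- D) \<ge> 1"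
      using that \<alpha> by (intro powr_mono2') auto
    then show ?thesis using False
      by (auto simp: indicator_def intro!: add_increasing2)
  next
    case True
    have "x \<notin> - D" using True by simp
    then have "infdist x (- D) > 0"
      using D(1) ne by (metis closed_Compl infdist_nonneg in_closed_iff_infdist_zero less_eq_real_def)
    then obtain n where n: "(1/2::real) ^ n < infdist x (- D)"
      using real_arch_pow_inv[of "infdist x (- D)" "1/2"] by auto
    define m where "m = (LEAST n. (1/2::real) ^ n \<le> infdist x (- D))"
    have m: "(1/2::real) ^ m \<le> infdist x (- D)" unfolding m_def
      by (rule LeastI[of _ n]) (use n in simp)
    have "m \<noteq> 0" using m True by (intro notI) simp
    then obtain k where k: "m = Suc k" by (cases m) auto
    have "\<not> (1/2::real) ^ k \<le> infdist x (- D)"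
      using not_less_Least[of k "\<lambda>n. (1/2::real) ^ n \<le> infdist x (- D)"] k m_def by simp
    then have xA: "x \<in> A k" using True by (simp add: A_def)
    have "infdist x (- D) powr (- \<alpha>) \<le> ((1/2) ^ m) powr (- \<alpha>)"
      using m \<alpha> by (intro powr_mono2') auto
    also have "\<dots> = c k"
    proof -
      have "(1/2::real) ^ m = 2 powr (- real m)" by (simp add: powr_minus powr_realpow power_one_over inverse_eq_divide)
      then show ?thesis by (simp add: c_def k powr_powr mult.commute del: of_nat_Suc)
    qed
    finally have "ennreal (infdist x (- D) powr (- \<alpha>)) \<le> (\<Sum>k\<in>{k}. ennreal (c k) * indicator (A k) x)"
      using xA by (simp add: ennreal_leI)
    also have "\<dots> \<le> (\<Sum>k. ennreal (c k) * indicator (A k) x)"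
      by (intro sum_le_suminf) auto
    finally show ?thesis using True by (simp add: add_increasing)
  qed
  have "(\<integral>\<^sup>+x\<in>D. ennreal (infdist x (- D) powr (- \<alpha>)) \<partial>lborel)
      \<le> (\<integral>\<^sup>+x. indicator D x + (\<Sum>k. ennreal (c k) * indicator (A k) x) \<partial>lborel)"
    by (intro nn_integral_mono bound)
  also have "\<dots> = emeasure lborel D + (\<Sum>k. ennreal (c k) * emeasure lborel (A k))"
    by (simp add: nn_integral_add nn_integral_suminf nn_integral_cmult)
  also have "\<dots> \<le> emeasure lborel D + (\<Sum>k. ennreal (c k * (C * (1/2) ^ k)))"
    using C by (intro add_left_mono suminf_le)
      (auto simp: A_def ennreal_mult c_def intro!: mult_left_mono)
  also have "(\<lambda>k. c k * (C * (1/2) ^ k)) = (\<lambda>k. 2 powr \<alpha> * C * (2 powr (\<alpha> - 1)) ^ k)"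
    by (auto simp: c_def fun_eq_iff powr_realpow[symmetric] powr_powr powr_add[symmetric]
        powr_divide field_simps powr_diff powr_minus)
  also have "(\<Sum>k. ennreal (2 powr \<alpha> * C * (2 powr (\<alpha> - 1)) ^ k)) < \<infinity>"
  proof -
    have "2 powr (\<alpha> - 1) < 2 powr (0::real)" using \<alpha> by (intro powr_less_mono) auto
    then have "summable (\<lambda>k. 2 powr \<alpha> * C * (2 powr (\<alpha> - 1)) ^ k)"
      by (intro summable_mult summable_geometric) simp
    then show ?thesis using C(1) by (subst suminf_ennreal2) auto
  qed
  finally show ?thesis using D(2) by simp
qed

section \<open>Self-similar sets\<close>

lemma DIM_1_obtain:
  assumes "DIM('a::euclidean_space) = 1"
  obtains i :: "'a::euclidean_space" where "Basis = {i}" "norm i = 1" "\<And>x. x = (x \<bullet> i) *\<^sub>R i"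
proof -
  obtain i :: 'a where i: "Basis = {i}" using assms card_1_singletonE by blast
  moreover have "norm i = 1" by (intro norm_Basis) (simp add: i)
  moreover have "x = (x \<bullet> i) *\<^sub>R i" for x
  proof -
    have "(\<Sum>b\<in>{i}. (x \<bullet> b) *\<^sub>R b) = x"
      unfolding i[symmetric] by (rule euclidean_representation)
    then show ?thesis by simp
  qed
  ultimately show ?thesis using that by blast
qed

text \<open>Lets the one-dimensional hypothesis be treated together with the others. With the length
  of the interval as chart radius, a ball around one endpoint does not reach past the other, so
  there the interval is a half-line and the zero function describes its boundary.\<close>

lemma C11_open_set_box:
  fixes p q :: "'a::euclidean_space"
  assumes dim: "DIM('a) = 1" and ne: "box p q \<noteq> {}"
  shows "C11_open_set (box p q)"
proof -
  obtain i :: 'a where i: "Basis = {i}" "norm i = 1" and rep: "\<And>x. x = (x \<bullet> i) *\<^sub>R i"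
    using DIM_1_obtain[OF dim] by blast
  define \<rho> where "\<rho> = (q - p) \<bullet> i"
  have pos: "\<rho> > 0" using ne i by (auto simp: box_ne_empty \<rho>_def inner_diff_left)
  have box: "y \<in> box p q \<longleftrightarrow> p \<bullet> i < y \<bullet> i \<and> y \<bullet> i < q \<bullet> i" for y
    by (simp add: mem_box i)
  have dist: "dist x y = \<bar>(x - y) \<bullet> i\<bar>" for x y
    by (subst dist_norm, subst rep[of "x - y"]) (simp add: i)
  have fr: "z = p \<or> z = q" if "z \<in> frontier (box p q)" for z
  proof -
    have "z \<in> cbox p q - box p q" using that ne by (simp add: frontier_box)
    then have "z \<bullet> i = p \<bullet> i \<or> z \<bullet> i = q \<bullet> i" by (auto simp: box mem_box i)
    then show ?thesis using rep[of z] rep[of p] rep[of q] by metis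
  qed
  have half: "\<exists>e. norm e = 1 \<and> box p q \<inter> ball z \<rho> = {y \<in> ball z \<rho>. (y - z) \<bullet> e > 0}"
    if z: "z \<in> frontier (box p q)" for z
    using fr[OF z]
  proof
    assume "z = p"
    then show ?thesis using i
      by (intro exI[of _ i]) (auto simp: box dist \<rho>_def inner_diff_left)
  next
    assume "z = q"
    then show ?thesis using i
      by (intro exI[of _ "- i"]) (auto simp: box dist \<rho>_def inner_diff_left)
  qed
  show ?thesis
    unfolding C11_open_set_def Let_def
  proof (rule conjI, rule open_box, rule exI[of _ \<rho>], rule conjI, rule pos, rule exI[of _ "1::real"],
      rule conjI, simp, rule ballI)
    fix z assume "z \<in> frontier (box p q)"
    then obtain e where "norm e = 1" "box p q \<inter> ball z \<rho> = {y \<in> ball z \<rho>. (y - z) \<bullet> e > 0}"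
      using half by blast
    then show "\<exists>e \<phi> g. norm e = 1 \<and> \<phi> 0 = (0::real) \<and> g 0 = 0 \<and>
        (\<forall>v\<in>{v. v \<bullet> e = 0}. g v \<in> {v. v \<bullet> e = 0} \<and> norm (g v) \<le> 1 \<and>
           (\<phi> has_derivative (\<lambda>h. g v \<bullet> h)) (at v within {v. v \<bullet> e = 0})) \<and>
        1-lipschitz_on {v. v \<bullet> e = 0} g \<and>
        box p q \<inter> ball z \<rho> =
          {y \<in> ball z \<rho>. (y - z) \<bullet> e > \<phi> ((y - z) - ((y - z) \<bullet> e) *\<^sub>R e)}"
      by (intro exI[of _ e] exI[of _ "\<lambda>_. 0"]) (auto simp: lipschitz_on_def)
  qed
qed

text \<open>Weights that are multiplicative along words turn level n into an n-th power. This is the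
  source of the geometric series over word lengths.\<close>

lemma sum_words:
  fixes f :: "'b \<Rightarrow> 'c::comm_semiring_1"
  assumes "finite A"
  shows "(\<Sum>w\<in>{w. set w \<subseteq> A \<and> length w = n}. prod_list (map f w)) = (\<Sum>j\<in>A. f j) ^ n"
proof (induction n)
  case 0
  have "{w. set w \<subseteq> A \<and> length w = 0} = {[]}" by auto
  then show ?case by simp
next
  case (Suc n)
  have "(\<Sum>w\<in>{w. set w \<subseteq> A \<and> length w = Suc n}. prod_list (map f w))
      = (\<Sum>(w, j)\<in>{w. set w \<subseteq> A \<and> length w = n} \<times> A. f j * prod_list (map f w))"
    unfolding lists_length_Suc_eq
    by (subst sum.reindex) (auto simp: inj_on_def case_prod_unfold)
  also have "\<dots> = (\<Sum>w\<in>{w. set w \<subseteq> A \<and> length w = n}. prod_list (map f w)) * (\<Sum>j\<in>A. f j)"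
    by (simp add: sum.cartesian_product[symmetric] sum_distrib_left sum_distrib_right mult.commute)
  finally show ?case using Suc by (simp add: mult.commute)
qed

text \<open>Common skeleton of two finiteness results, the volume of \<open>G\<close> with weights
  r^d and the integral of a distance power with weights r^(d-\<alpha>). On the union, \<Phi> is at
  most the sum of all majorants \<open>\<psi> w\<close>. Sorted by length, level n contributes at
  most the n-th power of the weight sum times \<open>C\<close>.\<close>

lemma nn_integral_words_finite:
  fixes \<Phi> :: "'a::euclidean_space \<Rightarrow> ennreal" and s :: "nat \<Rightarrow> real"
  assumes A: "finite A" and s: "\<And>j. j \<in> A \<Longrightarrow> 0 \<le> s j" "(\<Sum>j\<in>A. s j) < 1"
    and [measurable]: "\<And>w. w \<in> lists A \<Longrightarrow> \<psi> w \<in> borel_measurable lborel"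
    and le: "\<And>w x. w \<in> lists A \<Longrightarrow> x \<in> S w \<Longrightarrow> \<Phi> x \<le> \<psi> w x"
    and int: "\<And>w. w \<in> lists A \<Longrightarrow> (\<integral>\<^sup>+x. \<psi> w x \<partial>lborel) \<le> ennreal (prod_list (map s w)) * C"
    and C: "C < \<infinity>"
  shows "(\<integral>\<^sup>+x\<in>(\<Union>w\<in>lists A. S w). \<Phi> x \<partial>lborel) < \<infinity>"
proof -
  define T where "T n = {w. set w \<subseteq> A \<and> length w = n}" for n
  have T: "finite (T n)" "w \<in> T n \<Longrightarrow> w \<in> lists A" for n w
    using A finite_lists_length_eq by (auto simp: T_def)
  have prod: "0 \<le> prod_list (map s w)" if "w \<in> lists A" for w
    using that s(1) by (induction w) auto
  have "\<Phi> x * indicator (\<Union>w\<in>lists A. S w) x \<le> (\<Sum>n. \<Sum>w\<in>T n. \<psi> w x)" for x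
  proof (cases "x \<in> (\<Union>w\<in>lists A. S w)")
    case True
    then obtain w where w: "w \<in> lists A" "x \<in> S w" by auto
    then have wT: "w \<in> T (length w)" by (auto simp: T_def)
    have "\<Phi> x \<le> \<psi> w x" using le w by blast
    also have "\<dots> \<le> (\<Sum>w\<in>T (length w). \<psi> w x)"
      using T(1) wT by (intro member_le_sum) auto
    also have "\<dots> = (\<Sum>n\<in>{length w}. \<Sum>w\<in>T n. \<psi> w x)" by simp
    also have "\<dots> \<le> (\<Sum>n. \<Sum>w\<in>T n. \<psi> w x)" by (intro sum_le_suminf) auto
    finally show ?thesis using True by simp
  qed simp
  then have "(\<integral>\<^sup>+x\<in>(\<Union>w\<in>lists A. S w). \<Phi> x \<partial>lborel) \<le> (\<integral>\<^sup>+x. (\<Sum>n. \<Sum>w\<in>T n. \<psi> w x) \<partial>lborel)"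
    by (intro nn_integral_mono)
  also have "\<dots> = (\<Sum>n. \<integral>\<^sup>+x. (\<Sum>w\<in>T n. \<psi> w x) \<partial>lborel)"
    using T(2) by (intro nn_integral_suminf borel_measurable_sum) auto
  also have "\<dots> = (\<Sum>n. \<Sum>w\<in>T n. \<integral>\<^sup>+x. \<psi> w x \<partial>lborel)"
    using T by (intro suminf_cong nn_integral_sum) auto
  also have "\<dots> \<le> (\<Sum>n. \<Sum>w\<in>T n. ennreal (prod_list (map s w)) * C)"
    using int T(2) by (intro suminf_le sum_mono) auto
  also have "\<dots> = (\<Sum>n. ennreal ((\<Sum>j\<in>A. s j) ^ n)) * C"
  proof -
    have "(\<Sum>w\<in>T n. ennreal (prod_list (map s w)) * C) = ennreal ((\<Sum>j\<in>A. s j) ^ n) * C" for n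
    proof -
      have "(\<Sum>w\<in>T n. ennreal (prod_list (map s w))) = ennreal (\<Sum>w\<in>T n. prod_list (map s w))"
        using prod T(2) by (intro sum_ennreal) auto
      also have "(\<Sum>w\<in>T n. prod_list (map s w)) = (\<Sum>j\<in>A. s j) ^ n"
        unfolding T_def by (rule sum_words[OF A])
      finally show ?thesis by (simp add: sum_distrib_right[symmetric])
    qed
    then show ?thesis by (simp add: ennreal_suminf_multc)
  qed
  finally have le_C: "(\<integral>\<^sup>+x\<in>(\<Union>w\<in>lists A. S w). \<Phi> x \<partial>lborel) \<le> (\<Sum>n. ennreal ((\<Sum>j\<in>A. s j) ^ n)) * C" .
  have "(\<Sum>n. ennreal ((\<Sum>j\<in>A. s j) ^ n)) < \<infinity>"
  proof -
    have "0 \<le> (\<Sum>j\<in>A. s j)" using s(1) by (intro sum_nonneg) auto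
    moreover from this have "summable (\<lambda>n. (\<Sum>j\<in>A. s j) ^ n)"
      using s(2) by (intro summable_geometric) auto
    ultimately show ?thesis by (subst suminf_ennreal2) auto
  qed
  then have "(\<Sum>n. ennreal ((\<Sum>j\<in>A. s j) ^ n)) * C < \<infinity>" using C by (auto simp: ennreal_mult_less_top)
  with le_C show ?thesis by (rule le_less_trans)
qed

lemma similitude_compose_word:
  assumes "\<And>j. j \<in> A \<Longrightarrow> similitude (R j) (r j)" "w \<in> lists A"
  shows "similitude (compose_word R w) (prod_list (map r w))"
  using assms(2)
proof (induction w)
  case Nil
  then show ?case by (simp add: compose_word_def similitude_def)
next
  case (Cons j w)
  have "similitude (R j \<circ> compose_word R w) (r j * prod_list (map r w))"
    using Cons by (intro similitude_comp assms(1)) auto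
  then show ?case by (simp add: compose_word_def comp_def)
qed

text \<open>The empty word yields \<open>G0\<close> itself, which absorbs the separate member of the
  union in the definition.\<close>

lemma self_similar_set_eq_words:
  "self_similar_set R N G0 = (\<Union>w\<in>lists {1..N}. compose_word R w ` G0)"
proof -
  have nil: "compose_word R [] ` G0 = G0" by (simp add: compose_word_def)
  have "x \<in> self_similar_set R N G0" if "w \<in> lists {1..N}" "x \<in> compose_word R w ` G0" for w x
  proof (cases w)
    case Nil
    then show ?thesis using that(2) nil by (simp add: self_similar_set_def)
  next
    case Cons
    then have "length w \<in> {1..}" by simp
    then show ?thesis using that unfolding self_similar_set_def lists_eq_set by blast
  qed
  moreover have "G0 \<subseteq> (\<Union>w\<in>lists {1..N}. compose_word R w ` G0)" using nil by blast
  ultimately show ?thesis unfolding self_similar_set_def lists_eq_set by blast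
qed

lemma prod_list_map_power: "prod_list (map (\<lambda>j. f j ^ n) w) = prod_list (map f w) ^ n"
  for f :: "'b \<Rightarrow> 'c::comm_monoid_mult"
  by (induction w) (simp_all add: power_mult_distrib)

lemma prod_list_map_powr:
  fixes r :: "'b \<Rightarrow> real"
  assumes "\<And>j. j \<in> set w \<Longrightarrow> 0 < r j"
  shows "prod_list (map (\<lambda>j. r j powr a) w) = prod_list (map r w) powr a"
  using assms by (induction w) (simp_all add: powr_mult prod_list_nonneg less_imp_le)

text \<open>The change of variables contributes r^d and the scaling of distances r^(-\<alpha>).
  Bijectivity makes the complement of the image the image of the complement.\<close>

lemma nn_integral_infdist_similitude_image:
  fixes \<phi> :: "'a::euclidean_space \<Rightarrow> 'a"
  assumes \<phi>: "similitude \<phi> r" and D: "open D"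
  shows "(\<integral>\<^sup>+x\<in>\<phi> ` D. ennreal (infdist x (- (\<phi> ` D)) powr (- \<alpha>)) \<partial>lborel)
    = ennreal (r powr (real DIM('a) - \<alpha>)) * (\<integral>\<^sup>+x\<in>D. ennreal (infdist x (- D) powr (- \<alpha>)) \<partial>lborel)"
proof -
  note r = similitude_pos[OF \<phi>]
  have bij: "bij \<phi>" by (rule similitude_bij[OF \<phi>])
  have [measurable]: "D \<in> sets borel" "\<phi> ` D \<in> sets borel"
    using similitude_image_open[OF \<phi> D] D by auto
  have [measurable]: "(\<lambda>x. infdist x B) \<in> borel_measurable borel" for B :: "'a set"
    by (intro borel_measurable_continuous_onI continuous_intros)
  have eq: "ennreal (infdist (\<phi> x) (- (\<phi> ` D)) powr (- \<alpha>)) * indicator (\<phi> ` D) (\<phi> x)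
      = ennreal (r powr (- \<alpha>)) * (ennreal (infdist x (- D) powr (- \<alpha>)) * indicator D x)" for x
  proof -
    have "- (\<phi> ` D) = \<phi> ` (- D)" using bij by (simp add: bij_image_Compl_eq)
    then have "infdist (\<phi> x) (- (\<phi> ` D)) = r * infdist x (- D)"
      by (simp add: infdist_similitude[OF \<phi>])
    moreover have "indicator (\<phi> ` D) (\<phi> x) = (indicator D x :: ennreal)"
      using bij by (auto simp: indicator_def bij_def inj_image_mem_iff)
    ultimately show ?thesis
      using r infdist_nonneg[of x "- D"]
      by (simp add: powr_mult ennreal_mult' mult.assoc[symmetric])
  qed
  have "(\<integral>\<^sup>+x\<in>\<phi> ` D. ennreal (infdist x (- (\<phi> ` D)) powr (- \<alpha>)) \<partial>lborel)
      = ennreal (r ^ DIM('a)) * (\<integral>\<^sup>+x. ennreal (infdist (\<phi> x) (- (\<phi> ` D)) powr (- \<alpha>)) * indicator (\<phi> ` D) (\<phi> x) \<partial>lborel)"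
    by (rule nn_integral_similitude[OF \<phi>]) measurable
  also have "\<dots> = ennreal (r ^ DIM('a)) * (ennreal (r powr (- \<alpha>)) *
      (\<integral>\<^sup>+x\<in>D. ennreal (infdist x (- D) powr (- \<alpha>)) \<partial>lborel))"
    unfolding eq by (subst nn_integral_cmult) auto
  also have "\<dots> = ennreal (r ^ DIM('a) * r powr (- \<alpha>)) * (\<integral>\<^sup>+x\<in>D. ennreal (infdist x (- D) powr (- \<alpha>)) \<partial>lborel)"
    using r by (simp add: ennreal_mult mult.assoc)
  also have "r ^ DIM('a) * r powr (- \<alpha>) = r powr (real DIM('a) - \<alpha>)"
    using r by (simp add: powr_realpow[symmetric] powr_add[symmetric])
  finally show ?thesis .
qed

lemma self_similar_set_open:
  assumes "\<And>j. j \<in> {1..N} \<Longrightarrow> similitude (R j) (r j)" "open G0"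
  shows "open (self_similar_set R N G0)"
  unfolding self_similar_set_eq_words
  by (intro open_UN ballI similitude_image_open[OF similitude_compose_word[OF assms(1)] assms(2)])

lemma emeasure_self_similar_set_finite:
  fixes R :: "nat \<Rightarrow> 'a::euclidean_space \<Rightarrow> 'a"
  assumes sim: "\<And>j. j \<in> {1..N} \<Longrightarrow> similitude (R j) (r j)" and G0: "open G0" "bounded G0"
    and sum: "(\<Sum>j=1..N. r j ^ DIM('a)) < 1"
  shows "emeasure lborel (self_similar_set R N G0) < \<infinity>"
proof -
  have "(\<integral>\<^sup>+x\<in>(\<Union>w\<in>lists {1..N}. compose_word R w ` G0). 1 \<partial>lborel) < \<infinity>"
  proof (rule nn_integral_words_finite[OF _ _ sum, where C = "emeasure lborel G0"
        and \<psi> = "\<lambda>w. indicator (compose_word R w ` G0)"])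
    fix w assume w: "w \<in> lists {1..N}"
    note sw = similitude_compose_word[OF sim w]
    note op = similitude_image_open[OF sw G0(1)]
    show "indicator (compose_word R w ` G0) \<in> borel_measurable lborel" using op by simp
    show "(\<integral>\<^sup>+x. indicator (compose_word R w ` G0) x \<partial>lborel)
        \<le> ennreal (prod_list (map (\<lambda>j. r j ^ DIM('a)) w)) * emeasure lborel G0"
      using op emeasure_similitude_image_open[OF sw G0(1)]
      by (simp add: prod_list_map_power)
  qed (use emeasure_bounded_finite[OF G0(2)] similitude_pos[OF sim] in \<open>auto simp: less_imp_le\<close>)
  then show ?thesis
    using self_similar_set_open[OF sim G0(1)] by (simp add: self_similar_set_eq_words)
qed

text \<open>The hypothesis \<open>le\<close> is applied with \<open>D\<close> a copy of
  \<open>G0\<close> along a word. The distance to the complement of the copy is at most the distance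
  to the complement of the whole set, so the bound is weaker, but it scales exactly and its integral
  is known.\<close>

lemma nn_integral_infdist_self_similar_finite:
  fixes R :: "nat \<Rightarrow> 'a::euclidean_space \<Rightarrow> 'a"
  assumes sim: "\<And>j. j \<in> {1..N} \<Longrightarrow> similitude (R j) (r j)"
    and G0: "C11_open_set G0" "bounded G0"
    and sum: "(\<Sum>j=1..N. r j powr (real DIM('a) - \<alpha>)) < 1" and \<alpha>: "0 < \<alpha>" "\<alpha> < 1" and "K \<ge> 0"
    and le: "\<And>D x. open D \<Longrightarrow> D \<subseteq> self_similar_set R N G0 \<Longrightarrow> x \<in> D \<Longrightarrow> infdist x (- D) > 0
      \<Longrightarrow> \<Phi> x \<le> ennreal (K * infdist x (- D) powr (- \<alpha>))"
  shows "(\<integral>\<^sup>+x\<in>self_similar_set R N G0. \<Phi> x \<partial>lborel) < \<infinity>"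
proof -
  have op: "open G0" using G0(1) by (simp add: C11_open_set_def)
  define I where "I = (\<integral>\<^sup>+x\<in>G0. ennreal (infdist x (- G0) powr (- \<alpha>)) \<partial>lborel)"
  have I: "I < \<infinity>"
  proof -
    obtain C where C: "C \<ge> 0"
      "\<And>\<epsilon>. \<epsilon> > 0 \<Longrightarrow> emeasure lborel {x \<in> G0. infdist x (- G0) < \<epsilon>} \<le> ennreal (C * \<epsilon>)"
      by (rule C11_collar[OF G0(2,1)]) blast
    show ?thesis
      unfolding I_def by (rule nn_integral_infdist_powr_finite[OF op emeasure_bounded_finite[OF G0(2)] \<alpha> C])
  qed
  have ne: "- G0 \<noteq> {}" using G0(2) not_bounded_UNIV by (metis Compl_empty_eq double_complement)
  show ?thesis unfolding self_similar_set_eq_words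
  proof (rule nn_integral_words_finite[OF _ _ sum, where C = "ennreal K * I"
        and \<psi> = "\<lambda>w x. ennreal (K * infdist x (- (compose_word R w ` G0)) powr (- \<alpha>))
          * indicator (compose_word R w ` G0) x"])
    fix w assume w: "w \<in> lists {1..N}"
    define \<phi> where "\<phi> = compose_word R w"
    have sw: "similitude \<phi> (prod_list (map r w))"
      unfolding \<phi>_def by (rule similitude_compose_word[OF sim w])
    note op' = similitude_image_open[OF sw op]
    have sub: "\<phi> ` G0 \<subseteq> self_similar_set R N G0"
      using w by (auto simp: self_similar_set_eq_words \<phi>_def)
    have [measurable]: "\<phi> ` G0 \<in> sets borel" using op' by simp
    have [measurable]: "(\<lambda>x. infdist x B) \<in> borel_measurable borel" for B :: "'a set"
      by (intro borel_measurable_continuous_onI continuous_intros)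
    show "(\<lambda>x. ennreal (K * infdist x (- (compose_word R w ` G0)) powr (- \<alpha>))
          * indicator (compose_word R w ` G0) x) \<in> borel_measurable lborel"
      unfolding \<phi>_def[symmetric] by measurable
    have "(\<integral>\<^sup>+x. ennreal (K * infdist x (- (\<phi> ` G0)) powr (- \<alpha>)) * indicator (\<phi> ` G0) x \<partial>lborel)
        = ennreal K * (\<integral>\<^sup>+x\<in>\<phi> ` G0. ennreal (infdist x (- (\<phi> ` G0)) powr (- \<alpha>)) \<partial>lborel)"
      using \<open>K \<ge> 0\<close> by (subst nn_integral_cmult[symmetric]) (auto simp: ennreal_mult' mult.assoc)
    also have "\<dots> = ennreal K * (ennreal (prod_list (map r w) powr (real DIM('a) - \<alpha>)) * I)"
      unfolding I_def nn_integral_infdist_similitude_image[OF sw op] ..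
    also have "prod_list (map r w) powr (real DIM('a) - \<alpha>)
        = prod_list (map (\<lambda>j. r j powr (real DIM('a) - \<alpha>)) w)"
      using w similitude_pos[OF sim] by (intro prod_list_map_powr[symmetric]) auto
    finally show "(\<integral>\<^sup>+x. ennreal (K * infdist x (- (compose_word R w ` G0)) powr (- \<alpha>))
          * indicator (compose_word R w ` G0) x \<partial>lborel)
        \<le> ennreal (prod_list (map (\<lambda>j. r j powr (real DIM('a) - \<alpha>)) w)) * (ennreal K * I)"
      by (simp add: \<phi>_def ac_simps)
    fix x assume "x \<in> compose_word R w ` G0"
    then have x: "x \<in> \<phi> ` G0" by (simp add: \<phi>_def)
    have "- (\<phi> ` G0) = \<phi> ` (- G0)" using similitude_bij[OF sw] by (simp add: bij_image_Compl_eq)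
    then have "- (\<phi> ` G0) \<noteq> {}" using ne by simp
    moreover have "x \<notin> - (\<phi> ` G0)" using x by simp
    ultimately have "infdist x (- (\<phi> ` G0)) > 0"
      using op' by (metis closed_Compl infdist_nonneg in_closed_iff_infdist_zero less_eq_real_def)
    from le[OF op' sub x this] x
    show "\<Phi> x \<le> ennreal (K * infdist x (- (compose_word R w ` G0)) powr (- \<alpha>))
          * indicator (compose_word R w ` G0) x"
      by (simp add: \<phi>_def)
  qed (use I in \<open>auto simp: ennreal_mult_less_top\<close>)
qed

section \<open>Stable subordinators\<close>

text \<open>Weierstrass: replace \<open>f\<close> by a uniformly close polynomial on [0, 1], for
  which convergence of moments suffices. The moment of order 0 keeps the total masses of
  \<open>w i\<close> eventually bounded, which controls the approximation error uniformly.\<close>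

lemma moment_convergence_imp_integral_tendsto:
  fixes X :: "'m \<Rightarrow> real" and w :: "'i \<Rightarrow> 'm \<Rightarrow> real" and f :: "real \<Rightarrow> real"
  assumes [measurable]: "X \<in> borel_measurable M" "f \<in> borel_measurable borel"
    and X: "\<And>v. 0 \<le> X v" "\<And>v. X v \<le> 1"
    and w: "\<And>i. integrable M (w i)" "\<And>i v. 0 \<le> w i v"
    and u: "integrable M u" "\<And>v. 0 \<le> u v"
    and moments: "\<And>k::nat. ((\<lambda>i. \<integral>v. X v ^ k * w i v \<partial>M) \<longlongrightarrow> (\<integral>v. X v ^ k * u v \<partial>M)) F"
    and f: "continuous_on {0..1} f"
  shows "((\<lambda>i. \<integral>v. f (X v) * w i v \<partial>M) \<longlongrightarrow> (\<integral>v. f (X v) * u v \<partial>M)) F"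
proof (rule tendstoI)
  fix \<epsilon> :: real assume "\<epsilon> > 0"
  define U where "U = (\<integral>v. u v \<partial>M)"
  \<comment> \<open>The three errors are e (U + 1) for the weights \<open>w i\<close>, whose mass is
    eventually below U + 1, then e for the polynomial, and e U for the limit weight. Together they
    stay strictly below e (2 U + 3) = \<epsilon>.\<close>
  define e where "e = \<epsilon> / (2 * U + 3)"
  have U: "U \<ge> 0" using u by (simp add: U_def)
  then have e: "e > 0" using \<open>\<epsilon> > 0\<close> by (simp add: e_def)
  obtain p where p: "real_polynomial_function p" "\<And>x. x \<in> {0..1} \<Longrightarrow> \<bar>f x - p x\<bar> < e"
    using Stone_Weierstrass_real_polynomial_function[OF _ f e] by auto
  obtain a n where pa: "p = (\<lambda>x. \<Sum>i\<le>n. a i * x ^ i)"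
    using p(1) by (auto simp: real_polynomial_function_iff_sum)
  have [measurable]: "p \<in> borel_measurable borel" unfolding pa by measurable
  have int_bdd: "integrable M (\<lambda>v. h (X v) * y v)"
    if [measurable]: "h \<in> borel_measurable borel" and y: "integrable M y"
      and h: "\<And>x. x \<in> {0..1} \<Longrightarrow> \<bar>h x\<bar> \<le> K" for h :: "real \<Rightarrow> real" and y K
  proof (rule Bochner_Integration.integrable_bound[of M "\<lambda>v. K * y v"])
    have "\<bar>h (X v)\<bar> * \<bar>y v\<bar> \<le> \<bar>K\<bar> * \<bar>y v\<bar>" for v
      using h[of "X v"] X by (intro mult_right_mono) auto
    then show "AE v in M. norm (h (X v) * y v) \<le> norm (K * y v)" by (simp add: abs_mult)
  qed (use y in auto)
  have pow: "integrable M (\<lambda>v. X v ^ k * y v)" if "integrable M y" for k y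
    using int_bdd[of "\<lambda>x. x ^ k" y 1] that by (simp add: power_le_one)
  have p_int: "integrable M (\<lambda>v. p (X v) * y v)"
    "(\<integral>v. p (X v) * y v \<partial>M) = (\<Sum>i\<le>n. a i * (\<integral>v. X v ^ i * y v \<partial>M))" if "integrable M y" for y
    using pow[OF that] by (simp_all add: pa sum_distrib_right mult.assoc)
  obtain K where K: "\<And>x. x \<in> {0..1} \<Longrightarrow> \<bar>f x\<bar> \<le> K"
    using compact_imp_bounded[OF compact_continuous_image[OF f compact_Icc]]
    unfolding bounded_iff by (metis image_eqI real_norm_def)
  have diff: "\<bar>(\<integral>v. f (X v) * y v \<partial>M) - (\<integral>v. p (X v) * y v \<partial>M)\<bar> \<le> e * (\<integral>v. y v \<partial>M)"
    if y: "integrable M y" "\<And>v. 0 \<le> y v" for y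
  proof -
    have fint: "integrable M (\<lambda>v. f (X v) * y v)" by (rule int_bdd[OF _ y(1) K]) auto
    have "\<bar>(\<integral>v. f (X v) * y v \<partial>M) - (\<integral>v. p (X v) * y v \<partial>M)\<bar>
        = \<bar>\<integral>v. (f (X v) - p (X v)) * y v \<partial>M\<bar>"
      using fint p_int(1)[OF y(1)] by (simp add: left_diff_distrib)
    also have "\<dots> \<le> (\<integral>v. \<bar>(f (X v) - p (X v)) * y v\<bar> \<partial>M)" by (rule integral_abs_bound)
    also have "\<dots> \<le> (\<integral>v. e * y v \<partial>M)"
    proof (rule integral_mono')
      show "\<bar>(f (X v) - p (X v)) * y v\<bar> \<le> e * y v" for v
        using p(2)[of "X v"] X y(2)[of v] by (auto simp: abs_mult intro!: mult_right_mono)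
    qed (use y e in auto)
    finally show ?thesis by simp
  qed
  have "((\<lambda>i. \<integral>v. p (X v) * w i v \<partial>M) \<longlongrightarrow> (\<integral>v. p (X v) * u v \<partial>M)) F"
    unfolding p_int(2)[OF w(1)] p_int(2)[OF u(1)] by (intro tendsto_intros moments)
  then have "\<forall>\<^sub>F i in F. dist (\<integral>v. p (X v) * w i v \<partial>M) (\<integral>v. p (X v) * u v \<partial>M) < e"
    using e by (rule tendstoD)
  moreover have "\<forall>\<^sub>F i in F. (\<integral>v. w i v \<partial>M) < U + 1"
    using order_tendstoD(2)[OF moments[of 0], of "U + 1"] by (simp add: U_def)
  ultimately show "\<forall>\<^sub>F i in F. dist (\<integral>v. f (X v) * w i v \<partial>M) (\<integral>v. f (X v) * u v \<partial>M) < \<epsilon>"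
  proof eventually_elim
    case (elim i)
    have "e * (\<integral>v. w i v \<partial>M) \<le> e * (U + 1)" using elim e by (intro mult_left_mono) auto
    moreover have "e * (U + 1) + e + e * U = e * (2 * U + 3) - e" by (simp add: algebra_simps)
    moreover have "e * (2 * U + 3) = \<epsilon>" using U by (simp add: e_def)
    moreover have "e * (\<integral>v. u v \<partial>M) = e * U" by (simp add: U_def)
    ultimately show ?case
      using diff[OF w(1,2), of i] diff[OF u] elim(1) e unfolding dist_real_def by linarith
  qed
qed

text \<open>Karamata's argument: integrate against a bump between \<open>exp (- b)\<close> and \<open>exp (- a)\<close>.\<close>

lemma eventually_sandwich_if_laplace_tendsto:
  fixes g :: "'i \<Rightarrow> real \<Rightarrow> real" and h :: "real \<Rightarrow> real"
  assumes [measurable]: "\<And>i. g i \<in> borel_measurable borel" "h \<in> borel_measurable borel"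
    and g: "\<And>i v. 0 < v \<Longrightarrow> 0 \<le> g i v" "\<And>i v v'. 0 < v \<Longrightarrow> v \<le> v' \<Longrightarrow> g i v' \<le> g i v"
    and h: "\<And>v. 0 < v \<Longrightarrow> 0 \<le> h v" "\<And>v v'. 0 < v \<Longrightarrow> v \<le> v' \<Longrightarrow> h v' \<le> h v"
    and int_g: "\<And>i. set_integrable lborel {0<..} (\<lambda>v. exp (- v) * g i v)"
    and int_h: "set_integrable lborel {0<..} (\<lambda>v. exp (- v) * h v)"
    and laplace: "\<And>k::nat. k \<ge> 1 \<Longrightarrow> ((\<lambda>i. LINT v:{0<..}|lborel. exp (- real k * v) * g i v) \<longlongrightarrow>
        (LINT v:{0<..}|lborel. exp (- real k * v) * h v)) F"
    and ab: "0 < a" "a < b" and "\<epsilon> > 0"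
  shows "\<forall>\<^sub>F i in F. g i b < h a + \<epsilon> \<and> h b - \<epsilon> < g i a"
proof -
  \<comment> \<open>Clipping at 0 keeps the values in [0, 1] for negative arguments too. For
    positive v the powers of \<open>X v\<close> are exponentials, so moments become Laplace
    transforms at integers.\<close>
  define X :: "real \<Rightarrow> real" where "X v = exp (- max 0 v)" for v
  \<comment> \<open>The extra factor exp(-v) makes the weight integrable and shifts the k-th moment
    to the Laplace transform at k + 1, so \<open>laplace\<close> is only asked for at k \<ge>
    1.\<close>
  define wt where "wt y v = indicator {0<..} v * (exp (- v) * y v)" for y :: "real \<Rightarrow> real" and v
  \<comment> \<open>A quadratic clipped at 0: continuous, as the approximation needs, and
    \<open>f (X v)\<close> is positive exactly for a < v < b.\<close>
  define f :: "real \<Rightarrow> real" where "f x = max 0 ((x - exp (- b)) * (exp (- a) - x))" for x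
  have [measurable]: "X \<in> borel_measurable borel" "f \<in> borel_measurable borel"
    unfolding X_def f_def by measurable
  have f0: "f (X v) = 0" if "v \<notin> {a<..<b}" for v
  proof -
    have "(exp (- max 0 v) - exp (- b)) * (exp (- a) - exp (- max 0 v)) \<le> 0"
      using that ab by (cases "v \<le> a") (auto intro: mult_nonneg_nonpos mult_nonpos_nonneg)
    then show ?thesis by (simp add: f_def X_def)
  qed
  have f1: "f (X v) > 0" if "v \<in> {a<..<b}" for v
    using that ab by (auto simp: f_def X_def less_max_iff_disj)
  have f2: "0 \<le> f (X v)" "f (X v) \<le> 1" for v
  proof -
    have "(X v - exp (- b)) * (exp (- a) - X v) \<le> 1" if "v \<in> {a<..<b}"
    proof (rule mult_le_one)
      have "exp (- v) \<le> 1" "exp (- a) \<le> 1" "exp (- v) < exp (- a)" using that ab by auto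
      moreover have "exp (- v) > 0" "exp (- b) > 0" by simp_all
      moreover have "X v = exp (- v)" using that ab by (simp add: X_def)
      ultimately show "X v - exp (- b) \<le> 1" "0 \<le> exp (- a) - X v" "exp (- a) - X v \<le> 1"
        by linarith+
    qed
    then show "f (X v) \<le> 1" using f0[of v] by (cases "v \<in> {a<..<b}") (auto simp: f_def)
  qed (simp add: f_def)
  define c where "c = (\<integral>v. f (X v) * (exp (- v) * indicator {a<..<b} v) \<partial>lborel)"
  have c_int: "integrable lborel (\<lambda>v. f (X v) * (exp (- v) * indicator {a<..<b} v))"
  proof (rule Bochner_Integration.integrable_bound[of _ "indicator {a<..<b} :: real \<Rightarrow> real"])
    show "AE v in lborel. norm (f (X v) * (exp (- v) * indicator {a<..<b} v))
        \<le> norm (indicator {a<..<b} v :: real)"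
      using f2 ab by (auto simp: indicator_def intro!: mult_le_one)
  qed (use ab in auto)
  have "c \<noteq> 0"
  proof
    assume "c = 0"
    then have "AE v in lborel. f (X v) * (exp (- v) * indicator {a<..<b} v) = 0"
      unfolding c_def using f2 by (subst (asm) integral_nonneg_eq_0_iff_AE[OF c_int]) auto
    then have "AE v in lborel. v \<notin> {a<..<b}"
      using f1 by (auto elim!: eventually_mono simp: indicator_def split: if_splits) fastforce
    then have "emeasure lborel {a<..<b} = 0"
      by (subst (asm) AE_iff_measurable[of "{a<..<b}"]) auto
    then show False using ab by simp
  qed
  moreover have "c \<ge> 0" unfolding c_def using f2 by (intro integral_nonneg_AE) auto
  ultimately have c: "c > 0" by simp
  \<comment> \<open>A decreasing function lies between its values at \<open>b\<close> and
    \<open>a\<close> on the support of the bump, so its integral against the bump of mass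
    \<open>c\<close> is sandwiched. Dividing by \<open>c\<close> turns convergence of integrals into
    pointwise bounds.\<close>
  have bnd: "c * y b \<le> (\<integral>v. f (X v) * wt y v \<partial>lborel)" "(\<integral>v. f (X v) * wt y v \<partial>lborel) \<le> c * y a"
    if y: "\<And>v. 0 < v \<Longrightarrow> 0 \<le> y v" "\<And>v v'. 0 < v \<Longrightarrow> v \<le> v' \<Longrightarrow> y v' \<le> y v"
      and yint: "integrable lborel (wt y)" for y
  proof -
    have iy: "integrable lborel (\<lambda>v. f (X v) * wt y v)"
    proof (rule Bochner_Integration.integrable_bound[OF yint])
      show "AE v in lborel. norm (f (X v) * wt y v) \<le> norm (wt y v)"
        using f2 by (auto simp: abs_mult intro!: mult_left_le_one_le)
    qed (use borel_measurable_integrable[OF yint] in measurable)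
    have le: "f (X v) * (exp (- v) * indicator {a<..<b} v) * y b \<le> f (X v) * wt y v"
      "f (X v) * wt y v \<le> f (X v) * (exp (- v) * indicator {a<..<b} v) * y a" for v
      using y(2)[of v b] y(2)[of a v] f0[of v] f1[of v] ab
      by (cases "v \<in> {a<..<b}"; simp add: wt_def)+
    have "c * y b = (\<integral>v. f (X v) * (exp (- v) * indicator {a<..<b} v) * y b \<partial>lborel)"
      unfolding c_def using c_int by simp
    also have "\<dots> \<le> (\<integral>v. f (X v) * wt y v \<partial>lborel)"
      using iy c_int le(1) by (intro integral_mono) auto
    finally show "c * y b \<le> (\<integral>v. f (X v) * wt y v \<partial>lborel)" .
    have "(\<integral>v. f (X v) * wt y v \<partial>lborel) \<le> (\<integral>v. f (X v) * (exp (- v) * indicator {a<..<b} v) * y a \<partial>lborel)"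
      using iy c_int le(2) by (intro integral_mono) auto
    also have "\<dots> = c * y a" unfolding c_def using c_int by simp
    finally show "(\<integral>v. f (X v) * wt y v \<partial>lborel) \<le> c * y a" .
  qed
  have wint: "integrable lborel (wt (g i))" "integrable lborel (wt h)" for i
    using int_g[of i] int_h unfolding set_integrable_def wt_def by simp_all
  have wt0: "0 \<le> wt (g i) v" "0 \<le> wt h v" for i v
    using g(1)[of v i] h(1)[of v] by (auto simp: wt_def indicator_def)
  have mom: "(\<integral>v. X v ^ k * wt y v \<partial>lborel) = (LINT v:{0<..}|lborel. exp (- real (Suc k) * v) * y v)" for y k
    unfolding set_lebesgue_integral_def
    by (intro Bochner_Integration.integral_cong)
      (auto simp: X_def wt_def indicator_def exp_of_nat_mult[symmetric] exp_add[symmetric] algebra_simps)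
  have lim: "((\<lambda>i. \<integral>v. f (X v) * wt (g i) v \<partial>lborel) \<longlongrightarrow> (\<integral>v. f (X v) * wt h v \<partial>lborel)) F"
  proof (rule moment_convergence_imp_integral_tendsto[where X = X and M = lborel and w = "\<lambda>i. wt (g i)"])
    show "((\<lambda>i. \<integral>v. X v ^ k * wt (g i) v \<partial>lborel) \<longlongrightarrow> (\<integral>v. X v ^ k * wt h v \<partial>lborel)) F" for k
      unfolding mom by (rule laplace) simp
    show "continuous_on {0..1} f" unfolding f_def by (intro continuous_intros)
  qed (use wint wt0 in \<open>auto simp: X_def\<close>)
  have "\<forall>\<^sub>F i in F. (\<integral>v. f (X v) * wt (g i) v \<partial>lborel) < c * (h a + \<epsilon>)"
    using bnd(2)[OF h wint(2)] c \<open>\<epsilon> > 0\<close> mult_pos_pos[OF c \<open>\<epsilon> > 0\<close>]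
    unfolding distrib_left by (intro order_tendstoD(2)[OF lim]) linarith
  moreover have "\<forall>\<^sub>F i in F. c * (h b - \<epsilon>) < (\<integral>v. f (X v) * wt (g i) v \<partial>lborel)"
    using bnd(1)[OF h wint(2)] c \<open>\<epsilon> > 0\<close> mult_pos_pos[OF c \<open>\<epsilon> > 0\<close>]
    unfolding right_diff_distrib by (intro order_tendstoD(1)[OF lim]) linarith
  ultimately show ?thesis
  proof eventually_elim
    case (elim i)
    have "c * g i b < c * (h a + \<epsilon>)" using bnd(1)[OF g wint(1), of i] elim(1) by simp
    moreover have "c * (h b - \<epsilon>) < c * g i a" using bnd(2)[OF g wint(1), of i] elim(2) by simp
    ultimately show ?case using c by (simp only: mult_less_cancel_left_pos)
  qed
qed

section \<open>Laplace transforms of tail probabilities\<close>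

lemma nn_integral_exp_Icc:
  fixes l y :: real
  assumes "l > 0"
  shows "(\<integral>\<^sup>+v. ennreal (exp (- l * v)) * indicator {0..y} v \<partial>lborel)
    = ennreal ((1 - exp (- l * max 0 y)) / l)"
proof (cases "0 \<le> y")
  case True
  have "(\<integral>\<^sup>+v. ennreal (exp (- l * v)) * indicator {0..y} v \<partial>lborel)
      = ennreal (- exp (- l * y) / l - (- exp (- l * 0) / l))"
    using assms True
    by (intro nn_integral_FTC_Icc)
      (auto intro!: derivative_eq_intros simp: has_real_derivative_iff_has_vector_derivative[symmetric])
  then show ?thesis using True by (simp add: diff_divide_distrib max_def)
qed simp

context prob_space
begin

text \<open>Tonelli: the tail at v is the expectation of the indicator of v \<le> Y, and integrating
  exp(-l v) from 0 to Y gives (1 - exp(-l Y)) / l.\<close>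

lemma nn_integral_laplace_tail:
  assumes [measurable]: "Y \<in> borel_measurable M" and pos: "AE \<omega> in M. 0 \<le> Y \<omega>" and l: "l > 0"
  shows "(\<integral>\<^sup>+v. ennreal (indicator {0..} v * (exp (- l * v) * prob {\<omega>\<in>space M. v \<le> Y \<omega>})) \<partial>lborel)
    = ennreal ((1 - expectation (\<lambda>\<omega>. exp (- l * Y \<omega>))) / l)"
proof -
  interpret pair_sigma_finite M "lborel :: real measure" ..
  have int: "integrable M (\<lambda>\<omega>. exp (- l * Y \<omega>))"
    using pos l by (intro integrable_const_bound[of _ 1]) (auto elim!: eventually_mono)
  have "(\<integral>\<^sup>+v. ennreal (indicator {0..} v * (exp (- l * v) * prob {\<omega>\<in>space M. v \<le> Y \<omega>})) \<partial>lborel)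
      = (\<integral>\<^sup>+v. (\<integral>\<^sup>+\<omega>. ennreal (exp (- l * v)) * indicator {0..Y \<omega>} v \<partial>M) \<partial>lborel)"
  proof (rule nn_integral_cong)
    fix v :: real
    have "(\<integral>\<^sup>+\<omega>. ennreal (exp (- l * v)) * indicator {0..Y \<omega>} v \<partial>M)
        = (\<integral>\<^sup>+\<omega>. ennreal (indicator {0..} v * exp (- l * v)) * indicator {\<omega>\<in>space M. v \<le> Y \<omega>} \<omega> \<partial>M)"
      by (intro nn_integral_cong) (auto simp: indicator_def)
    also have "\<dots> = ennreal (indicator {0..} v * exp (- l * v)) * emeasure M {\<omega>\<in>space M. v \<le> Y \<omega>}"
      by (rule nn_integral_cmult_indicator) measurable
    finally show "ennreal (indicator {0..} v * (exp (- l * v) * prob {\<omega>\<in>space M. v \<le> Y \<omega>}))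
        = (\<integral>\<^sup>+\<omega>. ennreal (exp (- l * v)) * indicator {0..Y \<omega>} v \<partial>M)"
      by (simp add: emeasure_eq_measure ennreal_mult'[symmetric] mult.assoc)
  qed
  also have "\<dots> = (\<integral>\<^sup>+\<omega>. (\<integral>\<^sup>+v. ennreal (exp (- l * v)) * indicator {0..Y \<omega>} v \<partial>lborel) \<partial>M)"
  proof (rule Fubini')
    have "(\<lambda>(\<omega>, v). ennreal (exp (- l * v)) * (if 0 \<le> v \<and> v \<le> Y \<omega> then 1 else 0))
        \<in> borel_measurable (M \<Otimes>\<^sub>M lborel)"
      by measurable
    then show "(\<lambda>(\<omega>, v). ennreal (exp (- l * v)) * indicator {0..Y \<omega>} v)
        \<in> borel_measurable (M \<Otimes>\<^sub>M lborel)"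
      by (rule measurable_cong[THEN iffD1, rotated]) (auto simp: indicator_def)
  qed
  also have "\<dots> = (\<integral>\<^sup>+\<omega>. ennreal ((1 - exp (- l * Y \<omega>)) / l) \<partial>M)"
    unfolding nn_integral_exp_Icc[OF l]
    using pos by (intro nn_integral_cong_AE) (auto elim!: eventually_mono simp: max_def)
  also have "\<dots> = ennreal (\<integral>\<omega>. (1 - exp (- l * Y \<omega>)) / l \<partial>M)"
    using int l pos by (intro nn_integral_eq_integral) (auto elim!: eventually_mono)
  also have "(\<integral>\<omega>. (1 - exp (- l * Y \<omega>)) / l \<partial>M) = (1 - expectation (\<lambda>\<omega>. exp (- l * Y \<omega>))) / l"
    using int by (simp add: prob_space)
  finally show ?thesis .
qed

lemma borel_measurable_tail [measurable]:
  assumes [measurable]: "Y \<in> borel_measurable M"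
  shows "(\<lambda>v::real. prob {\<omega>\<in>space M. v \<le> Y \<omega>}) \<in> borel_measurable borel"
proof -
  have "(\<lambda>v. - prob {\<omega>\<in>space M. v \<le> Y \<omega>}) \<in> borel_measurable borel"
    by (rule borel_measurable_mono) (auto intro!: monoI finite_measure_mono)
  then show ?thesis by simp
qed

lemma laplace_tail:
  assumes [measurable]: "Y \<in> borel_measurable M" and pos: "AE \<omega> in M. 0 \<le> Y \<omega>" and l: "l > 0"
  shows "set_integrable lborel {0<..} (\<lambda>v. exp (- l * v) * prob {\<omega>\<in>space M. v \<le> Y \<omega>})"
    "(LINT v:{0<..}|lborel. exp (- l * v) * prob {\<omega>\<in>space M. v \<le> Y \<omega>})
      = (1 - expectation (\<lambda>\<omega>. exp (- l * Y \<omega>))) / l"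
proof -
  have int: "integrable M (\<lambda>\<omega>. exp (- l * Y \<omega>))"
    using pos l by (intro integrable_const_bound[of _ 1]) (auto elim!: eventually_mono)
  have "expectation (\<lambda>\<omega>. exp (- l * Y \<omega>)) \<le> expectation (\<lambda>\<omega>. 1)"
    using pos l int by (intro integral_mono_AE) (auto elim!: eventually_mono)
  then have le1: "(1 - expectation (\<lambda>\<omega>. exp (- l * Y \<omega>))) / l \<ge> 0"
    using l by (simp add: prob_space)
  have "AE v in lborel. v \<noteq> (0::real)" by (rule AE_lborel_singleton)
  then have "(\<integral>\<^sup>+v. ennreal (indicator {0<..} v * (exp (- l * v) * prob {\<omega>\<in>space M. v \<le> Y \<omega>})) \<partial>lborel)
      = (\<integral>\<^sup>+v. ennreal (indicator {0..} v * (exp (- l * v) * prob {\<omega>\<in>space M. v \<le> Y \<omega>})) \<partial>lborel)"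
    by (intro nn_integral_cong_AE) (auto elim!: eventually_mono simp: indicator_def)
  also note nn_integral_laplace_tail[OF assms]
  finally have "has_bochner_integral lborel
      (\<lambda>v. indicator {0<..} v * (exp (- l * v) * prob {\<omega>\<in>space M. v \<le> Y \<omega>}))
      ((1 - expectation (\<lambda>\<omega>. exp (- l * Y \<omega>))) / l)"
    by (intro has_bochner_integral_nn_integral le1) auto
  then show "set_integrable lborel {0<..} (\<lambda>v. exp (- l * v) * prob {\<omega>\<in>space M. v \<le> Y \<omega>})"
    "(LINT v:{0<..}|lborel. exp (- l * v) * prob {\<omega>\<in>space M. v \<le> Y \<omega>})
      = (1 - expectation (\<lambda>\<omega>. exp (- l * Y \<omega>))) / l"
    unfolding set_integrable_def set_lebesgue_integral_def has_bochner_integral_iff by simp_all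
qed

lemma tail_left_continuous:
  assumes [measurable]: "Y \<in> borel_measurable M"
  shows "(\<lambda>n. prob {\<omega>\<in>space M. v - 1 / real (Suc n) \<le> Y \<omega>}) \<longlonglongrightarrow> prob {\<omega>\<in>space M. v \<le> Y \<omega>}"
proof -
  define A where "A n = {\<omega>\<in>space M. v - 1 / real (Suc n) \<le> Y \<omega>}" for n
  have "decseq A"
    unfolding decseq_def A_def by (auto simp: frac_le intro: order_trans[rotated])
  moreover have "range A \<subseteq> events" by (auto simp: A_def)
  ultimately have "(\<lambda>n. prob (A n)) \<longlonglongrightarrow> prob (\<Inter>n. A n)"
    by (intro finite_Lim_measure_decseq)
  moreover have "(\<Inter>n. A n) = {\<omega>\<in>space M. v \<le> Y \<omega>}"
  proof safe
    fix \<omega> assume "\<omega> \<in> (\<Inter>n. A n)"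
    then have *: "v - 1 / real (Suc n) \<le> Y \<omega>" "\<omega> \<in> space M" for n by (auto simp: A_def)
    have "(\<lambda>n. v - 1 / real (Suc n)) \<longlonglongrightarrow> v - 0"
      by (intro tendsto_diff tendsto_const LIMSEQ_Suc[OF lim_1_over_n])
    then show "v \<le> Y \<omega>" using * by (intro LIMSEQ_le_const2[of _ v]) auto
    show "\<omega> \<in> space M" by (rule *)
  next
    fix \<omega> n assume "v \<le> Y \<omega>" "\<omega> \<in> space M"
    moreover have "0 \<le> 1 / real (Suc n)" by simp
    ultimately show "\<omega> \<in> A n" by (auto simp only: A_def mem_Collect_eq)
  qed
  ultimately show ?thesis by (simp add: A_def)
qed

text \<open>Markov's inequality for 1 - exp(-Y / v), which is at least 1 - exp(-1) where Y \<ge>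
  v.\<close>

lemma tail_bound_laplace:
  assumes [measurable]: "Y \<in> borel_measurable M" and pos: "AE \<omega> in M. 0 \<le> Y \<omega>" and v: "v > 0"
  shows "(1 - exp (- 1)) * prob {\<omega>\<in>space M. v \<le> Y \<omega>} \<le> 1 - expectation (\<lambda>\<omega>. exp (- (1 / v) * Y \<omega>))"
proof -
  have int: "integrable M (\<lambda>\<omega>. exp (- (1 / v) * Y \<omega>))"
    using pos v by (intro integrable_const_bound[of _ 1]) (auto elim!: eventually_mono)
  have "(1 - exp (- 1)) * prob {\<omega>\<in>space M. v \<le> Y \<omega>}
      = (\<integral>\<omega>. (1 - exp (- 1)) * indicator {\<omega>\<in>space M. v \<le> Y \<omega>} \<omega> \<partial>M)"
    by simp
  also have "\<dots> \<le> (\<integral>\<omega>. 1 - exp (- (1 / v) * Y \<omega>) \<partial>M)"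
  proof (rule integral_mono_AE)
    show "AE \<omega> in M. (1 - exp (- 1)) * indicator {\<omega> \<in> space M. v \<le> Y \<omega>} \<omega> \<le> 1 - exp (- (1 / v) * Y \<omega>)"
      using pos by eventually_elim (use v in \<open>auto simp: indicator_def field_simps\<close>)
  qed (use int in \<open>auto simp: emeasure_eq_measure\<close>)
  also have "\<dots> = 1 - expectation (\<lambda>\<omega>. exp (- (1 / v) * Y \<omega>))"
    using int by (simp add: prob_space)
  finally show ?thesis .
qed

end

text \<open>Uniqueness of the Laplace transform as a degenerate case of Karamata's argument: a
  family constant in its index gives g b \<le> h a whenever a < b. Letting a increase to b costs
  nothing, since tails defined with a weak inequality are left-continuous.\<close>

lemma tail_le_if_laplace_eq:
  fixes Y :: "'w \<Rightarrow> real" and Z :: "'w2 \<Rightarrow> real"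
  assumes M: "prob_space M" and K: "prob_space K"
    and [measurable]: "Y \<in> borel_measurable M" "Z \<in> borel_measurable K"
    and pos: "AE \<omega> in M. 0 \<le> Y \<omega>" "AE \<omega> in K. 0 \<le> Z \<omega>"
    and eq: "\<And>l. l > 0 \<Longrightarrow> prob_space.expectation M (\<lambda>\<omega>. exp (- l * Y \<omega>))
        = prob_space.expectation K (\<lambda>\<omega>. exp (- l * Z \<omega>))"
    and v: "v > 0"
  shows "measure M {\<omega>\<in>space M. v \<le> Y \<omega>} \<le> measure K {\<omega>\<in>space K. v \<le> Z \<omega>}"
proof -
  interpret M: prob_space M by fact
  interpret K: prob_space K by fact
  define g where "g v = measure M {\<omega>\<in>space M. v \<le> Y \<omega>}" for v
  define h where "h v = measure K {\<omega>\<in>space K. v \<le> Z \<omega>}" for v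
  have [measurable]: "g \<in> borel_measurable borel" "h \<in> borel_measurable borel"
    unfolding g_def[abs_def] h_def[abs_def] by measurable
  have anti: "g v' \<le> g v" "h v' \<le> h v" if "v \<le> v'" for v v'
    using that unfolding g_def h_def
    by (auto intro!: M.finite_measure_mono K.finite_measure_mono)
  have le: "g b \<le> h a" if ab: "0 < a" "a < b" for a b
  proof (rule field_le_epsilon)
    fix \<epsilon> :: real assume "\<epsilon> > 0"
    have "\<forall>\<^sub>F i :: nat in sequentially. g b < h a + \<epsilon> \<and> h b - \<epsilon> < g a"
    proof (rule eventually_sandwich_if_laplace_tendsto[OF _ _ _ _ _ _ _ _ _ ab \<open>\<epsilon> > 0\<close>])
      show "set_integrable lborel {0<..} (\<lambda>v. exp (- v) * g v)"
        using M.laplace_tail(1)[OF _ pos(1), of 1] by (simp add: g_def)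
      show "set_integrable lborel {0<..} (\<lambda>v. exp (- v) * h v)"
        using K.laplace_tail(1)[OF _ pos(2), of 1] by (simp add: h_def)
      fix k :: nat assume "k \<ge> 1"
      then have k: "0 < real k" by simp
      show "(\<lambda>i. LINT v:{0<..}|lborel. exp (- real k * v) * g v) \<longlonglongrightarrow>
          (LINT v:{0<..}|lborel. exp (- real k * v) * h v)"
        unfolding g_def h_def M.laplace_tail(2)[OF \<open>Y \<in> borel_measurable M\<close> pos(1) k]
          K.laplace_tail(2)[OF \<open>Z \<in> borel_measurable K\<close> pos(2) k] eq[OF k]
        by (rule tendsto_const)
    qed (use anti in \<open>auto simp: g_def h_def\<close>)
    then show "g b \<le> h a + \<epsilon>" by (auto simp: eventually_sequentially intro: less_imp_le)
  qed
  have "g v \<le> h v"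
  proof (rule LIMSEQ_le_const)
    show "(\<lambda>n. h (v - 1 / real (Suc n))) \<longlonglongrightarrow> h v"
      unfolding h_def by (rule K.tail_left_continuous) measurable
    obtain n0 where n0: "1 / real (Suc n0) < v" using v nat_approx_posE by blast
    have "g v \<le> h (v - 1 / real (Suc n))" if "n \<ge> n0" for n
    proof (rule le)
      have "1 / real (Suc n) \<le> 1 / real (Suc n0)" using that by (intro divide_left_mono) auto
      then show "0 < v - 1 / real (Suc n)" using n0 by linarith
    qed simp
    then show "\<exists>N. \<forall>n\<ge>N. g v \<le> h (v - 1 / real (Suc n))" by blast
  qed
  then show ?thesis by (simp add: g_def h_def)
qed

section \<open>Small-time tails of the stable subordinator\<close>

lemma nn_integral_powr_laplace:
  fixes \<beta> l :: real
  assumes "\<beta> < 1" "l > 0"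
  shows "(\<integral>\<^sup>+v. ennreal (indicator {0<..} v * (exp (- l * v) * v powr (- \<beta>))) \<partial>lborel)
    = ennreal (Gamma (1 - \<beta>) * l powr (\<beta> - 1))"
proof -
  let ?I = "\<integral>\<^sup>+v. ennreal (indicator {0<..} v * (exp (- l * v) * v powr (- \<beta>))) \<partial>lborel"
  have "ennreal (Gamma (1 - \<beta>)) = (\<integral>\<^sup>+t. ennreal (indicator {0..} t * t powr (- \<beta>) / exp t) \<partial>lborel)"
    using Gamma_conv_nn_integral_real[of "1 - \<beta>"] assms by simp
  also have "\<dots> = ennreal l * (\<integral>\<^sup>+t. ennreal (indicator {0..} (l * t) * (l * t) powr (- \<beta>) / exp (l * t)) \<partial>lborel)"
    using nn_integral_real_affine[of "\<lambda>t. ennreal (indicator {0..} t * t powr (- \<beta>) / exp t)" l 0] assms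
    by simp
  also have "(\<integral>\<^sup>+t. ennreal (indicator {0..} (l * t) * (l * t) powr (- \<beta>) / exp (l * t)) \<partial>lborel)
      = (\<integral>\<^sup>+t. ennreal (l powr (- \<beta>)) * ennreal (indicator {0<..} t * (exp (- l * t) * t powr (- \<beta>))) \<partial>lborel)"
    using assms
    by (intro nn_integral_cong)
      (auto simp: indicator_def powr_mult exp_minus divide_inverse zero_le_mult_iff ennreal_mult'[symmetric])
  also have "\<dots> = ennreal (l powr (- \<beta>)) * ?I"
    by (rule nn_integral_cmult) measurable
  finally have eq: "ennreal (Gamma (1 - \<beta>)) = ennreal (l powr (1 - \<beta>)) * ?I"
    using assms by (simp add: mult.assoc[symmetric] ennreal_mult'[symmetric] powr_diff powr_minus field_simps)
  have "ennreal (l powr (\<beta> - 1)) * ennreal (l powr (1 - \<beta>)) = 1"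
    using assms by (simp add: ennreal_mult'[symmetric] powr_add[symmetric])
  then have "?I = ennreal (l powr (\<beta> - 1)) * ennreal (Gamma (1 - \<beta>))"
    unfolding eq by (simp add: mult.assoc[symmetric])
  then show ?thesis using assms by (simp add: ennreal_mult'[symmetric] mult.commute)
qed

lemma stable_subordinator_nonneg:
  assumes "stable_subordinator M \<beta> S" "t \<ge> 0"
  shows "AE \<omega> in M. 0 \<le> S t \<omega>"
proof -
  have "AE \<omega> in M. S 0 \<omega> = 0" "\<And>\<omega>. \<omega> \<in> space M \<Longrightarrow> mono_on {0..} (\<lambda>t. S t \<omega>)"
    using assms(1) by (auto simp: stable_subordinator_def)
  then have "S 0 \<omega> \<le> S t \<omega>" if "\<omega> \<in> space M" for \<omega>
    using that assms(2) mono_onD[of "{0..}" "\<lambda>t. S t \<omega>" 0 t] by auto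
  then have "AE \<omega> in M. S 0 \<omega> \<le> S t \<omega>" by (rule AE_I2)
  with \<open>AE \<omega> in M. S 0 \<omega> = 0\<close> show ?thesis by eventually_elim simp
qed

text \<open>Permits replacing the tail of \<open>S t\<close> under \<open>P x\<close> by the one
  under the reference law \<open>P 0\<close>.\<close>

lemma stable_subordinator_tail_eq:
  assumes "stable_subordinator M \<beta> S" "stable_subordinator K \<beta> S'" "t \<ge> 0" "v > 0"
  shows "measure M {\<omega>\<in>space M. v \<le> S t \<omega>} = measure K {\<omega>\<in>space K. v \<le> S' t \<omega>}"
proof -
  have S: "prob_space M" "S t \<in> borel_measurable M" "prob_space K" "S' t \<in> borel_measurable K"
    using assms by (simp_all add: stable_subordinator_def)
  have L: "prob_space.expectation M (\<lambda>\<omega>. exp (- l * S t \<omega>)) = exp (- t * l powr \<beta>)"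
    "prob_space.expectation K (\<lambda>\<omega>. exp (- l * S' t \<omega>)) = exp (- t * l powr \<beta>)" if "l > 0" for l
    using assms that unfolding stable_subordinator_def by meson+
  note nn = stable_subordinator_nonneg[OF assms(1,3)] stable_subordinator_nonneg[OF assms(2,3)]
  show ?thesis
  proof (rule antisym)
    show "measure M {\<omega>\<in>space M. v \<le> S t \<omega>} \<le> measure K {\<omega>\<in>space K. v \<le> S' t \<omega>}"
      by (rule tail_le_if_laplace_eq[OF S(1,3,2,4) nn _ \<open>v > 0\<close>]) (simp only: L)
    show "measure K {\<omega>\<in>space K. v \<le> S' t \<omega>} \<le> measure M {\<omega>\<in>space M. v \<le> S t \<omega>}"
      by (rule tail_le_if_laplace_eq[OF S(3,1,4,2) nn(2,1) _ \<open>v > 0\<close>]) (simp only: L)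
  qed
qed

text \<open>Take the Laplace transform at 1 / v and use 1 - exp(-y) \<le> y. Being uniform in t and
  v, the bound later supplies the dominating function.\<close>

lemma stable_subordinator_tail_le:
  assumes S: "stable_subordinator M \<beta> S" and t: "t \<ge> 0" and v: "v > 0"
  shows "measure M {\<omega>\<in>space M. v \<le> S t \<omega>} \<le> t * v powr (- \<beta>) / (1 - exp (- 1))"
proof -
  interpret prob_space M using S by (simp add: stable_subordinator_def)
  have "(1 - exp (- 1)) * prob {\<omega>\<in>space M. v \<le> S t \<omega>} \<le> 1 - exp (- t * (1 / v) powr \<beta>)"
  proof -
    have "expectation (\<lambda>\<omega>. exp (- (1 / v) * S t \<omega>)) = exp (- t * (1 / v) powr \<beta>)"
      using S t v unfolding stable_subordinator_def by (meson zero_less_divide_1_iff)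
    then show ?thesis
      using tail_bound_laplace[of "S t" v] S t v stable_subordinator_nonneg[OF S t]
      by (auto simp only: stable_subordinator_def)
  qed
  also have "\<dots> \<le> t * v powr (- \<beta>)"
    using exp_ge_add_one_self[of "- t * (1 / v) powr \<beta>"] v
    by (simp add: powr_divide powr_minus field_simps)
  finally show ?thesis by (simp add: field_simps)
qed

text \<open>The tail divided by t has Laplace transform (1 - exp(-t l^\<beta>)) / (l t), which tends
  to l^(\<beta>-1), the transform of the claimed limit. Karamata's sandwich and continuity of the
  limit upgrade this to pointwise convergence.\<close>

lemma stable_subordinator_tail_asymp:
  assumes S: "stable_subordinator M \<beta> S" and \<beta>: "0 < \<beta>" "\<beta> < 1" and v: "v > 0"
  shows "((\<lambda>t. measure M {\<omega>\<in>space M. v \<le> S t \<omega>} / t) \<longlongrightarrow> v powr (- \<beta>) / Gamma (1 - \<beta>)) (at_right 0)"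
proof -
  interpret prob_space M using S by (simp add: stable_subordinator_def)
  define h where "h v = v powr (- \<beta>) / Gamma (1 - \<beta>)" for v
  \<comment> \<open>The sandwich lemma wants its hypotheses for every index, so \<open>g\<close> is
    set to 0 for t \<le> 0. The filter \<open>at_right 0\<close> does not see these values.\<close>
  define g where "g t v = (if t > 0 then prob {\<omega>\<in>space M. v \<le> S t \<omega>} / t else 0)" for t v
  have S_meas [measurable]: "S t \<in> borel_measurable M" if "t > 0" for t
    using S that by (simp add: stable_subordinator_def)
  have Gpos: "Gamma (1 - \<beta>) > 0" using \<beta> by (intro Gamma_real_pos) auto
  have h_lap: "set_integrable lborel {0<..} (\<lambda>v. exp (- l * v) * h v)"
    "(LINT v:{0<..}|lborel. exp (- l * v) * h v) = l powr (\<beta> - 1)" if "l > 0" for l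
  proof -
    have "has_bochner_integral lborel (\<lambda>v. indicator {0<..} v * (exp (- l * v) * v powr (- \<beta>)))
        (Gamma (1 - \<beta>) * l powr (\<beta> - 1))"
      using nn_integral_powr_laplace[of \<beta> l] \<beta> Gpos that
      by (intro has_bochner_integral_nn_integral) auto
    then have "has_bochner_integral lborel (\<lambda>v. indicator {0<..} v * (exp (- l * v) * v powr (- \<beta>)) / Gamma (1 - \<beta>))
        (Gamma (1 - \<beta>) * l powr (\<beta> - 1) / Gamma (1 - \<beta>))"
      by (rule has_bochner_integral_divide_zero)
    then show "set_integrable lborel {0<..} (\<lambda>v. exp (- l * v) * h v)"
      "(LINT v:{0<..}|lborel. exp (- l * v) * h v) = l powr (\<beta> - 1)"
      using Gpos unfolding set_integrable_def set_lebesgue_integral_def has_bochner_integral_iff h_def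
      by simp_all
  qed
  have g_lap: "set_integrable lborel {0<..} (\<lambda>v. exp (- l * v) * g t v)"
    "t > 0 \<Longrightarrow> (LINT v:{0<..}|lborel. exp (- l * v) * g t v) = (1 - exp (- t * l powr \<beta>)) / l / t"
    if "l > 0" for l t
  proof -
    have "set_integrable lborel {0<..} (\<lambda>v. exp (- l * v) * g t v) \<and>
        (LINT v:{0<..}|lborel. exp (- l * v) * g t v) = (1 - exp (- t * l powr \<beta>)) / l / t" if "t > 0"
    proof -
      note lt = laplace_tail[OF S_meas[OF \<open>t > 0\<close>] stable_subordinator_nonneg[OF S less_imp_le[OF \<open>t > 0\<close>]] \<open>l > 0\<close>]
      have "expectation (\<lambda>\<omega>. exp (- l * S t \<omega>)) = exp (- t * l powr \<beta>)"
        using S \<open>t > 0\<close> \<open>l > 0\<close> unfolding stable_subordinator_def by (meson less_imp_le)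
      then show ?thesis
        using lt that by (simp add: g_def set_integrable_divide)
    qed
    moreover have "set_integrable lborel {0<..} (\<lambda>v. exp (- l * v) * g t v)" if "\<not> t > 0"
      using that by (simp add: g_def set_integrable_def)
    ultimately show "set_integrable lborel {0<..} (\<lambda>v. exp (- l * v) * g t v)"
      "t > 0 \<Longrightarrow> (LINT v:{0<..}|lborel. exp (- l * v) * g t v) = (1 - exp (- t * l powr \<beta>)) / l / t"
      by blast+
  qed
  have g_meas: "g t \<in> borel_measurable borel" for t
    unfolding g_def[abs_def] by (cases "t > 0") (simp_all add: borel_measurable_tail S_meas)
  have sandwich: "\<forall>\<^sub>F t in at_right 0. g t b < h a + \<epsilon> \<and> h b - \<epsilon> < g t a"
    if ab: "0 < a" "a < b" and "\<epsilon> > 0" for a b \<epsilon>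
  proof (rule eventually_sandwich_if_laplace_tendsto[OF g_meas _ _ _ _ _ _ _ _ ab \<open>\<epsilon> > 0\<close>])
    show "h \<in> borel_measurable borel" unfolding h_def[abs_def] by measurable
    show "0 < v \<Longrightarrow> 0 \<le> h v" for v using Gpos by (simp add: h_def)
    show "0 < v \<Longrightarrow> v \<le> v' \<Longrightarrow> h v' \<le> h v" for v v'
      using Gpos \<beta> by (simp add: h_def divide_right_mono powr_mono2')
    show "0 < v \<Longrightarrow> v \<le> v' \<Longrightarrow> g t v' \<le> g t v" for t v v'
      by (auto simp: g_def intro!: divide_right_mono finite_measure_mono S_meas)
    show "set_integrable lborel {0<..} (\<lambda>v. exp (- v) * g t v)" for t using g_lap(1)[of 1] by simp
    show "set_integrable lborel {0<..} (\<lambda>v. exp (- v) * h v)" using h_lap(1)[of 1] by simp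
    fix k :: nat assume "k \<ge> 1"
    then have k: "0 < real k" by simp
    have "((\<lambda>t. (1 - exp (- t * real k powr \<beta>)) / real k / t) \<longlongrightarrow> real k powr (\<beta> - 1)) (at_right 0)"
    proof -
      have "((\<lambda>t. exp (- t * real k powr \<beta>)) has_real_derivative - (real k powr \<beta>)) (at 0)"
        by (auto intro!: derivative_eq_intros)
      then have "((\<lambda>t. (exp (- t * real k powr \<beta>) - 1) / t) \<longlongrightarrow> - (real k powr \<beta>)) (at_right 0)"
        unfolding DERIV_def by (auto intro: tendsto_mono[OF at_le])
      then have "((\<lambda>t. - (1 / real k) * ((exp (- t * real k powr \<beta>) - 1) / t))
          \<longlongrightarrow> - (1 / real k) * - (real k powr \<beta>)) (at_right 0)"
        by (intro tendsto_intros)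
      moreover have "(1 - e) / real k / t = - (1 / real k) * ((e - 1) / t)" for e t
        using k by (cases "t = 0") (auto simp: field_simps)
      moreover have "real k powr (\<beta> - 1) = - (1 / real k) * - (real k powr \<beta>)"
        using k by (simp add: powr_diff)
      ultimately show ?thesis by (simp only:)
    qed
    moreover have "\<forall>\<^sub>F t in at_right 0. (1 - exp (- t * real k powr \<beta>)) / real k / t
        = (LINT v:{0<..}|lborel. exp (- real k * v) * g t v)"
      using eventually_at_right_less[of 0] by eventually_elim (simp only: g_lap(2)[OF k])
    ultimately show "((\<lambda>t. LINT v:{0<..}|lborel. exp (- real k * v) * g t v) \<longlongrightarrow>
        (LINT v:{0<..}|lborel. exp (- real k * v) * h v)) (at_right 0)"
      unfolding h_lap(2)[OF k] by (rule Lim_transform_eventually)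
  qed (auto simp: g_def)
  have cont: "isCont h v" unfolding h_def[abs_def] using v Gpos by (intro continuous_intros) auto
  have "((\<lambda>t. g t v) \<longlongrightarrow> h v) (at_right 0)"
  proof (rule order_tendstoI)
    \<comment> \<open>By continuity some b > v has \<open>h b\<close> still above the midpoint of
      \<open>y\<close> and \<open>h v\<close>. The sandwich between v and b, with half the gap as
      error, then gives y < g t v. The upper bound uses a point to the left of v.\<close>
    fix y assume "y < h v"
    then have "\<forall>\<^sub>F b in at_right v. (y + h v) / 2 < h b"
      using cont by (intro order_tendstoD(1)[of h "h v"]) (auto simp: isCont_def intro: tendsto_mono[OF at_le])
    moreover have "\<forall>\<^sub>F b in at_right v. v < b" by (rule eventually_at_right_less)
    ultimately have "\<forall>\<^sub>F b in at_right v. (y + h v) / 2 < h b \<and> v < b" by eventually_elim simp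
    then obtain b where b: "(y + h v) / 2 < h b" "v < b"
      using eventually_happens[of _ "at_right v"] by (auto simp: trivial_limit_at_right_real)
    from sandwich[OF v b(2), of "(h v - y) / 2"] \<open>y < h v\<close>
    show "\<forall>\<^sub>F t in at_right 0. y < g t v"
      by (auto elim!: eventually_mono) (use b(1) in \<open>simp add: field_simps\<close>)
  next
    fix y assume "h v < y"
    then have "\<forall>\<^sub>F a in at_left v. h a < (y + h v) / 2"
      using cont by (intro order_tendstoD(2)[of h "h v"]) (auto simp: isCont_def intro: tendsto_mono[OF at_le])
    moreover have "\<forall>\<^sub>F a in at_left v. a < v \<and> 0 < a"
      using v by (auto simp: eventually_at_left)
    ultimately have "\<forall>\<^sub>F a in at_left v. h a < (y + h v) / 2 \<and> a < v \<and> 0 < a" by eventually_elim simp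
    then obtain a where a: "h a < (y + h v) / 2" "a < v" "0 < a"
      using eventually_happens[of _ "at_left v"] by (auto simp: trivial_limit_at_left_real)
    from sandwich[OF a(3,2), of "(y - h v) / 2"] \<open>h v < y\<close>
    show "\<forall>\<^sub>F t in at_right 0. g t v < y"
      by (auto elim!: eventually_mono) (use a(1) in \<open>simp add: field_simps\<close>)
  qed
  moreover have "\<forall>\<^sub>F t in at_right 0. g t v = prob {\<omega>\<in>space M. v \<le> S t \<omega>} / t"
    using eventually_at_right_less[of 0] by eventually_elim (simp add: g_def)
  ultimately show ?thesis unfolding h_def by (rule Lim_transform_eventually)
qed

section \<open>Exit times of Brownian motion\<close>

lemma exit_time_nonneg: "0 \<le> exit_time D w"
  unfolding exit_time_def by (rule Inf_greatest) auto

text \<open>Since \<open>D\<close> is open and the path continuous, a path inside \<open>D\<close>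
  at time u stays there a little longer, which makes the inequality strict. The exit time ignores
  time 0, so for u = 0 the interval is empty and \<open>w0\<close> must supply that the path is in
  \<open>D\<close>.\<close>

lemma exit_time_greater_iff':
  fixes w :: "real \<Rightarrow> 'a::real_normed_vector"
  assumes cont: "continuous_on {0..} w" and D: "open D" and u: "u \<ge> 0" and w0: "w 0 \<in> D \<or> u > 0"
  shows "ereal u < exit_time D w \<longleftrightarrow> (\<forall>s\<in>{0<..u}. w s \<in> D)"
proof
  assume gt: "ereal u < exit_time D w"
  show "\<forall>s\<in>{0<..u}. w s \<in> D"
  proof (rule ccontr)
    assume "\<not> ?thesis"
    then obtain s where s: "0 < s" "s \<le> u" "w s \<notin> D" by auto
    then have "exit_time D w \<le> ereal s"
      unfolding exit_time_def by (intro Inf_lower) auto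
    with gt s(2) show False by (metis ereal_less_eq(3) leD order_trans)
  qed
next
  assume in_D: "\<forall>s\<in>{0<..u}. w s \<in> D"
  have "(w \<longlongrightarrow> w u) (at u within {0..})"
    using cont u by (auto simp: continuous_on_def)
  moreover have "w u \<in> D" using in_D u w0 by (cases "u = 0") auto
  ultimately have "\<forall>\<^sub>F s in at u within {0..}. w s \<in> D"
    using D by (intro topological_tendstoD) auto
  then obtain e where e: "e > 0" "\<And>s. s \<ge> 0 \<Longrightarrow> s \<noteq> u \<Longrightarrow> dist s u < e \<Longrightarrow> w s \<in> D"
    unfolding eventually_at by auto
  have "ereal (u + e) \<le> exit_time D w"
    unfolding exit_time_def
  proof (rule Inf_greatest, safe)
    fix t assume t: "0 < t" "w t \<notin> D"
    then have "u < t" using in_D by (metis greaterThanAtMost_iff not_le)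
    then have "u + e \<le> t" using e(2)[of t] t by (force simp: dist_real_def not_less)
    then show "ereal (u + e) \<le> ereal t" by simp
  qed
  then show "ereal u < exit_time D w" using e(1) by (auto intro: less_le_trans[rotated])
qed

lemma exit_time_greater_iff:
  fixes w :: "real \<Rightarrow> 'a::real_normed_vector"
  assumes "continuous_on {0..} w" "open D" "w 0 \<in> D" "u \<ge> 0"
  shows "ereal u < exit_time D w \<longleftrightarrow> (\<forall>s\<in>{0..u}. w s \<in> D)"
proof -
  have "ereal u < exit_time D w \<longleftrightarrow> (\<forall>s\<in>{0<..u}. w s \<in> D)"
    using assms by (intro exit_time_greater_iff') auto
  moreover have "{0..u} = insert 0 {0<..u}" using assms(4) by auto
  ultimately show ?thesis using assms(3) by simp
qed

text \<open>Rounding s down to the dyadic grid keeps the approximating times in [0, u], and the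
  closed set \<open>F\<close> retains the limit.\<close>

lemma dyadic_closed:
  fixes w :: "real \<Rightarrow> 'a::metric_space"
  assumes cont: "continuous_on {0..} w" and F: "closed F" and u: "u \<ge> 0"
    and dyadic: "\<And>n k. k \<le> 2 ^ n \<Longrightarrow> w (real k * u / 2 ^ n) \<in> F" and s: "s \<in> {0..u}"
  shows "w s \<in> F"
proof (cases "u = 0")
  case True
  then show ?thesis using s dyadic[of 0 0] by simp
next
  case False
  then have u: "u > 0" using u by simp
  define k where "k n = nat \<lfloor>2 ^ n * s / u\<rfloor>" for n
  have nn: "0 \<le> 2 ^ n * s / u" for n using s u by simp
  have k: "real (k n) \<le> 2 ^ n * s / u" "2 ^ n * s / u < real (k n) + 1" for n
    using nn[of n] unfolding k_def by (simp_all add: of_nat_nat)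
  have "k n \<le> 2 ^ n" for n
  proof -
    have "2 ^ n * s / u \<le> 2 ^ n" using s u by (simp add: field_simps)
    with k(1)[of n] have "real (k n) \<le> 2 ^ n" by (rule order_trans)
    then show ?thesis by (metis of_nat_le_iff of_nat_numeral of_nat_power)
  qed
  then have inF: "w (real (k n) * u / 2 ^ n) \<in> F" for n by (rule dyadic)
  have bnd: "\<bar>real (k n) * u / 2 ^ n - s\<bar> \<le> u * (1 / 2) ^ n" for n
  proof -
    have "real (k n) * u \<le> 2 ^ n * s" "2 ^ n * s \<le> real (k n) * u + u"
      using k[of n] u by (simp_all add: field_simps)
    then have "real (k n) * u / 2 ^ n \<le> s" "s \<le> (real (k n) * u + u) / 2 ^ n"
      by (simp_all add: pos_divide_le_eq pos_le_divide_eq mult.commute)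
    then show ?thesis by (simp add: abs_le_iff power_one_over add_divide_distrib)
  qed
  have "(\<lambda>n. u * (1 / 2) ^ n) \<longlonglongrightarrow> u * 0"
    by (intro tendsto_mult tendsto_const LIMSEQ_realpow_zero) auto
  then have lim0: "(\<lambda>n. u * (1 / 2) ^ n) \<longlonglongrightarrow> 0" by simp
  have "(\<lambda>n. real (k n) * u / 2 ^ n - s) \<longlonglongrightarrow> 0"
    by (rule Lim_null_comparison[OF _ lim0], rule always_eventually, unfold real_norm_def, intro allI bnd)
  then have "(\<lambda>n. real (k n) * u / 2 ^ n) \<longlonglongrightarrow> s"
    by (simp add: LIM_zero_iff)
  then have "(\<lambda>n. w (real (k n) * u / 2 ^ n)) \<longlonglongrightarrow> w s"
    using s u by (intro continuous_on_tendsto_compose[OF cont] always_eventually allI) auto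
  with F inF show ?thesis by (rule closed_sequentially)
qed

text \<open>For an open set, checking dyadic times alone would miss a path that touches the boundary
  in between. The image of [0, u] is compact and hence inside a single \<open>C m\<close>, and for
  that closed set dyadic times suffice. The condition becomes a countable one.\<close>

lemma path_in_open_iff_dyadic:
  fixes w :: "real \<Rightarrow> 'a::euclidean_space"
  assumes cont: "continuous_on {0..} w" and u: "u \<ge> 0"
    and C: "\<And>m. compact (C m)" "\<And>m. C m \<subseteq> D" "\<And>K. compact K \<Longrightarrow> K \<subseteq> D \<Longrightarrow> \<exists>N. \<forall>m\<ge>N. K \<subseteq> C m"
  shows "(\<forall>s\<in>{0..u}. w s \<in> D) \<longleftrightarrow> (\<exists>m::nat. \<forall>n. \<forall>k\<le>2 ^ n. w (real k * u / 2 ^ n) \<in> C m)"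
proof
  assume "\<forall>s\<in>{0..u}. w s \<in> D"
  then have sub: "w ` {0..u} \<subseteq> D" by auto
  have "compact (w ` {0..u})"
    by (intro compact_continuous_image continuous_on_subset[OF cont]) auto
  from C(3)[OF this sub] obtain m where m: "w ` {0..u} \<subseteq> C m" by (metis order_refl)
  have "real k * u / 2 ^ n \<in> {0..u}" if "k \<le> 2 ^ n" for k n
  proof -
    have "real k \<le> 2 ^ n" using that by (metis of_nat_le_iff of_nat_numeral of_nat_power)
    then have "real k * u \<le> 2 ^ n * u" using u by (rule mult_right_mono)
    then show ?thesis using u by (simp add: pos_divide_le_eq mult.commute)
  qed
  with m show "\<exists>m. \<forall>n. \<forall>k\<le>2 ^ n. w (real k * u / 2 ^ n) \<in> C m" by blast
next
  assume "\<exists>m. \<forall>n. \<forall>k\<le>2 ^ n. w (real k * u / 2 ^ n) \<in> C m"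
  then obtain m where m: "\<And>n k. k \<le> 2 ^ n \<Longrightarrow> w (real k * u / 2 ^ n) \<in> C m" by blast
  have "w s \<in> C m" if "s \<in> {0..u}" for s
    by (rule dyadic_closed[OF cont compact_imp_closed[OF C(1)] u m that])
  then show "\<forall>s\<in>{0..u}. w s \<in> D" using C(2) by blast
qed

text \<open>Stated for any measurable space with continuous paths, because it serves the probability
  spaces, their product with the starting point, and the sigma-algebra generated by \<open>W\<close>
  alone.\<close>

lemma borel_measurable_exit_time:
  fixes X :: "real \<Rightarrow> 'w \<Rightarrow> 'a::euclidean_space"
  assumes meas: "\<And>s. s \<ge> 0 \<Longrightarrow> X s \<in> borel_measurable M"
    and cont: "\<And>\<omega>. \<omega> \<in> space M \<Longrightarrow> continuous_on {0..} (\<lambda>s. X s \<omega>)" and D: "open D"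
  shows "(\<lambda>\<omega>. exit_time D (\<lambda>s. X s \<omega>)) \<in> borel_measurable M"
proof (rule borel_measurableI_greater)
  fix y :: ereal
  obtain C :: "nat \<Rightarrow> 'a set" where C: "\<And>n. compact (C n)" "\<And>n. C n \<subseteq> D" 
    "\<And>K. \<lbrakk>compact K; K \<subseteq> D\<rbrakk> \<Longrightarrow> \<exists>N. \<forall>n\<ge>N. K \<subseteq> C n"
    by (rule open_Union_compact_subsets[OF D]) blast
  have [measurable]: "C m \<in> sets borel" for m using C(1) by (intro borel_compact)
  have stay: "{\<omega> \<in> space M. \<forall>s\<in>{0..u}. X (v + s) \<omega> \<in> D} \<in> sets M" if "0 \<le> u" "0 \<le> v" for u v
  proof -
    have [measurable]: "X (v + real k * u / 2 ^ n) \<in> borel_measurable M" for k n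
      using that by (intro meas) auto
    have "{\<omega> \<in> space M. \<forall>s\<in>{0..u}. X (v + s) \<omega> \<in> D}
        = {\<omega> \<in> space M. \<exists>m. \<forall>n. \<forall>k\<le>2 ^ n. X (v + real k * u / 2 ^ n) \<omega> \<in> C m}"
    proof (intro Collect_cong conj_cong refl)
      fix \<omega> assume "\<omega> \<in> space M"
      then have "continuous_on {0..} (\<lambda>s. X (v + s) \<omega>)"
        using that by (intro continuous_on_compose2[OF cont, of _ _ "\<lambda>s. v + s"]) (auto intro!: continuous_intros)
      from path_in_open_iff_dyadic[OF this that(1), of C] C
      show "(\<forall>s\<in>{0..u}. X (v + s) \<omega> \<in> D) \<longleftrightarrow> (\<exists>m. \<forall>n. \<forall>k\<le>2 ^ n. X (v + real k * u / 2 ^ n) \<omega> \<in> C m)"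
        by simp
    qed
    also have "\<dots> \<in> sets M" by measurable
    finally show ?thesis .
  qed
  have pos: "{\<omega> \<in> space M. ereal u < exit_time D (\<lambda>s. X s \<omega>)} \<in> sets M" if u: "u > 0" for u
  proof -
    \<comment> \<open>The closed intervals from \<open>v j\<close> to u exhaust (0, u], and the
      dyadic criterion applies to each. Time 0 stays out because the process may start outside
      \<open>D\<close>.\<close>
    define v where "v j = u / real (j + 1)" for j :: nat
    have v: "0 < v j" "v j \<le> u" for j using u by (auto simp: v_def divide_le_eq mult_le_cancel_left1)
    have "ereal u < exit_time D (\<lambda>s. X s \<omega>) \<longleftrightarrow> (\<forall>j. \<forall>s\<in>{0..u - v j}. X (v j + s) \<omega> \<in> D)"
      if "\<omega> \<in> space M" for \<omega>
    proof -
      have "(\<forall>s\<in>{0<..u}. X s \<omega> \<in> D) \<longleftrightarrow> (\<forall>j. \<forall>s\<in>{0..u - v j}. X (v j + s) \<omega> \<in> D)"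
      proof (intro iffI ballI allI)
        fix j s assume "\<forall>s\<in>{0<..u}. X s \<omega> \<in> D" "s \<in> {0..u - v j}"
        then show "X (v j + s) \<omega> \<in> D" using v[of j] by simp
      next
        fix s assume *: "\<forall>j. \<forall>s\<in>{0..u - v j}. X (v j + s) \<omega> \<in> D" and s: "s \<in> {0<..u}"
        obtain j where "1 / real (Suc j) < s / u" using nat_approx_posE[of "s / u"] s u by auto
        then have "v j \<le> s" using u by (simp add: v_def field_simps)
        then show "X s \<omega> \<in> D" using *[rule_format, of "s - v j" j] s by simp
      qed
      then show ?thesis using exit_time_greater_iff'[OF cont[OF that] D, of u] u by simp
    qed
    then have "{\<omega> \<in> space M. ereal u < exit_time D (\<lambda>s. X s \<omega>)}
        = (\<Inter>j. {\<omega> \<in> space M. \<forall>s\<in>{0..u - v j}. X (v j + s) \<omega> \<in> D})"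
      by auto
    also have "\<dots> \<in> sets M" using v by (intro sets.countable_INT') (auto intro!: stay simp: less_imp_le)
    finally show ?thesis .
  qed
  have "\<exists>u. y = ereal u \<and> u > 0" if "0 < y" "y \<noteq> \<infinity>" using that by (cases y) auto
  then consider "y < 0" | "y = 0" | u where "y = ereal u" "u > 0" | "y = \<infinity>"
    using linorder_less_linear[of y 0] by blast
  then show "{\<omega> \<in> space M. y < exit_time D (\<lambda>s. X s \<omega>)} \<in> sets M"
  proof cases
    case 1
    then have "{\<omega> \<in> space M. y < exit_time D (\<lambda>s. X s \<omega>)} = space M"
      using exit_time_nonneg[of D] by (auto intro: less_le_trans)
    then show ?thesis by simp
  next
    case 2
    have "{\<omega> \<in> space M. y < exit_time D (\<lambda>s. X s \<omega>)}
        = (\<Union>j. {\<omega> \<in> space M. ereal (1 / real (Suc j)) < exit_time D (\<lambda>s. X s \<omega>)})"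
    proof (intro equalityI subsetI)
      fix \<omega> assume \<omega>: "\<omega> \<in> {\<omega> \<in> space M. y < exit_time D (\<lambda>s. X s \<omega>)}"
      obtain z where z: "0 < ereal z" "ereal z < exit_time D (\<lambda>s. X s \<omega>)"
        using \<omega> 2 ereal_dense2[of 0 "exit_time D (\<lambda>s. X s \<omega>)"] by auto
      then obtain j where "1 / real (Suc j) < z" using nat_approx_posE[of z] by auto
      then have "ereal (1 / real (Suc j)) < exit_time D (\<lambda>s. X s \<omega>)"
        using z(2) by (meson ereal_less(2) less_ereal.simps(1) less_trans)
      then show "\<omega> \<in> (\<Union>j. {\<omega> \<in> space M. ereal (1 / real (Suc j)) < exit_time D (\<lambda>s. X s \<omega>)})"
        using \<omega> by blast
    next
      fix \<omega> assume "\<omega> \<in> (\<Union>j. {\<omega> \<in> space M. ereal (1 / real (Suc j)) < exit_time D (\<lambda>s. X s \<omega>)})"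
      then obtain j where j: "\<omega> \<in> space M" "ereal (1 / real (Suc j)) < exit_time D (\<lambda>s. X s \<omega>)" by blast
      have "0 < ereal (1 / real (Suc j))" by simp
      with j(2) have "0 < exit_time D (\<lambda>s. X s \<omega>)" by (rule less_trans[rotated])
      with j(1) 2 show "\<omega> \<in> {\<omega> \<in> space M. y < exit_time D (\<lambda>s. X s \<omega>)}" by simp
    qed
    also have "\<dots> \<in> sets M" by (intro sets.countable_UN'' pos) auto
    finally show ?thesis .
  next
    case 3
    then show ?thesis using pos by simp
  next
    case 4
    then show ?thesis by simp
  qed
qed

text \<open>The starting point is regarded as part of the sample point, so joint measurability is
  the previous lemma on a product space.\<close>

lemma borel_measurable_exit_time_Pair:
  fixes X :: "real \<Rightarrow> 'w \<Rightarrow> 'a::euclidean_space"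
  assumes meas: "\<And>s. s \<ge> 0 \<Longrightarrow> X s \<in> borel_measurable M"
    and cont: "\<And>\<omega>. \<omega> \<in> space M \<Longrightarrow> continuous_on {0..} (\<lambda>s. X s \<omega>)" and D: "open D"
  shows "(\<lambda>(x, \<omega>). exit_time D (\<lambda>s. x + X s \<omega> - X 0 \<omega>))
    \<in> borel_measurable (restrict_space lborel D \<Otimes>\<^sub>M M)"
proof -
  have id: "(\<lambda>x. x) \<in> borel_measurable (restrict_space lborel D)"
    by (intro measurable_restrict_space1) simp
  have "(\<lambda>p. exit_time D (\<lambda>s. fst p + X s (snd p) - X 0 (snd p)))
    \<in> borel_measurable (restrict_space lborel D \<Otimes>\<^sub>M M)"
  proof (rule borel_measurable_exit_time)
    fix s :: real assume [arith]: "s \<ge> 0"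
    note [measurable] = measurable_compose[OF measurable_fst id] meas[OF \<open>s \<ge> 0\<close>] meas[of 0]
    show "(\<lambda>p. fst p + X s (snd p) - X 0 (snd p)) \<in> borel_measurable (restrict_space lborel D \<Otimes>\<^sub>M M)"
      by measurable
  qed (use D cont in \<open>auto simp: space_pair_measure space_restrict_space intro!: continuous_intros\<close>)
  then show ?thesis by (simp add: case_prod_unfold)
qed

section \<open>Independence of the exit law from the realisation of Brownian motion\<close>

lemma brownian_motionD:
  assumes "brownian_motion M c x W"
  shows "prob_space M" "t \<ge> 0 \<Longrightarrow> W t \<in> borel_measurable M" "AE \<omega> in M. W 0 \<omega> = x"
    "\<omega> \<in> space M \<Longrightarrow> continuous_on {0..} (\<lambda>t. W t \<omega>)" "independent_increments M W"
    "0 \<le> s \<Longrightarrow> s < t \<Longrightarrow> distributed M lborel (\<lambda>\<omega>. W t \<omega> - W s \<omega>)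
          (\<lambda>y. ennreal (\<Prod>i\<in>Basis. normal_density 0 (sqrt (c * (t - s))) (y \<bullet> i)))"
  using assms unfolding brownian_motion_def by simp_all

text \<open>The event depends only on the increments along the grid. These are independent
  Gaussians, so their joint law is the same product measure for both motions.\<close>

lemma brownian_grid_prob_eq:
  fixes W :: "real \<Rightarrow> 'w \<Rightarrow> 'a::euclidean_space" and V :: "real \<Rightarrow> 'v \<Rightarrow> 'a"
  assumes W: "brownian_motion M c y W" and V: "brownian_motion K c z V" and h: "h > 0" and N: "N > 0"
    and [measurable]: "A \<in> sets borel"
  shows "measure M {\<omega>\<in>space M. \<forall>k\<le>N. x + W (real k * h) \<omega> - W 0 \<omega> \<in> A}
    = measure K {\<omega>\<in>space K. \<forall>k\<le>N. x + V (real k * h) \<omega> - V 0 \<omega> \<in> A}"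
proof -
  define B :: "(nat \<Rightarrow> 'a) set" where
    "B = {f \<in> space (PiM {..<N} (\<lambda>_. borel)). \<forall>k\<le>N. x + (\<Sum>i<k. f i) \<in> A}"
  have [measurable]: "B \<in> sets (PiM {..<N} (\<lambda>_. borel))"
  proof -
    have "(\<lambda>f. \<Sum>i<k. f i) \<in> borel_measurable (PiM {..<N} (\<lambda>_. borel :: 'a measure))" if "k \<le> N" for k
      using that by (intro borel_measurable_sum measurable_component_singleton) auto
    then have "{f \<in> space (PiM {..<N} (\<lambda>_. borel)). x + (\<Sum>i<k. f i) \<in> A} \<in> sets (PiM {..<N} (\<lambda>_. borel))"
      if "k \<le> N" for k using that by measurable
    then have "{f \<in> space (PiM {..<N} (\<lambda>_. borel)). \<forall>k\<in>{..N}. x + (\<Sum>i<k. f i) \<in> A}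
        \<in> sets (PiM {..<N} (\<lambda>_. borel))"
      by (intro sets.sets_Collect_finite_All) auto
    then show ?thesis by (simp add: B_def Ball_def)
  qed
  have *: "measure L {\<omega>\<in>space L. \<forall>k\<le>N. x + U (real k * h) \<omega> - U 0 \<omega> \<in> A}
    = measure (PiM {..<N} (\<lambda>i. density lborel
        (\<lambda>y. ennreal (\<Prod>b\<in>Basis. normal_density 0 (sqrt (c * (real (Suc i) * h - real i * h))) (y \<bullet> b))))) B"
    if U: "brownian_motion L c y' U" for L :: "'u measure" and U :: "real \<Rightarrow> 'u \<Rightarrow> 'a" and y'
  proof -
    interpret prob_space L by (rule brownian_motionD(1)[OF U])
    define inc where "inc i \<omega> = U (real (Suc i) * h) \<omega> - U (real i * h) \<omega>" for i :: nat and \<omega>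
    have [measurable]: "U (real k * h) \<in> borel_measurable L" for k :: nat
      using h by (intro brownian_motionD(2)[OF U]) simp
    have [measurable]: "inc i \<in> borel_measurable L" for i unfolding inc_def by measurable
    have "indep_vars (\<lambda>_. borel) inc {..<N}"
      using brownian_motionD(5)[OF U] h
      unfolding independent_increments_def inc_def[abs_def]
      by (elim allE[of _ "\<lambda>i. real i * h"] allE[of _ N]) (auto intro!: mono_onI mult_right_mono)
    then have eq: "distr L (PiM {..<N} (\<lambda>_. borel)) (\<lambda>\<omega>. \<lambda>i\<in>{..<N}. inc i \<omega>)
        = PiM {..<N} (\<lambda>i. distr L borel (inc i))"
      using N by (subst (asm) indep_vars_iff_distr_eq_PiM) auto
    have "distr L borel (inc i) = density lborel
        (\<lambda>y. ennreal (\<Prod>b\<in>Basis. normal_density 0 (sqrt (c * (real (Suc i) * h - real i * h))) (y \<bullet> b)))" for i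
    proof -
      have "distributed L lborel (inc i)
        (\<lambda>y. ennreal (\<Prod>b\<in>Basis. normal_density 0 (sqrt (c * (real (Suc i) * h - real i * h))) (y \<bullet> b)))"
        unfolding inc_def[abs_def] using h by (intro brownian_motionD(6)[OF U] mult_strict_right_mono) auto
      then have "distr L lborel (inc i) = density lborel
        (\<lambda>y. ennreal (\<Prod>b\<in>Basis. normal_density 0 (sqrt (c * (real (Suc i) * h - real i * h))) (y \<bullet> b)))"
        by (rule distributed_distr_eq_density)
      moreover have "distr L borel (inc i) = distr L lborel (inc i)" by (rule distr_cong) auto
      ultimately show ?thesis by simp
    qed
    note eq = eq[unfolded this]
    have tel: "(\<Sum>i<k. inc i \<omega>) = U (real k * h) \<omega> - U 0 \<omega>" for k \<omega>
      unfolding inc_def by (subst sum_lessThan_telescope) simp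
    have "{\<omega>\<in>space L. \<forall>k\<le>N. x + U (real k * h) \<omega> - U 0 \<omega> \<in> A}
        = (\<lambda>\<omega>. \<lambda>i\<in>{..<N}. inc i \<omega>) -` B \<inter> space L"
    proof -
      have "(\<Sum>i<k. (\<lambda>i\<in>{..<N}. inc i \<omega>) i) = U (real k * h) \<omega> - U 0 \<omega>" if "k \<le> N" for k \<omega>
        using that unfolding tel[symmetric] by (intro sum.cong) auto
      then show ?thesis by (auto simp: B_def space_PiM add_diff_eq)
    qed
    then have "measure L {\<omega>\<in>space L. \<forall>k\<le>N. x + U (real k * h) \<omega> - U 0 \<omega> \<in> A}
        = measure (distr L (PiM {..<N} (\<lambda>_. borel)) (\<lambda>\<omega>. \<lambda>i\<in>{..<N}. inc i \<omega>)) B"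
      by (subst measure_distr) auto
    then show ?thesis unfolding eq .
  qed
  show ?thesis unfolding *[OF W] *[OF V] ..
qed

text \<open>The path event is reached from grid events by two monotone limits: refining the grid
  decreases the event, then enlarging the compact set increases it. Grid probabilities agree for
  both motions, hence so do the limits.\<close>

lemma brownian_exit_time_prob_eq:
  fixes W :: "real \<Rightarrow> 'w \<Rightarrow> 'a::euclidean_space" and V :: "real \<Rightarrow> 'v \<Rightarrow> 'a"
  assumes W: "brownian_motion M c y W" and V: "brownian_motion K c z V"
    and D: "open D" "x \<in> D" and u: "u > 0"
  shows "measure M {\<omega>\<in>space M. ereal u < exit_time D (\<lambda>s. x + W s \<omega> - W 0 \<omega>)}
    = measure K {\<omega>\<in>space K. ereal u < exit_time D (\<lambda>s. x + V s \<omega> - V 0 \<omega>)}"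
proof -
  obtain C :: "nat \<Rightarrow> 'a set" where C: "\<And>n. compact (C n)" "\<And>n. C n \<subseteq> D" 
    "\<And>n. C n \<subseteq> interior (C (Suc n))" "\<And>K. \<lbrakk>compact K; K \<subseteq> D\<rbrakk> \<Longrightarrow> \<exists>N. \<forall>n\<ge>N. K \<subseteq> C n"
    by (rule open_Union_compact_subsets[OF D(1)]) blast
  have C_mono: "C n \<subseteq> C (Suc n)" for n using C(3)[of n] interior_subset by blast
  have [measurable]: "C m \<in> sets borel" for m using C(1) by (intro borel_compact)
  have *: "\<exists>p. (\<forall>m. (\<lambda>n. measure L {\<omega>\<in>space L. \<forall>k\<le>2 ^ n. x + U (real k * (u / 2 ^ n)) \<omega> - U 0 \<omega> \<in> C m}) \<longlonglongrightarrow> p m)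
      \<and> p \<longlonglongrightarrow> measure L {\<omega>\<in>space L. ereal u < exit_time D (\<lambda>s. x + U s \<omega> - U 0 \<omega>)}"
    if U: "brownian_motion L c y' U" for L :: "'u measure" and U :: "real \<Rightarrow> 'u \<Rightarrow> 'a" and y'
  proof -
    interpret prob_space L by (rule brownian_motionD(1)[OF U])
    define E where "E m n = {\<omega>\<in>space L. \<forall>k\<le>2 ^ n. x + U (real k * (u / 2 ^ n)) \<omega> - U 0 \<omega> \<in> C m}" for m n :: nat
    have [measurable]: "U (real k * (u / 2 ^ n)) \<in> borel_measurable L" "U 0 \<in> borel_measurable L" for k n :: nat
      using u by (auto intro!: brownian_motionD(2)[OF U])
    have E_meas [measurable]: "E m n \<in> events" for m n unfolding E_def by measurable
    have "E m (Suc n) \<subseteq> E m n" for m n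
    proof
      fix \<omega> assume \<omega>: "\<omega> \<in> E m (Suc n)"
      have "x + U (real k * (u / 2 ^ n)) \<omega> - U 0 \<omega> \<in> C m" if "k \<le> 2 ^ n" for k
      proof -
        have "2 * k \<le> 2 ^ Suc n" using that by simp
        then have "x + U (real (2 * k) * (u / 2 ^ Suc n)) \<omega> - U 0 \<omega> \<in> C m"
          using \<omega> unfolding E_def by blast
        moreover have "real (2 * k) * (u / 2 ^ Suc n) = real k * (u / 2 ^ n)" by simp
        ultimately show ?thesis by simp
      qed
      then show "\<omega> \<in> E m n" using \<omega> by (simp add: E_def)
    qed
    then have dec: "decseq (E m)" for m by (intro decseq_SucI)
    have "(\<lambda>n. prob (E m n)) \<longlonglongrightarrow> prob (\<Inter>n. E m n)" for m
      using dec by (intro finite_Lim_measure_decseq) auto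
    moreover have "(\<lambda>m. prob (\<Inter>n. E m n)) \<longlonglongrightarrow> prob (\<Union>m. \<Inter>n. E m n)"
    proof (rule finite_Lim_measure_incseq)
      have "E m n \<subseteq> E (Suc m) n" for m n using C_mono[of m] unfolding E_def by blast
      then show "incseq (\<lambda>m. \<Inter>n. E m n)" by (intro incseq_SucI) blast
    qed auto
    moreover have "(\<Union>m. \<Inter>n. E m n) = {\<omega>\<in>space L. ereal u < exit_time D (\<lambda>s. x + U s \<omega> - U 0 \<omega>)}"
    proof -
      have "\<omega> \<in> (\<Union>m. \<Inter>n. E m n) \<longleftrightarrow> ereal u < exit_time D (\<lambda>s. x + U s \<omega> - U 0 \<omega>)"
        if "\<omega> \<in> space L" for \<omega>
      proof -
        have "continuous_on {0..} (\<lambda>s. x + U s \<omega> - U 0 \<omega>)"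
          using brownian_motionD(4)[OF U that] by (intro continuous_intros)
        from exit_time_greater_iff[OF this D(1)] path_in_open_iff_dyadic[OF this _ C(1,2,4)] D(2) u
        have "ereal u < exit_time D (\<lambda>s. x + U s \<omega> - U 0 \<omega>) \<longleftrightarrow>
            (\<exists>m. \<forall>n. \<forall>k\<le>2 ^ n. x + U (real k * u / 2 ^ n) \<omega> - U 0 \<omega> \<in> C m)" by simp
        then show ?thesis using that by (simp add: E_def)
      qed
      moreover have "(\<Union>m. \<Inter>n. E m n) \<subseteq> space L" by (auto simp: E_def)
      ultimately show ?thesis by blast
    qed
    ultimately have "\<exists>p. (\<forall>m. (\<lambda>n. prob (E m n)) \<longlonglongrightarrow> p m)
      \<and> p \<longlonglongrightarrow> prob {\<omega>\<in>space L. ereal u < exit_time D (\<lambda>s. x + U s \<omega> - U 0 \<omega>)}"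
      by (intro exI[of _ "\<lambda>m. prob (\<Inter>n. E m n)"]) simp
    then show ?thesis unfolding E_def .
  qed
  obtain p where p: "\<And>m. (\<lambda>n. measure M {\<omega>\<in>space M. \<forall>k\<le>2 ^ n. x + W (real k * (u / 2 ^ n)) \<omega> - W 0 \<omega> \<in> C m}) \<longlonglongrightarrow> p m"
    "p \<longlonglongrightarrow> measure M {\<omega>\<in>space M. ereal u < exit_time D (\<lambda>s. x + W s \<omega> - W 0 \<omega>)}"
    using *[OF W] by auto
  obtain q where q: "\<And>m. (\<lambda>n. measure K {\<omega>\<in>space K. \<forall>k\<le>2 ^ n. x + V (real k * (u / 2 ^ n)) \<omega> - V 0 \<omega> \<in> C m}) \<longlonglongrightarrow> q m"
    "q \<longlonglongrightarrow> measure K {\<omega>\<in>space K. ereal u < exit_time D (\<lambda>s. x + V s \<omega> - V 0 \<omega>)}"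
    using *[OF V] by auto
  have eq: "measure M {\<omega>\<in>space M. \<forall>k\<le>2 ^ n. x + W (real k * (u / 2 ^ n)) \<omega> - W 0 \<omega> \<in> C m}
      = measure K {\<omega>\<in>space K. \<forall>k\<le>2 ^ n. x + V (real k * (u / 2 ^ n)) \<omega> - V 0 \<omega> \<in> C m}" for n m
    using u by (intro brownian_grid_prob_eq[OF W V]) auto
  have "p m = q m" for m by (rule LIMSEQ_unique[OF p(1)[unfolded eq] q(1)])
  then have "p = q" by auto
  with p(2) q(2) show ?thesis using LIMSEQ_unique by blast
qed

text \<open>Open upper rays and the whole space form an intersection-stable generator. Positivity
  settles rays starting at or below 0, and the ray from infinity is empty.\<close>

lemma distr_ereal_eqI:
  fixes f :: "'w \<Rightarrow> ereal" and g :: "'v \<Rightarrow> ereal"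
  assumes M: "prob_space M" and K: "prob_space K"
    and [measurable]: "f \<in> borel_measurable M" "g \<in> borel_measurable K"
    and pos: "\<And>\<omega>. \<omega> \<in> space M \<Longrightarrow> 0 < f \<omega>" "\<And>\<omega>. \<omega> \<in> space K \<Longrightarrow> 0 < g \<omega>"
    and eq: "\<And>u. u > 0 \<Longrightarrow> measure M {\<omega>\<in>space M. ereal u < f \<omega>} = measure K {\<omega>\<in>space K. ereal u < g \<omega>}"
  shows "distr M borel f = distr K borel g"
proof -
  interpret M: prob_space M by fact
  interpret K: prob_space K by fact
  have gen: "emeasure M {\<omega>\<in>space M. y < f \<omega>} = emeasure K {\<omega>\<in>space K. y < g \<omega>}" for y
  proof (cases "0 < y \<and> y < \<infinity>")
    case True
    then obtain u where "y = ereal u" "u > 0" by (cases y) auto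
    then show ?thesis using eq by (simp add: M.emeasure_eq_measure K.emeasure_eq_measure)
  next
    case False
    then consider "y \<le> 0" | "y = \<infinity>" by (cases y) (auto simp: not_less)
    then show ?thesis
    proof cases
      case 1
      then have "{\<omega>\<in>space M. y < f \<omega>} = space M" "{\<omega>\<in>space K. y < g \<omega>} = space K"
        using pos by (auto intro: le_less_trans)
      then show ?thesis by (simp add: M.emeasure_space_1 K.emeasure_space_1)
    qed simp
  qed
  show ?thesis
  proof (rule measure_eqI_generator_eq)
    let ?E = "insert UNIV (range greaterThan) :: ereal set set"
    show "Int_stable ?E"
    proof (rule Int_stableI)
      fix a b :: "ereal set" assume "a \<in> ?E" "b \<in> ?E"
      moreover have "{x<..} \<inter> {y<..} = {max x y<..}" for x y :: ereal by auto
      ultimately show "a \<inter> b \<in> ?E" by auto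
    qed
    show "emeasure (distr M borel f) X = emeasure (distr K borel g) X" if "X \<in> ?E" for X
    proof -
      have "emeasure (distr M borel f) {y<..} = emeasure (distr K borel g) {y<..}" for y
        using gen[of y] by (simp add: emeasure_distr vimage_def Int_def conj_commute)
      moreover have "emeasure (distr M borel f) UNIV = emeasure (distr K borel g) UNIV"
        by (simp add: emeasure_distr M.emeasure_space_1 K.emeasure_space_1)
      ultimately show ?thesis using that by auto
    qed
    have "sets borel = sigma_sets UNIV (range greaterThan :: ereal set set)"
      unfolding borel_Ioi by simp
    also have "\<dots> = sigma_sets UNIV ?E"
      by (intro sigma_sets_eqI) (auto intro: sigma_sets_top)
    finally show "sets (distr M borel f) = sigma_sets UNIV ?E" "sets (distr K borel g) = sigma_sets UNIV ?E"
      by simp_all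
    show "range (\<lambda>i::nat. UNIV) \<subseteq> ?E" by auto
    show "emeasure (distr M borel f) UNIV \<noteq> \<infinity>"
      by (simp add: emeasure_distr M.emeasure_space_1)
  qed auto
qed

lemma exit_time_pos:
  fixes w :: "real \<Rightarrow> 'a::real_normed_vector"
  assumes "continuous_on {0..} w" "open D" "w 0 \<in> D"
  shows "0 < exit_time D w"
  using exit_time_greater_iff[OF assms, of 0] assms(3) by (simp add: zero_ereal_def)

lemma brownian_translate_cont:
  assumes "brownian_motion M c y W" "\<omega> \<in> space M"
  shows "continuous_on {0..} (\<lambda>s. x + W s \<omega> - W 0 \<omega>)"
  using brownian_motionD(4)[OF assms] by (intro continuous_intros)

lemma borel_measurable_brownian_exit_time:
  fixes W :: "real \<Rightarrow> 'w \<Rightarrow> 'a::euclidean_space"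
  assumes W: "brownian_motion M c y W" and D: "open D"
  shows "(\<lambda>\<omega>. exit_time D (\<lambda>s. x + W s \<omega> - W 0 \<omega>)) \<in> borel_measurable M"
proof (rule borel_measurable_exit_time)
  fix s :: real assume "s \<ge> 0"
  note [measurable] = brownian_motionD(2)[OF W this] brownian_motionD(2)[OF W order_refl]
  show "(\<lambda>\<omega>. x + W s \<omega> - W 0 \<omega>) \<in> borel_measurable M" by measurable
qed (use D brownian_translate_cont[OF W] in auto)

text \<open>The bridge between the unrelated laws: it is used with M = P x and K = P 0.\<close>

lemma brownian_exit_time_distr_eq:
  fixes W :: "real \<Rightarrow> 'w \<Rightarrow> 'a::euclidean_space" and V :: "real \<Rightarrow> 'v \<Rightarrow> 'a"
  assumes W: "brownian_motion M c y W" and V: "brownian_motion K c z V" and D: "open D" "x \<in> D"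
  shows "distr M borel (\<lambda>\<omega>. exit_time D (\<lambda>s. x + W s \<omega> - W 0 \<omega>))
    = distr K borel (\<lambda>\<omega>. exit_time D (\<lambda>s. x + V s \<omega> - V 0 \<omega>))"
  using brownian_exit_time_prob_eq[OF W V D] D
  by (intro distr_ereal_eqI brownian_motionD(1)[OF W] brownian_motionD(1)[OF V]
      borel_measurable_brownian_exit_time[OF W D(1)] borel_measurable_brownian_exit_time[OF V D(1)]
      exit_time_pos brownian_translate_cont[OF W] brownian_translate_cont[OF V]) auto

section \<open>Small-time exit probabilities\<close>

lemma brownian_coordinate_tail:
  fixes W :: "real \<Rightarrow> 'w \<Rightarrow> 'a::euclidean_space"
  assumes W: "brownian_motion M c y W" and c: "c > 0" and st: "0 \<le> s" "s < t" and a: "a > 0"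
    and i: "i \<in> Basis"
  shows "measure M {\<omega>\<in>space M. a \<le> \<bar>(W t \<omega> - W s \<omega>) \<bullet> i\<bar>} \<le> 3 * (c * (t - s))\<^sup>2 / a ^ 4"
proof -
  interpret prob_space M by (rule brownian_motionD(1)[OF W])
  define \<sigma> where "\<sigma> = sqrt (c * (t - s))"
  have \<sigma>: "\<sigma> > 0" "\<sigma> ^ 4 = (c * (t - s))\<^sup>2"
    using c st by (simp_all add: \<sigma>_def power2_eq_square power4_eq_xxxx)
  note [measurable] = brownian_motionD(2)[OF W st(1)] brownian_motionD(2)[OF W, of t]
  have [measurable]: "W t \<in> borel_measurable M" using st by (intro brownian_motionD(2)[OF W]) auto
  \<comment> \<open>Factors of the Gaussian integral of the fourth power of coordinate
    \<open>i\<close>: only that coordinate carries the power, all others integrate to 1. The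
    resulting moment 3 \<sigma>^4 enters Markov's inequality below.\<close>
  define F where "F j x = ennreal (normal_density 0 \<sigma> x) * (if j = i then ennreal (x ^ 4) else 1)" for j and x :: real
  have Fi: "(\<integral>\<^sup>+x. F i x \<partial>lborel) = ennreal (3 * \<sigma> ^ 4)"
  proof -
    have "has_bochner_integral lborel (\<lambda>x. normal_density 0 \<sigma> x * x ^ 4) (3 * \<sigma> ^ 4)"
    proof -
      have "fact (2 * 2) / ((2 / \<sigma>\<^sup>2) ^ 2 * fact 2) = 3 * \<sigma> ^ 4"
        using \<sigma>(1) by (simp add: fact_numeral power_divide field_simps)
      with normal_moment_even[OF \<sigma>(1), of 0 2] show ?thesis by simp
    qed
    then have "(\<integral>\<^sup>+x. ennreal (normal_density 0 \<sigma> x * x ^ 4) \<partial>lborel) = ennreal (3 * \<sigma> ^ 4)"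
      unfolding has_bochner_integral_iff using \<sigma>(1)
      by (subst nn_integral_eq_integral) auto
    then show ?thesis by (simp add: F_def ennreal_mult')
  qed
  have Fj: "(\<integral>\<^sup>+x. F j x \<partial>lborel) = 1" if "j \<noteq> i" for j
    using that \<sigma>(1) integral_normal_density[of \<sigma> 0] integrable_normal_density[of \<sigma> 0]
    by (simp add: F_def nn_integral_eq_integral)
  have "distributed M lborel (\<lambda>\<omega>. W t \<omega> - W s \<omega>)
      (\<lambda>y. ennreal (\<Prod>j\<in>Basis. normal_density 0 \<sigma> (y \<bullet> j)))"
    unfolding \<sigma>_def by (rule brownian_motionD(6)[OF W st])
  then have "(\<integral>\<^sup>+\<omega>. ennreal (((W t \<omega> - W s \<omega>) \<bullet> i) ^ 4) \<partial>M)
      = (\<integral>\<^sup>+y. ennreal (\<Prod>j\<in>Basis. normal_density 0 \<sigma> (y \<bullet> j)) * ennreal ((y \<bullet> i) ^ 4) \<partial>lborel)"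
    by (intro distributed_nn_integral[symmetric]) auto
  also have "\<dots> = (\<integral>\<^sup>+y. (\<Prod>j\<in>Basis. F j (y \<bullet> j)) \<partial>lborel)"
    using i \<sigma>(1)
    by (intro nn_integral_cong) (simp add: F_def prod.distrib prod_ennreal prod.delta)
  also have "\<dots> = (\<Prod>j\<in>Basis. \<integral>\<^sup>+x. F j x \<partial>lborel)"
    unfolding F_def by (rule nn_integral_lborel_prod) auto
  also have "\<dots> = ennreal (3 * \<sigma> ^ 4)"
    using i by (subst prod.remove[of _ i]) (auto simp: Fi Fj)
  finally have mom: "(\<integral>\<^sup>+\<omega>. ennreal (((W t \<omega> - W s \<omega>) \<bullet> i) ^ 4) \<partial>M) = ennreal (3 * \<sigma> ^ 4)" .
  have "emeasure M {\<omega>\<in>space M. a \<le> \<bar>(W t \<omega> - W s \<omega>) \<bullet> i\<bar>}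
      = (\<integral>\<^sup>+\<omega>. indicator {\<omega>\<in>space M. a \<le> \<bar>(W t \<omega> - W s \<omega>) \<bullet> i\<bar>} \<omega> \<partial>M)"
    by simp
  also have "\<dots> \<le> (\<integral>\<^sup>+\<omega>. ennreal (1 / a ^ 4) * ennreal (((W t \<omega> - W s \<omega>) \<bullet> i) ^ 4) \<partial>M)"
  proof (rule nn_integral_mono)
    fix \<omega>
    have "1 \<le> 1 / a ^ 4 * z ^ 4" if "a \<le> \<bar>z\<bar>" for z
      using power_mono[OF that, of 4] a by (simp add: power_even_abs)
    then show "indicator {\<omega>\<in>space M. a \<le> \<bar>(W t \<omega> - W s \<omega>) \<bullet> i\<bar>} \<omega>
        \<le> ennreal (1 / a ^ 4) * ennreal (((W t \<omega> - W s \<omega>) \<bullet> i) ^ 4)"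
      using a by (auto simp: indicator_def simp flip: ennreal_mult' ennreal_1 intro!: ennreal_leI)
  qed
  also have "\<dots> = ennreal (1 / a ^ 4) * ennreal (3 * \<sigma> ^ 4)"
    by (subst nn_integral_cmult) (auto simp: mom)
  also have "\<dots> = ennreal (3 * \<sigma> ^ 4 / a ^ 4)"
    using a by (subst ennreal_mult'[symmetric]) auto
  finally show ?thesis using a by (simp add: emeasure_eq_measure \<sigma>(2) ennreal_le_iff)
qed

text \<open>If the norm is at least a, some coordinate is at least a / d by comparison with the l1
  norm. The union bound over d coordinates and the fourth power of d from the threshold give
  d^5.\<close>

lemma brownian_increment_tail:
  fixes W :: "real \<Rightarrow> 'w \<Rightarrow> 'a::euclidean_space"
  assumes W: "brownian_motion M c y W" and c: "c > 0" and st: "0 \<le> s" "s < t" and a: "a > 0"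
  shows "measure M {\<omega>\<in>space M. a \<le> norm (W t \<omega> - W s \<omega>)}
    \<le> 3 * real DIM('a) ^ 5 * (c * (t - s))\<^sup>2 / a ^ 4"
proof -
  interpret prob_space M by (rule brownian_motionD(1)[OF W])
  have [measurable]: "W t \<in> borel_measurable M" "W s \<in> borel_measurable M"
    using st by (auto intro!: brownian_motionD(2)[OF W])
  let ?d = "real DIM('a)"
  have d: "?d > 0" by simp
  define E where "E i = {\<omega>\<in>space M. a / ?d \<le> \<bar>(W t \<omega> - W s \<omega>) \<bullet> i\<bar>}" for i
  have [measurable]: "E i \<in> events" for i unfolding E_def by measurable
  have "{\<omega>\<in>space M. a \<le> norm (W t \<omega> - W s \<omega>)} \<subseteq> (\<Union>i\<in>Basis. E i)"
  proof (rule ccontr)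
    assume "\<not> ?thesis"
    then obtain \<omega> where \<omega>: "\<omega> \<in> space M" "a \<le> norm (W t \<omega> - W s \<omega>)" "\<And>i. i \<in> Basis \<Longrightarrow> \<omega> \<notin> E i"
      by auto
    have "norm (W t \<omega> - W s \<omega>) \<le> (\<Sum>i\<in>Basis. \<bar>(W t \<omega> - W s \<omega>) \<bullet> i\<bar>)" by (rule norm_le_l1)
    also have "\<dots> < (\<Sum>i\<in>(Basis::'a set). a / ?d)"
      using \<omega> by (intro sum_strict_mono) (auto simp: E_def not_le)
    also have "\<dots> = a" by simp
    finally show False using \<omega>(2) by simp
  qed
  then have "prob {\<omega>\<in>space M. a \<le> norm (W t \<omega> - W s \<omega>)} \<le> prob (\<Union>i\<in>Basis. E i)"
    by (intro finite_measure_mono sets.finite_UN) auto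
  also have "\<dots> \<le> (\<Sum>i\<in>Basis. prob (E i))"
    by (intro finite_measure_subadditive_finite) auto
  also have "\<dots> \<le> (\<Sum>i\<in>(Basis::'a set). 3 * (c * (t - s))\<^sup>2 / (a / ?d) ^ 4)"
    unfolding E_def using a d
    by (intro sum_mono brownian_coordinate_tail[OF W c st]) (auto intro!: divide_pos_pos)
  also have "\<dots> = 3 * ?d ^ 5 * (c * (t - s))\<^sup>2 / a ^ 4"
    by (simp add: power_divide eval_nat_numeral)
  finally show ?thesis .
qed

text \<open>Chaining along the dyadic grid: level \<open>m\<close> is allowed increments of size
  \<open>\<delta> / 20 * (9 / 10) ^ m\<close>, which add up to \<open>\<delta> / 2\<close>; since \<open>(10 / 9) ^ 4 < 2\<close>, the fourth moment
  of the increments makes the union bound summable.\<close>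

lemma norm_dyadic_chain_le:
  fixes w :: "real \<Rightarrow> 'a::real_normed_vector"
  assumes step: "\<And>m k. m \<le> n \<Longrightarrow> k < 2 ^ m \<Longrightarrow>
    norm (w (real (Suc k) * (u / 2 ^ m)) - w (real k * (u / 2 ^ m))) \<le> a m"
    and a: "\<And>m. 0 \<le> a m" and k: "k \<le> 2 ^ n"
  shows "norm (w (real k * (u / 2 ^ n)) - w 0) \<le> (\<Sum>m\<le>n. a m)"
  using step k
proof (induction n arbitrary: k)
  case 0
  then have "k = 0 \<or> k = 1" by auto
  then show ?case using 0(1)[of 0 0] a[of 0] by auto
next
  case (Suc n)
  \<comment> \<open>An even grid index already belongs to the coarser level; an odd one is a single
    step away from it.\<close>
  define j where "j = k div 2"
  have j: "j \<le> 2 ^ n" using Suc.prems(2) by (simp add: j_def)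
  have half: "real (2 * j) * (u / 2 ^ Suc n) = real j * (u / 2 ^ n)" by simp
  have IH: "norm (w (real (2 * j) * (u / 2 ^ Suc n)) - w 0) \<le> (\<Sum>m\<le>n. a m)"
    unfolding half using Suc.prems(1) j by (intro Suc.IH) auto
  consider "k = 2 * j" | "k = Suc (2 * j)" unfolding j_def by linarith
  then show ?case
  proof cases
    case 1
    then show ?thesis using IH a[of "Suc n"] by simp
  next
    case 2
    then have "2 * j < 2 ^ Suc n" using Suc.prems(2) by simp
    then have "norm (w (real k * (u / 2 ^ Suc n)) - w (real (2 * j) * (u / 2 ^ Suc n))) \<le> a (Suc n)"
      unfolding 2 by (rule Suc.prems(1)[OF order_refl])
    moreover have "norm (w (real k * (u / 2 ^ Suc n)) - w 0) \<le>
        norm (w (real k * (u / 2 ^ Suc n)) - w (real (2 * j) * (u / 2 ^ Suc n)))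
        + norm (w (real (2 * j) * (u / 2 ^ Suc n)) - w 0)"
      using norm_triangle_ineq[of "w (real k * (u / 2 ^ Suc n)) - w (real (2 * j) * (u / 2 ^ Suc n))"
          "w (real (2 * j) * (u / 2 ^ Suc n)) - w 0"] by simp
    ultimately show ?thesis using IH by simp
  qed
qed

text \<open>\<open>K\<close> depends only on the dimension and \<open>c\<close>, so it is the same
  for all copies of \<open>G0\<close> and all starting points, as the later sum over words
  requires.\<close>

lemma brownian_exit_time_le:
  fixes c :: real
  assumes c: "c > 0"
  obtains K where "K \<ge> 0"
    "\<And>(M :: 'w measure) (W :: real \<Rightarrow> 'w \<Rightarrow> 'a::euclidean_space) y D x \<delta> u. brownian_motion M c y W \<Longrightarrow>
      open D \<Longrightarrow> ball x \<delta> \<subseteq> D \<Longrightarrow> \<delta> > 0 \<Longrightarrow> u > 0 \<Longrightarrow>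
      measure M {\<omega>\<in>space M. exit_time D (\<lambda>s. x + W s \<omega> - W 0 \<omega>) \<le> ereal u} \<le> K * u\<^sup>2 / \<delta> ^ 4"
proof -
  \<comment> \<open>q = (10/9)^4 / 2. Level m has 2^m increments, the squared variance gives 4^(-m),
    and the threshold gives (10/9)^(4 m); the product is q^m. The factor 160000 in \<open>L\<close>
    is 20^4, from the threshold \<delta> / 20.\<close>
  define q :: real where "q = 10000 / 13122"
  define L :: real where "L = 3 * real DIM('a) ^ 5 * c\<^sup>2 * 160000"
  define K where "K = L / (1 - q)"
  have L: "L \<ge> 0" by (simp add: L_def)
  have bound: "measure M {\<omega>\<in>space M. exit_time D (\<lambda>s. x + W s \<omega> - W 0 \<omega>) \<le> ereal u} \<le> K * u\<^sup>2 / \<delta> ^ 4"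
    if W: "brownian_motion M c y W" and D: "open D" "ball x \<delta> \<subseteq> D" and \<delta>: "\<delta> > 0" and u: "u > 0"
    for M :: "'w measure" and W :: "real \<Rightarrow> 'w \<Rightarrow> 'a" and y D x \<delta> u
  proof -
    interpret prob_space M by (rule brownian_motionD(1)[OF W])
    have x: "x \<in> D" using D(2) \<delta> by auto
    define a where "a m = \<delta> / 20 * (9 / 10) ^ m" for m :: nat
    have a: "a m > 0" for m using \<delta> by (simp add: a_def)
    have asum: "(\<Sum>m\<le>n. a m) \<le> \<delta> / 2" for n
    proof -
      have "(\<Sum>m\<le>n. (9 / 10 :: real) ^ m) \<le> (\<Sum>m. (9 / 10) ^ m)"
        by (intro sum_le_suminf summable_geometric) auto
      also have "\<dots> = 10" by (subst suminf_geometric) auto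
      finally have "\<delta> / 20 * (\<Sum>m\<le>n. (9 / 10 :: real) ^ m) \<le> \<delta> / 20 * 10"
        using \<delta> by (intro mult_left_mono) auto
      then show ?thesis by (simp add: a_def sum_distrib_left)
    qed
    define E where "E m k = {\<omega>\<in>space M. a m \<le> norm (W (real (Suc k) * (u / 2 ^ m)) \<omega> - W (real k * (u / 2 ^ m)) \<omega>)}"
      for m k :: nat
    have [measurable]: "W (real k * (u / 2 ^ m)) \<in> borel_measurable M" for k m :: nat
      using u by (intro brownian_motionD(2)[OF W]) simp
    have E_meas [measurable]: "E m k \<in> events" for m k unfolding E_def by measurable
    have "prob (E m k) \<le> L * u\<^sup>2 / \<delta> ^ 4 * q ^ m / 2 ^ m" for m k
    proof -
      have "prob (E m k) \<le> 3 * real DIM('a) ^ 5 * (c * (real (Suc k) * (u / 2 ^ m) - real k * (u / 2 ^ m)))\<^sup>2 / a m ^ 4"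
        unfolding E_def using u
        by (intro brownian_increment_tail[OF W c _ _ a]) (auto simp: divide_strict_right_mono)
      also have "real (Suc k) * (u / 2 ^ m) - real k * (u / 2 ^ m) = u / 2 ^ m"
        by (simp add: add_divide_distrib algebra_simps)
      also have "a m ^ 4 = \<delta> ^ 4 / 160000 * (6561 / 10000) ^ m"
        by (simp add: a_def power_mult_distrib power_divide flip: power_mult mult.commute[of 4])
          (simp add: power_mult)
      also have "3 * real DIM('a) ^ 5 * (c * (u / 2 ^ m))\<^sup>2 / (\<delta> ^ 4 / 160000 * (6561 / 10000) ^ m)
          = L * u\<^sup>2 / \<delta> ^ 4 * ((10000 / 6561) ^ m / (2 ^ m)\<^sup>2)"
        by (simp add: L_def power_mult_distrib power_divide field_simps)
      also have "(10000 / 6561 :: real) ^ m / (2 ^ m)\<^sup>2 = q ^ m / 2 ^ m"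
      proof -
        have "(10000 / 6561 :: real) = 2 * q" by (simp add: q_def)
        then show ?thesis by (simp only: power_mult_distrib power2_eq_square) simp
      qed
      finally show ?thesis by simp
    qed
    note E_le = this
    define B where "B m = (\<Union>k<2 ^ m. E m k)" for m
    have [measurable]: "B m \<in> events" for m unfolding B_def by auto
    have B_le: "prob (B m) \<le> L * u\<^sup>2 / \<delta> ^ 4 * q ^ m" for m
    proof -
      have "prob (B m) \<le> (\<Sum>k<2 ^ m. prob (E m k))"
        unfolding B_def by (intro finite_measure_subadditive_finite) auto
      also have "\<dots> \<le> (\<Sum>k<(2::nat) ^ m. L * u\<^sup>2 / \<delta> ^ 4 * q ^ m / 2 ^ m)"
        by (intro sum_mono E_le)
      also have "\<dots> = L * u\<^sup>2 / \<delta> ^ 4 * q ^ m" by simp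
      finally show ?thesis .
    qed
    have q: "0 \<le> q" "q < 1" by (simp_all add: q_def)
    have geo: "summable (\<lambda>m. L * u\<^sup>2 / \<delta> ^ 4 * q ^ m)"
      using q by (intro summable_mult summable_geometric) auto
    have sB: "summable (\<lambda>m. prob (B m))"
      by (rule summable_comparison_test'[OF geo, of 0]) (simp only: real_norm_def abs_of_nonneg[OF measure_nonneg] B_le)
    have "prob (\<Union>m. B m) \<le> (\<Sum>m. prob (B m))"
      using sB by (intro finite_measure_subadditive_countably) auto
    also have "\<dots> \<le> (\<Sum>m. L * u\<^sup>2 / \<delta> ^ 4 * q ^ m)"
      by (intro suminf_le B_le sB geo)
    also have "\<dots> = K * u\<^sup>2 / \<delta> ^ 4"
      using q by (subst suminf_mult) (auto simp: summable_geometric suminf_geometric K_def)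
    finally have B: "prob (\<Union>m. B m) \<le> K * u\<^sup>2 / \<delta> ^ 4" .
    \<comment> \<open>Off the bad events the thresholds sum to at most \<delta> / 2, so the path is
      in the closed half-radius ball at dyadic times, hence during all of [0, u], and the exit comes
      strictly later.\<close>
    have "{\<omega>\<in>space M. exit_time D (\<lambda>s. x + W s \<omega> - W 0 \<omega>) \<le> ereal u} \<subseteq> (\<Union>m. B m)"
    proof (rule ccontr)
      assume "\<not> ?thesis"
      then obtain \<omega> where \<omega>: "\<omega> \<in> space M" "exit_time D (\<lambda>s. x + W s \<omega> - W 0 \<omega>) \<le> ereal u"
        "\<And>m. \<omega> \<notin> B m" by blast
      have step: "norm (W (real (Suc k) * (u / 2 ^ m)) \<omega> - W (real k * (u / 2 ^ m)) \<omega>) \<le> a m"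
        if "k < 2 ^ m" for k m
        using \<omega>(3)[of m] \<omega>(1) that by (force simp: B_def E_def not_le)
      have cont: "continuous_on {0..} (\<lambda>s. x + W s \<omega> - W 0 \<omega>)"
        by (rule brownian_translate_cont[OF W \<omega>(1)])
      have "x + W s \<omega> - W 0 \<omega> \<in> cball x (\<delta> / 2)" if s: "s \<in> {0..u}" for s
      proof (rule dyadic_closed[OF cont closed_cball less_imp_le[OF u] _ s])
        fix n k :: nat assume "k \<le> 2 ^ n"
        then have "norm (W (real k * (u / 2 ^ n)) \<omega> - W 0 \<omega>) \<le> (\<Sum>m\<le>n. a m)"
          using step a by (intro norm_dyadic_chain_le[where w = "\<lambda>s. W s \<omega>"]) (auto simp: less_imp_le)
        also note asum
        finally show "x + W (real k * u / 2 ^ n) \<omega> - W 0 \<omega> \<in> cball x (\<delta> / 2)"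
          by (simp add: dist_norm norm_minus_commute algebra_simps)
      qed
      moreover have "cball x (\<delta> / 2) \<subseteq> D" using D(2) \<delta> by (force simp: subset_eq)
      ultimately have "ereal u < exit_time D (\<lambda>s. x + W s \<omega> - W 0 \<omega>)"
        using x u by (subst exit_time_greater_iff[OF cont D(1)]) auto
      with \<omega>(2) show False by simp
    qed
    then have "prob {\<omega>\<in>space M. exit_time D (\<lambda>s. x + W s \<omega> - W 0 \<omega>) \<le> ereal u} \<le> prob (\<Union>m. B m)"
      by (intro finite_measure_mono) auto
    with B show ?thesis by linarith
  qed
  have "K \<ge> 0" using L by (simp add: K_def q_def)
  then show ?thesis using that bound by blast
qed

lemma nn_integral_powr_tail:
  fixes \<beta> v :: real
  assumes "\<beta> > 0" "v > 0"
  shows "(\<integral>\<^sup>+u. ennreal (u powr (- 1 - \<beta>)) * indicator {v..} u \<partial>lborel) = ennreal (v powr (- \<beta>) / \<beta>)"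
proof -
  have "(\<integral>\<^sup>+u. ennreal (u powr (- 1 - \<beta>)) * indicator {v..} u \<partial>lborel)
      = ennreal (0 - (- (v powr (- \<beta>)) / \<beta>))"
  proof (rule nn_integral_FTC_atLeast)
    fix u assume "v \<le> u"
    then have "u > 0" using assms by simp
    then show "DERIV (\<lambda>u. - (u powr (- \<beta>)) / \<beta>) u :> u powr (- 1 - \<beta>)"
      using assms by (auto intro!: derivative_eq_intros simp: powr_diff powr_minus field_simps)
  next
    have "((\<lambda>u. u powr (- \<beta>)) \<longlongrightarrow> 0) at_top"
      using assms by (intro tendsto_neg_powr filterlim_ident) auto
    then have "((\<lambda>u. - (u powr (- \<beta>)) / \<beta>) \<longlongrightarrow> - 0 / \<beta>) at_top"
      by (intro tendsto_intros) (use assms in auto)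
    then show "((\<lambda>u. - (u powr (- \<beta>)) / \<beta>) \<longlongrightarrow> 0) at_top" by simp
  qed auto
  then show ?thesis by simp
qed

text \<open>Split at the Brownian time scale v = \<delta>^2: below it the quadratic bound makes the
  integrand at most the constant \<open>A\<close>, above it p \<le> 1 leaves the tail of
  u^(-1-\<beta>). Both parts are of order v^(-\<beta>).\<close>

lemma nn_integral_exit_bound:
  fixes p :: "real \<Rightarrow> ennreal"
  assumes \<beta>: "0 < \<beta>" "\<beta> < 1" and \<delta>: "\<delta> > 0" and K: "K \<ge> 0"
    and p1: "\<And>u. u > 0 \<Longrightarrow> p u \<le> 1" and p2: "\<And>u. u > 0 \<Longrightarrow> p u \<le> ennreal (K * u\<^sup>2 / \<delta> ^ 4)"
  shows "(\<integral>\<^sup>+u\<in>{0<..}. ennreal (u powr (- 1 - \<beta>)) * p u \<partial>lborel) \<le> ennreal ((K + 1 / \<beta>) * \<delta> powr (- (2 * \<beta>)))"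
proof -
  define v where "v = \<delta>\<^sup>2"
  have v: "v > 0" using \<delta> by (simp add: v_def)
  have vp: "\<delta> powr (- (2 * \<beta>)) = v powr (- \<beta>)"
    using \<delta> by (simp add: v_def powr_powr flip: powr_numeral)
  define A where "A = K * v powr (- 1 - \<beta>)"
  have "ennreal (u powr (- 1 - \<beta>)) * p u * indicator {0<..} u
      \<le> ennreal A * indicator {0..v} u + ennreal (u powr (- 1 - \<beta>)) * indicator {v..} u" for u
  proof -
    consider "u \<le> 0" | "0 < u" "u < v" | "u \<ge> v" "u > 0" by linarith
    then show ?thesis
    proof cases
      case 2
      have "ennreal (u powr (- 1 - \<beta>)) * p u \<le> ennreal (u powr (- 1 - \<beta>)) * ennreal (K * u\<^sup>2 / \<delta> ^ 4)"
        using p2 2 by (intro mult_left_mono) auto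
      also have "\<dots> = ennreal (K * (u powr (- 1 - \<beta>) * u\<^sup>2) / v\<^sup>2)"
        by (simp add: ennreal_mult'[symmetric] v_def mult_ac flip: power_mult)
      also have "u powr (- 1 - \<beta>) * u\<^sup>2 = u powr (1 - \<beta>)"
        using 2 by (simp flip: powr_numeral powr_add)
      also have "K * u powr (1 - \<beta>) / v\<^sup>2 \<le> K * v powr (1 - \<beta>) / v\<^sup>2"
        using 2 \<beta> K by (intro divide_right_mono mult_left_mono powr_mono2) auto
      also have "\<dots> = A"
      proof -
        have "v powr (1 - \<beta>) = v powr (- 1 - \<beta>) * v\<^sup>2"
          using v by (simp flip: powr_numeral powr_add)
        then show ?thesis using v by (simp add: A_def)
      qed
      finally have "ennreal (u powr (- 1 - \<beta>)) * p u \<le> ennreal A" by (simp add: ennreal_leI)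
      then show ?thesis using 2 by simp
    next
      case 3
      have "ennreal (u powr (- 1 - \<beta>)) * p u \<le> ennreal (u powr (- 1 - \<beta>)) * 1"
        using p1 3 by (intro mult_left_mono) auto
      then show ?thesis using 3 by (simp add: add_increasing)
    qed simp
  qed
  then have "(\<integral>\<^sup>+u\<in>{0<..}. ennreal (u powr (- 1 - \<beta>)) * p u \<partial>lborel)
      \<le> (\<integral>\<^sup>+u. ennreal A * indicator {0..v} u + ennreal (u powr (- 1 - \<beta>)) * indicator {v..} u \<partial>lborel)"
    by (intro nn_integral_mono)
  also have "\<dots> = ennreal A * ennreal v + ennreal (v powr (- \<beta>) / \<beta>)"
    using v \<beta> by (subst nn_integral_add) (auto simp: nn_integral_cmult nn_integral_powr_tail)
  also have "\<dots> = ennreal (A * v + v powr (- \<beta>) / \<beta>)"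
    using v \<beta> K by (simp add: A_def ennreal_mult'[symmetric] ennreal_plus[symmetric] del: ennreal_plus)
  also have "A * v + v powr (- \<beta>) / \<beta> = (K + 1 / \<beta>) * \<delta> powr (- (2 * \<beta>))"
    unfolding vp using v by (simp add: A_def powr_diff powr_minus field_simps)
  finally show ?thesis .
qed

section \<open>Subordination\<close>

text \<open>Layer-cake formula by Tonelli. For a = -1-\<beta> the inner integral is T^(-\<beta>) /
  \<beta> at finite positive T. It is used both for a fixed starting point and on the product of
  \<open>G\<close> with Wiener space.\<close>

lemma nn_integral_layer:
  fixes T :: "'m \<Rightarrow> ereal"
  assumes M: "sigma_finite_measure M" and [measurable]: "T \<in> borel_measurable M"
  shows "(\<integral>\<^sup>+p. (\<integral>\<^sup>+u. ennreal (u powr a) * (if 0 < u \<and> T p \<le> ereal u then 1 else 0) \<partial>lborel) \<partial>M)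
    = (\<integral>\<^sup>+u\<in>{0<..}. ennreal (u powr a) * emeasure M {p\<in>space M. T p \<le> ereal u} \<partial>lborel)"
proof -
  interpret sigma_finite_measure M by fact
  interpret MU: pair_sigma_finite M "lborel :: real measure" ..
  have "(\<integral>\<^sup>+p. (\<integral>\<^sup>+u. ennreal (u powr a) * (if 0 < u \<and> T p \<le> ereal u then 1 else 0) \<partial>lborel) \<partial>M)
      = (\<integral>\<^sup>+u. (\<integral>\<^sup>+p. ennreal (u powr a) * (if 0 < u \<and> T p \<le> ereal u then 1 else 0) \<partial>M) \<partial>lborel)"
    by (rule MU.Fubini'[symmetric]) measurable
  also have "\<dots> = (\<integral>\<^sup>+u\<in>{0<..}. ennreal (u powr a) * emeasure M {p\<in>space M. T p \<le> ereal u} \<partial>lborel)"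
  proof (rule nn_integral_cong)
    fix u :: real
    have "(\<integral>\<^sup>+p. ennreal (u powr a) * (if 0 < u \<and> T p \<le> ereal u then 1 else 0) \<partial>M)
        = (\<integral>\<^sup>+p. (ennreal (u powr a) * indicator {0<..} u) * indicator {p\<in>space M. T p \<le> ereal u} p \<partial>M)"
      by (intro nn_integral_cong) (auto simp: indicator_def)
    also have "\<dots> = (ennreal (u powr a) * indicator {0<..} u) * emeasure M {p\<in>space M. T p \<le> ereal u}"
      by (rule nn_integral_cmult_indicator) measurable
    finally show "(\<integral>\<^sup>+p. ennreal (u powr a) * (if 0 < u \<and> T p \<le> ereal u then 1 else 0) \<partial>M)
        = ennreal (u powr a) * emeasure M {p\<in>space M. T p \<le> ereal u} * indicator {0<..} u"
      by (simp add: ac_simps)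
  qed
  finally show ?thesis .
qed

text \<open>The layer formula identifies the integral of T^(-\<beta>) as \<beta> J. This same
  function, divided by 1 - exp(-1), dominates the tails over t, and divided by Gamma(1-\<beta>) is
  their limit.\<close>

lemma subordinator_limit:
  fixes T :: "'m \<Rightarrow> ereal" and S :: "real \<Rightarrow> 'w \<Rightarrow> real"
  assumes M: "finite_measure M" and [measurable]: "T \<in> borel_measurable M"
    and T: "\<And>p. p \<in> space M \<Longrightarrow> 0 < T p"
    and S: "stable_subordinator K \<beta> S" and \<beta>: "0 < \<beta>" "\<beta> < 1"
    and H: "\<And>t. t > 0 \<Longrightarrow> (\<lambda>v. measure K {\<omega>\<in>space K. v \<le> ereal (S t \<omega>)}) \<in> borel_measurable borel"
    and fin: "(\<integral>\<^sup>+u\<in>{0<..}. ennreal (u powr (- 1 - \<beta>)) * emeasure M {p\<in>space M. T p \<le> ereal u} \<partial>lborel) < \<infinity>"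
  defines "J \<equiv> LINT u:{0<..}|lborel. measure M {p\<in>space M. T p \<le> ereal u} * u powr (- 1 - \<beta>)"
  shows "set_integrable lborel {0<..} (\<lambda>u. measure M {p\<in>space M. T p \<le> ereal u} * u powr (- 1 - \<beta>))"
    "((\<lambda>t. (\<integral>p. measure K {\<omega>\<in>space K. T p \<le> ereal (S t \<omega>)} \<partial>M) / t)
      \<longlongrightarrow> \<beta> / Gamma (1 - \<beta>) * J) (at_right 0)"
proof -
  interpret M: finite_measure M by fact
  interpret K: prob_space K using S by (simp add: stable_subordinator_def)
  define m where "m u = measure M {p\<in>space M. T p \<le> ereal u}" for u
  have "mono m" unfolding m_def
    by (intro monoI M.finite_measure_mono) (auto intro: order_trans)
  then have [measurable]: "m \<in> borel_measurable borel" by (rule borel_measurable_mono)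
  have m: "emeasure M {p\<in>space M. T p \<le> ereal u} = ennreal (m u)" for u
    by (simp add: m_def M.emeasure_eq_measure)
  have eq_m: "(\<integral>\<^sup>+u\<in>{0<..}. ennreal (u powr (- 1 - \<beta>)) * emeasure M {p\<in>space M. T p \<le> ereal u} \<partial>lborel)
      = (\<integral>\<^sup>+u. ennreal (indicator {0<..} u * (m u * u powr (- 1 - \<beta>))) \<partial>lborel)"
    unfolding m
    by (intro nn_integral_cong) (auto simp: indicator_def m_def mult.commute simp flip: ennreal_mult')
  have int: "integrable lborel (\<lambda>u. indicator {0<..} u * (m u * u powr (- 1 - \<beta>)))"
    using fin unfolding eq_m by (intro integrableI_nonneg) (auto simp: m_def)
  then show "set_integrable lborel {0<..} (\<lambda>u. measure M {p\<in>space M. T p \<le> ereal u} * u powr (- 1 - \<beta>))"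
    unfolding set_integrable_def m_def by simp
  have J: "(\<integral>\<^sup>+u. ennreal (indicator {0<..} u * (m u * u powr (- 1 - \<beta>))) \<partial>lborel) = ennreal J"
    unfolding J_def set_lebesgue_integral_def using int
    by (subst nn_integral_eq_integral) (auto simp: m_def)
  have J0: "J \<ge> 0" unfolding J_def set_lebesgue_integral_def by (intro integral_nonneg_AE) (auto simp: m_def)
  \<comment> \<open>At T = \<infinity> both sides vanish: \<open>real_of_ereal\<close> of infinity
    is 0 and 0 to any power is 0 for \<open>powr\<close>. A path that never leaves thus contributes
    nothing.\<close>
  have inner: "(\<integral>\<^sup>+u. ennreal (u powr (- 1 - \<beta>)) * (if 0 < u \<and> T p \<le> ereal u then 1 else 0) \<partial>lborel)
      = ennreal (real_of_ereal (T p) powr (- \<beta>) / \<beta>)" if "p \<in> space M" for p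
  proof (cases "T p")
    case (real v)
    then have v: "v > 0" using T[OF that] by simp
    have "(\<integral>\<^sup>+u. ennreal (u powr (- 1 - \<beta>)) * (if 0 < u \<and> T p \<le> ereal u then 1 else 0) \<partial>lborel)
        = (\<integral>\<^sup>+u. ennreal (u powr (- 1 - \<beta>)) * indicator {v..} u \<partial>lborel)"
      using v real by (intro nn_integral_cong) (auto simp: indicator_def)
    then show ?thesis using nn_integral_powr_tail[OF \<beta>(1) v] real by simp
  next
    case PInf
    then show ?thesis by simp
  next
    case MInf
    then show ?thesis using T[OF that] by simp
  qed
  have "(\<integral>\<^sup>+p. ennreal (real_of_ereal (T p) powr (- \<beta>) / \<beta>) \<partial>M)
      = (\<integral>\<^sup>+p. (\<integral>\<^sup>+u. ennreal (u powr (- 1 - \<beta>)) * (if 0 < u \<and> T p \<le> ereal u then 1 else 0) \<partial>lborel) \<partial>M)"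
    by (intro nn_integral_cong) (simp add: inner)
  also have "\<dots> = (\<integral>\<^sup>+u\<in>{0<..}. ennreal (u powr (- 1 - \<beta>)) * emeasure M {p\<in>space M. T p \<le> ereal u} \<partial>lborel)"
    by (rule nn_integral_layer) (auto intro: M.sigma_finite_measure_axioms)
  finally have "has_bochner_integral M (\<lambda>p. real_of_ereal (T p) powr (- \<beta>) / \<beta>) J"
    unfolding eq_m J using \<beta> J0 by (intro has_bochner_integral_nn_integral) auto
  from has_bochner_integral_mult_right[OF this, of \<beta>]
  have hbi: "has_bochner_integral M (\<lambda>p. real_of_ereal (T p) powr (- \<beta>)) (\<beta> * J)"
    using \<beta> by simp
  show "((\<lambda>t. (\<integral>p. measure K {\<omega>\<in>space K. T p \<le> ereal (S t \<omega>)} \<partial>M) / t)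
      \<longlongrightarrow> \<beta> / Gamma (1 - \<beta>) * J) (at_right 0)"
    \<comment> \<open>Dominated convergence is applied along arbitrary positive sequences tending to
      0.\<close>
    unfolding tendsto_at_iff_sequentially
  proof (intro allI impI)
    fix X :: "nat \<Rightarrow> real"
    assume X: "\<forall>i. X i \<in> {0<..} - {0}" "X \<longlonglongrightarrow> 0"
    then have Xpos: "X i > 0" for i by auto
    have XL: "filterlim X (at_right 0) sequentially"
      unfolding filterlim_at
      by (intro conjI always_eventually X(2)) (use X(1) in blast)
    let ?h = "\<lambda>p. real_of_ereal (T p) powr (- \<beta>)"
    have tail: "measure K {\<omega>\<in>space K. T p \<le> ereal (S t \<omega>)} =
        (if T p = \<infinity> then 0 else measure K {\<omega>\<in>space K. real_of_ereal (T p) \<le> S t \<omega>})"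
      "T p \<noteq> \<infinity> \<Longrightarrow> real_of_ereal (T p) > 0" if "p \<in> space M" for p t
      using T[OF that] by (cases "T p"; simp)+
    have "(\<lambda>i. \<integral>p. measure K {\<omega>\<in>space K. T p \<le> ereal (S (X i) \<omega>)} / X i \<partial>M)
        \<longlonglongrightarrow> (\<integral>p. ?h p / Gamma (1 - \<beta>) \<partial>M)"
    proof (rule integral_dominated_convergence)
      show "integrable M (\<lambda>p. ?h p / (1 - exp (- 1)))"
        using hbi by (simp add: has_bochner_integral_iff)
      show "(\<lambda>p. ?h p / Gamma (1 - \<beta>)) \<in> borel_measurable M" by measurable
      show "(\<lambda>p. measure K {\<omega>\<in>space K. T p \<le> ereal (S (X i) \<omega>)} / X i) \<in> borel_measurable M" for i
        using measurable_compose[OF \<open>T \<in> borel_measurable M\<close> H[OF Xpos]] by simp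
      show "AE p in M. (\<lambda>i. measure K {\<omega>\<in>space K. T p \<le> ereal (S (X i) \<omega>)} / X i) \<longlonglongrightarrow> ?h p / Gamma (1 - \<beta>)"
      proof (rule AE_I2)
        fix p assume p: "p \<in> space M"
        show "(\<lambda>i. measure K {\<omega>\<in>space K. T p \<le> ereal (S (X i) \<omega>)} / X i) \<longlonglongrightarrow> ?h p / Gamma (1 - \<beta>)"
        proof (cases "T p = \<infinity>")
          case False
          from filterlim_compose[OF stable_subordinator_tail_asymp[OF S \<beta> tail(2)[OF p False]] XL]
          show ?thesis by (simp add: tail(1)[OF p] False)
        qed simp
      qed
      show "AE p in M. norm (measure K {\<omega>\<in>space K. T p \<le> ereal (S (X i) \<omega>)} / X i) \<le> ?h p / (1 - exp (- 1))" for i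
      proof (rule AE_I2)
        fix p assume p: "p \<in> space M"
        show "norm (measure K {\<omega>\<in>space K. T p \<le> ereal (S (X i) \<omega>)} / X i) \<le> ?h p / (1 - exp (- 1))"
        proof (cases "T p = \<infinity>")
          case False
          have "measure K {\<omega>\<in>space K. real_of_ereal (T p) \<le> S (X i) \<omega>} / X i
              \<le> (X i * ?h p / (1 - exp (- 1))) / X i"
            using Xpos[of i]
            by (intro divide_right_mono stable_subordinator_tail_le[OF S _ tail(2)[OF p False]]) auto
          then show ?thesis using Xpos[of i] by (simp add: tail(1)[OF p] False)
        qed simp
      qed
    qed
    moreover have "(\<integral>p. ?h p / Gamma (1 - \<beta>) \<partial>M) = \<beta> / Gamma (1 - \<beta>) * J"
      using hbi by (simp add: has_bochner_integral_iff)
    ultimately show "((\<lambda>t. (\<integral>p. measure K {\<omega>\<in>space K. T p \<le> ereal (S t \<omega>)} \<partial>M) / t) \<circ> X)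
        \<longlonglongrightarrow> \<beta> / Gamma (1 - \<beta>) * J"
      by (simp only: comp_def integral_divide_zero)
  qed
qed

section \<open>Independence and the passage to one reference law\<close>

lemma borel_measurable_prob_le:
  fixes Y :: "'w \<Rightarrow> ereal"
  assumes M: "prob_space M" and [measurable]: "Y \<in> borel_measurable M"
  shows "(\<lambda>v. measure M {\<omega>\<in>space M. v \<le> Y \<omega>}) \<in> borel_measurable borel"
proof -
  interpret prob_space M by fact
  let ?Q = "{z \<in> space (borel \<Otimes>\<^sub>M M). fst z \<le> Y (snd z)}"
  have "?Q \<in> sets (borel \<Otimes>\<^sub>M M)" by measurable
  then have "(\<lambda>v. emeasure M (Pair v -` ?Q)) \<in> borel_measurable borel"
    by (rule measurable_emeasure_Pair)
  moreover have "Pair v -` ?Q = {\<omega>\<in>space M. v \<le> Y \<omega>}" for v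
    by (auto simp: space_pair_measure)
  ultimately have "(\<lambda>v. emeasure M {\<omega>\<in>space M. v \<le> Y \<omega>}) \<in> borel_measurable borel" by simp
  then show ?thesis unfolding measure_def by measurable
qed

text \<open>The joint law is a product, and its section at a value of \<open>X\<close> is the tail
  of \<open>Y\<close> there. The inner sample point plays the part of an independent copy.\<close>

lemma (in prob_space) prob_le_eq_expectation_tail:
  fixes X Y :: "'a \<Rightarrow> ereal"
  assumes indep: "indep_var borel X borel Y"
  shows "prob {\<omega>\<in>space M. X \<omega> \<le> Y \<omega>} = expectation (\<lambda>\<omega>. prob {\<omega>'\<in>space M. X \<omega> \<le> Y \<omega>'})"
proof -
  have X [measurable]: "X \<in> borel_measurable M" and Y [measurable]: "Y \<in> borel_measurable M"
    and eq: "distr M borel X \<Otimes>\<^sub>M distr M borel Y = distr M (borel \<Otimes>\<^sub>M borel) (\<lambda>\<omega>. (X \<omega>, Y \<omega>))"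
    using indep by (auto simp: indep_var_distribution_eq)
  interpret DX: prob_space "distr M borel X" by (rule prob_space_distr) fact
  interpret DY: prob_space "distr M borel Y" by (rule prob_space_distr) fact
  let ?Q = "{z :: ereal \<times> ereal. fst z \<le> snd z}"
  have Q: "?Q \<in> sets (borel \<Otimes>\<^sub>M borel)"
  proof -
    have "{z \<in> space (borel \<Otimes>\<^sub>M borel :: (ereal \<times> ereal) measure). fst z \<le> snd z} \<in> sets (borel \<Otimes>\<^sub>M borel)"
      by measurable
    then show ?thesis by (simp add: space_pair_measure)
  qed
  have "emeasure M {\<omega>\<in>space M. X \<omega> \<le> Y \<omega>} = emeasure (distr M borel X \<Otimes>\<^sub>M distr M borel Y) ?Q"
    unfolding eq using Q by (subst emeasure_distr) (auto simp: vimage_def Int_def conj_commute)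
  also have "\<dots> = (\<integral>\<^sup>+v. emeasure (distr M borel Y) (Pair v -` ?Q) \<partial>distr M borel X)"
    using Q by (intro DY.emeasure_pair_measure_alt) (simp cong: sets_pair_measure_cong)
  also have "\<dots> = (\<integral>\<^sup>+v. ennreal (prob {\<omega>'\<in>space M. v \<le> Y \<omega>'}) \<partial>distr M borel X)"
    by (intro nn_integral_cong) (simp add: emeasure_distr emeasure_eq_measure vimage_def Int_def conj_commute)
  also have "\<dots> = (\<integral>\<^sup>+\<omega>. ennreal (prob {\<omega>'\<in>space M. X \<omega> \<le> Y \<omega>'}) \<partial>M)"
    using borel_measurable_prob_le[OF prob_space_axioms Y] by (subst nn_integral_distr) auto
  also have "\<dots> = ennreal (expectation (\<lambda>\<omega>. prob {\<omega>'\<in>space M. X \<omega> \<le> Y \<omega>'}))"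
    using measurable_compose[OF X borel_measurable_prob_le[OF prob_space_axioms Y]]
    by (intro nn_integral_eq_integral integrable_const_bound[of _ 1]) auto
  finally show ?thesis by (simp add: emeasure_eq_measure)
qed

lemma borel_measurable_vimage_process:
  assumes "s \<ge> 0"
  shows "X s \<in> borel_measurable (vimage_algebra \<Omega> (\<lambda>\<omega>. \<lambda>t\<in>{0..}. X t \<omega>) (PiM {0..} (\<lambda>_. borel)))"
proof -
  have "(\<lambda>\<omega>. \<lambda>t\<in>{0..}. X t \<omega>) \<in> measurable (vimage_algebra \<Omega> (\<lambda>\<omega>. \<lambda>t\<in>{0..}. X t \<omega>) (PiM {0..} (\<lambda>_. borel)))
      (PiM {0..} (\<lambda>_. borel))"
    by (rule measurable_vimage_algebra1) (auto simp: space_PiM)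
  from measurable_compose[OF this measurable_component_singleton[of s]] assms
  show ?thesis by simp
qed

text \<open>The exit time is already measurable for the sigma-algebra generated by \<open>W\<close>,
  and \<open>S t\<close> for that of \<open>S\<close>. Independence passes to the smaller
  sigma-algebras they generate.\<close>

lemma indep_var_exit_time_subordinator:
  fixes W :: "real \<Rightarrow> 'w \<Rightarrow> 'a::euclidean_space"
  assumes W: "brownian_motion M c y W" and S: "stable_subordinator M \<beta> S"
    and indep: "independent_processes M W S" and D: "open D" and t: "t \<ge> 0"
  shows "prob_space.indep_var M borel (\<lambda>\<omega>. exit_time D (\<lambda>s. x + W s \<omega> - W 0 \<omega>))
    borel (\<lambda>\<omega>. ereal (S t \<omega>))"
proof -
  interpret prob_space M by (rule brownian_motionD(1)[OF W])
  let ?T = "\<lambda>\<omega>. exit_time D (\<lambda>s. x + W s \<omega> - W 0 \<omega>)"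
  let ?A = "vimage_algebra (space M) (\<lambda>\<omega>. \<lambda>t\<in>{0..}. W t \<omega>) (PiM {0..} (\<lambda>_. borel))"
  let ?B = "vimage_algebra (space M) (\<lambda>\<omega>. \<lambda>t\<in>{0..}. S t \<omega>) (PiM {0..} (\<lambda>_. borel))"
  have T: "?T \<in> borel_measurable ?A"
  proof (rule borel_measurable_exit_time)
    fix s :: real assume "s \<ge> 0"
    note [measurable] = borel_measurable_vimage_process[of s W "space M", OF this]
      borel_measurable_vimage_process[of 0 W "space M", OF order_refl]
    show "(\<lambda>\<omega>. x + W s \<omega> - W 0 \<omega>) \<in> borel_measurable ?A" by measurable
  qed (use D brownian_translate_cont[OF W] in auto)
  have St: "(\<lambda>\<omega>. ereal (S t \<omega>)) \<in> borel_measurable ?B"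
    using borel_measurable_vimage_process[OF t, of S "space M"] by measurable
  have "sigma_sets (space M) {?T -` E \<inter> space M |E. E \<in> sets borel} \<subseteq> sets ?A"
  proof -
    have "?T -` E \<inter> space M \<in> sets ?A" if "E \<in> sets borel" for E
      using measurable_sets[OF T that] by simp
    then have "{?T -` E \<inter> space M |E. E \<in> sets borel} \<subseteq> sets ?A" by blast
    from sets.sigma_sets_subset[OF this] show ?thesis by simp
  qed
  moreover have "sigma_sets (space M) {(\<lambda>\<omega>. ereal (S t \<omega>)) -` E \<inter> space M |E. E \<in> sets borel} \<subseteq> sets ?B"
  proof -
    have "(\<lambda>\<omega>. ereal (S t \<omega>)) -` E \<inter> space M \<in> sets ?B" if "E \<in> sets borel" for E
      using measurable_sets[OF St that] by simp
    then have "{(\<lambda>\<omega>. ereal (S t \<omega>)) -` E \<inter> space M |E. E \<in> sets borel} \<subseteq> sets ?B" by blast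
    from sets.sigma_sets_subset[OF this] show ?thesis by simp
  qed
  ultimately have "indep_set (sigma_sets (space M) {?T -` E \<inter> space M |E. E \<in> sets borel})
      (sigma_sets (space M) {(\<lambda>\<omega>. ereal (S t \<omega>)) -` E \<inter> space M |E. E \<in> sets borel})"
    using indep unfolding independent_processes_def indep_set_def
    by (elim indep_sets_mono_sets) (auto split: bool.split)
  moreover have "S t \<in> borel_measurable M" using S t by (simp add: stable_subordinator_def)
  ultimately show ?thesis
    using borel_measurable_brownian_exit_time[OF W D] by (simp add: indep_var_eq)
qed

text \<open>Heat contents integrate over the completed Lebesgue measure, whereas Tonelli is run on
  Borel sets. Agreement on \<open>G\<close> with a Borel function \<open>h\<close> moves the
  integral from one to the other.\<close>

lemma set_lebesgue_integral_restrict_space_cong: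
  fixes f h :: "'a::euclidean_space \<Rightarrow> real"
  assumes G: "G \<in> sets borel" and h: "h \<in> borel_measurable (restrict_space lborel G)"
    and eq: "\<And>x. x \<in> G \<Longrightarrow> f x = h x"
  shows "(LINT x:G|lebesgue. f x) = (\<integral>x. h x \<partial>restrict_space lborel G)"
proof -
  have "(\<lambda>x. indicator G x *\<^sub>R h x) \<in> borel_measurable lborel"
    using h G by (subst (asm) borel_measurable_restrict_space_iff) auto
  then have "(\<integral>x. indicator G x *\<^sub>R h x \<partial>lebesgue) = (\<integral>x. indicator G x *\<^sub>R h x \<partial>lborel)"
    by (rule integral_completion)
  moreover have "(LINT x:G|lebesgue. f x) = (\<integral>x. indicator G x *\<^sub>R h x \<partial>lebesgue)"
    unfolding set_lebesgue_integral_def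
    by (intro Bochner_Integration.integral_cong) (auto simp: eq indicator_def)
  ultimately show ?thesis using G by (simp add: integral_restrict_space)
qed

text \<open>The first conjunct certifies that the integral in the limit is genuine, since a Bochner
  integral of a non-integrable function would be 0 by convention. The parameter \<open>c\<close>
  covers every normalisation of Brownian motion.\<close>

theorem theorem3p8:
  fixes G0 G :: "'a::euclidean_space set"
    and R :: "nat \<Rightarrow> 'a \<Rightarrow> 'a" and r :: "nat \<Rightarrow> real" and N :: nat
    and b \<alpha> c :: real
    and P :: "'a \<Rightarrow> 'w measure"
    and W :: "real \<Rightarrow> 'w \<Rightarrow> 'a" and S :: "real \<Rightarrow> 'w \<Rightarrow> real"
  assumes G0_interval: "DIM('a) = 1 \<Longrightarrow> \<exists>p q. G0 = box p q \<and> box p q \<noteq> {}"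
    and G0_C11: "DIM('a) \<ge> 2 \<Longrightarrow> bounded G0 \<and> C11_open_set G0"
    and similitudes: "\<And>j. j \<in> {1..N} \<Longrightarrow> similitude (R j) (r j)"
    and sum_d: "(\<Sum>j=1..N. r j ^ DIM('a)) < 1"
    and sum_d1: "1 < (\<Sum>j=1..N. r j ^ (DIM('a) - 1))"
    and G_def: "G = self_similar_set R N G0"
    and disjoint: "disjoint_family_on (\<lambda>j. R j ` G) {1..N}"
    and disjoint0: "\<And>j. j \<in> {1..N} \<Longrightarrow> R j ` G \<inter> G0 = {}"
    and b_range: "real DIM('a) - 1 < b" "b < real DIM('a)"
    and b_sum: "(\<Sum>j=1..N. r j powr b) = 1"
    and \<alpha>_range: "0 < \<alpha>" "\<alpha> < real DIM('a) - b"
    and c_pos: "c > 0"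
    and BM: "\<And>x. brownian_motion (P x) c x W"
    and subordinator: "\<And>x. stable_subordinator (P x) (\<alpha> / 2) S"
    and independent: "\<And>x. independent_processes (P x) W S"
  shows "set_integrable lborel {0<..}
           (\<lambda>u. (measure lebesgue G - spectral_heat_content P W G u) * u powr (- 1 - \<alpha> / 2)) \<and>
         ((\<lambda>t. (measure lebesgue G - subordinate_heat_content P W S G t) / t) \<longlongrightarrow>
            \<alpha> / (2 * Gamma (1 - \<alpha> / 2)) *
            (LINT u:{0<..}|lborel.
               (measure lebesgue G - spectral_heat_content P W G u) * u powr (- 1 - \<alpha> / 2)))
         (at_right 0)"
proof -
  define \<beta> where "\<beta> = \<alpha> / 2"
  have \<beta>: "0 < \<beta>" "\<beta> < 1" and \<alpha>1: "\<alpha> < 1" using \<alpha>_range b_range by (auto simp: \<beta>_def)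
  have bdd: "bounded G0" and C11: "C11_open_set G0"
  proof -
    consider "DIM('a) = 1" | "DIM('a) \<ge> 2" using DIM_positive[where 'a = 'a] by linarith
    then have "bounded G0 \<and> C11_open_set G0"
    proof cases
      case 1
      then show ?thesis using G0_interval C11_open_set_box bounded_box by metis
    qed (use G0_C11 in auto)
    then show "bounded G0" "C11_open_set G0" by auto
  qed
  have op0: "open G0" using C11 by (simp add: C11_open_set_def)
  have rpos: "r j > 0" if "j \<in> {1..N}" for j using similitude_pos[OF similitudes[OF that]] .
  \<comment> \<open>Ratios below 1 make powers decrease in the exponent, so d - \<alpha> > b gives a
    sum strictly below that for b, which is 1.\<close>
  have r1: "r j < 1" if j: "j \<in> {1..N}" for j
  proof (rule ccontr)
    assume "\<not> r j < 1"
    then have "1 \<le> r j ^ DIM('a)" by (intro one_le_power) auto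
    also have "\<dots> \<le> (\<Sum>j=1..N. r j ^ DIM('a))"
      using j rpos by (intro member_le_sum) (auto intro: less_imp_le)
    finally show False using sum_d by simp
  qed
  have "N \<noteq> 0" using sum_d1 by (intro notI) simp
  have sum_lt: "(\<Sum>j=1..N. r j powr (real DIM('a) - \<alpha>)) < 1"
  proof -
    have "(\<Sum>j=1..N. r j powr (real DIM('a) - \<alpha>)) < (\<Sum>j=1..N. r j powr b)"
    proof (rule sum_strict_mono)
      fix j assume "j \<in> {1..N}"
      then show "r j powr (real DIM('a) - \<alpha>) < r j powr b"
        using rpos r1 \<alpha>_range by (intro powr_less_mono') auto
    qed (use \<open>N \<noteq> 0\<close> in auto)
    then show ?thesis using b_sum by simp
  qed
  have opG: "open G" unfolding G_def by (rule self_similar_set_open[OF similitudes op0])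
  then have G [measurable]: "G \<in> sets borel" by simp
  have Gfin: "emeasure lborel G < \<infinity>"
    unfolding G_def by (rule emeasure_self_similar_set_finite[OF similitudes op0 bdd sum_d])
  \<comment> \<open>The reference law: from here on every starting point is served by translating
    the path under \<open>P 0\<close>.\<close>
  define P0 where "P0 = P 0"
  interpret P0: prob_space P0 unfolding P0_def by (rule brownian_motionD(1)[OF BM])
  define L where "L = restrict_space lborel G"
  have space_L: "space L = G" by (simp add: L_def space_restrict_space)
  have emL: "emeasure L (space L) = emeasure lborel G"
    unfolding L_def by (simp add: space_restrict_space emeasure_restrict_space)
  interpret L: finite_measure L
    using Gfin by (intro finite_measureI) (simp add: emL)
  have mG: "measure lebesgue G = measure L (space L)"
    unfolding measure_def emL by simp
  \<comment> \<open>Volume on \<open>G\<close> for the starting point times the law of the path. On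
    this finite measure space \<open>T\<close> is the exit time from a uniformly spread
    start.\<close>
  define M where "M = L \<Otimes>\<^sub>M P0"
  interpret M: finite_measure M
    unfolding M_def by (rule finite_measure_pair_measure) unfold_locales
  interpret LP: pair_sigma_finite L P0 ..
  define \<tau> where "\<tau> x \<omega> = exit_time G (\<lambda>s. x + W s \<omega> - W 0 \<omega>)" for x \<omega>
  define T where "T p = \<tau> (fst p) (snd p)" for p
  have T [measurable]: "T \<in> borel_measurable M"
    using borel_measurable_exit_time_Pair[of W P0 G] opG brownian_motionD(2)[OF BM] brownian_motionD(4)[OF BM]
    by (simp add: T_def[abs_def] \<tau>_def M_def L_def P0_def case_prod_unfold)
  have \<tau> [measurable]: "\<tau> x \<in> borel_measurable (P y)" for x y
    unfolding \<tau>_def[abs_def] by (rule borel_measurable_brownian_exit_time[OF BM opG])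
  have \<tau>_pos: "0 < \<tau> x \<omega>" if "x \<in> G" "\<omega> \<in> space (P y)" for x y \<omega>
    unfolding \<tau>_def using that
    by (intro exit_time_pos brownian_translate_cont[OF BM] opG) auto
  have Tpos: "0 < T p" if "p \<in> space M" for p
    using that \<tau>_pos[of "fst p" "snd p" 0] by (auto simp: M_def space_pair_measure space_L T_def P0_def)
  have law: "distr (P x) borel (\<tau> x) = distr P0 borel (\<tau> x)" if "x \<in> G" for x
    unfolding \<tau>_def[abs_def] P0_def by (rule brownian_exit_time_distr_eq[OF BM BM opG that])
  \<comment> \<open>The path starts at \<open>x\<close> only almost surely, so its exit time and
    that of its translate agree almost everywhere.\<close>
  have start: "AE \<omega> in P x. exit_time G (\<lambda>s. W s \<omega>) = \<tau> x \<omega>" for x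
    using brownian_motionD(3)[OF BM[of x]] by eventually_elim (simp add: \<tau>_def)
  have exit_meas [measurable]: "(\<lambda>\<omega>. exit_time G (\<lambda>s. W s \<omega>)) \<in> borel_measurable (P x)" for x
    by (intro borel_measurable_exit_time brownian_motionD(2,4)[OF BM] opG)
  \<comment> \<open>Serves both heat contents: if 1 - \<phi> x is the path integral of
    \<open>f\<close> at \<open>x\<close>, the heat loss is the integral of \<open>f\<close> over the
    product.\<close>
  have content: "measure lebesgue G - (LINT x:G|lebesgue. \<phi> x) = (\<integral>p. f p \<partial>M)"
    if f: "integrable M f" and \<phi>: "\<And>x. x \<in> G \<Longrightarrow> \<phi> x = 1 - (\<integral>\<omega>. f (x, \<omega>) \<partial>P0)" for \<phi> f
  proof -
    have int: "integrable L (\<lambda>x. \<integral>\<omega>. f (x, \<omega>) \<partial>P0)"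
      using f unfolding M_def by (rule LP.integrable_fst')
    have "(LINT x:G|lebesgue. \<phi> x) = (\<integral>x. 1 - (\<integral>\<omega>. f (x, \<omega>) \<partial>P0) \<partial>L)"
      unfolding L_def using int
      by (intro set_lebesgue_integral_restrict_space_cong G \<phi>) (auto simp: L_def)
    also have "\<dots> = measure L (space L) - (\<integral>x. (\<integral>\<omega>. f (x, \<omega>) \<partial>P0) \<partial>L)"
      using int by (subst Bochner_Integration.integral_diff) auto
    also have "(\<integral>x. (\<integral>\<omega>. f (x, \<omega>) \<partial>P0) \<partial>L) = (\<integral>p. f p \<partial>M)"
      unfolding M_def by (rule LP.integral_fst') (use f in \<open>simp add: M_def\<close>)
    finally show ?thesis by (simp add: mG)
  qed
  have Q: "measure lebesgue G - spectral_heat_content P W G u = measure M {p\<in>space M. T p \<le> ereal u}" for u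
  proof -
    have "measure lebesgue G - spectral_heat_content P W G u
        = (\<integral>p. indicator {p\<in>space M. T p \<le> ereal u} p \<partial>M)"
      unfolding spectral_heat_content_def
    proof (rule content)
      show "integrable M (indicator {p\<in>space M. T p \<le> ereal u} :: _ \<Rightarrow> real)"
        by (intro integrable_real_indicator) (auto simp: M.emeasure_eq_measure)
      fix x assume x: "x \<in> G"
      interpret Px: prob_space "P x" by (rule brownian_motionD(1)[OF BM])
      have "measure (P x) {\<omega> \<in> space (P x). exit_time G (\<lambda>s. W s \<omega>) > ereal u}
          = measure (P x) (space (P x) - {\<omega> \<in> space (P x). \<tau> x \<omega> \<le> ereal u})"
      proof (rule measure_eq_AE)
        show "AE \<omega> in P x. \<omega> \<in> {\<omega> \<in> space (P x). exit_time G (\<lambda>s. W s \<omega>) > ereal u}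
            \<longleftrightarrow> \<omega> \<in> space (P x) - {\<omega> \<in> space (P x). \<tau> x \<omega> \<le> ereal u}"
          using start[of x] by eventually_elim (auto simp: not_le)
      qed measurable
      also have "\<dots> = 1 - measure (P x) {\<omega> \<in> space (P x). \<tau> x \<omega> \<le> ereal u}"
        by (rule Px.prob_compl) measurable
      also have "measure (P x) {\<omega> \<in> space (P x). \<tau> x \<omega> \<le> ereal u} = measure (distr (P x) borel (\<tau> x)) {..ereal u}"
        by (subst measure_distr) (auto simp: vimage_def Int_def conj_commute)
      also have "\<dots> = measure P0 {\<omega> \<in> space P0. \<tau> x \<omega> \<le> ereal u}"
        unfolding law[OF x]
        by (subst measure_distr) (auto simp: P0_def vimage_def Int_def conj_commute)
      also have "\<dots> = (\<integral>\<omega>. indicator {\<omega> \<in> space P0. \<tau> x \<omega> \<le> ereal u} \<omega> \<partial>P0)"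
        by (auto intro!: arg_cong[where f = "measure P0"])
      also have "\<dots> = (\<integral>\<omega>. indicator {p\<in>space M. T p \<le> ereal u} (x, \<omega>) \<partial>P0)"
        using x by (intro Bochner_Integration.integral_cong)
          (auto simp: indicator_def M_def space_pair_measure space_L T_def)
      finally show "measure (P x) {\<omega> \<in> space (P x). exit_time G (\<lambda>s. W s \<omega>) > ereal u}
          = 1 - (\<integral>\<omega>. indicator {p\<in>space M. T p \<le> ereal u} (x, \<omega>) \<partial>P0)" .
    qed
    then show ?thesis by simp
  qed
  define H where "H t v = measure P0 {\<omega>\<in>space P0. v \<le> ereal (S t \<omega>)}" for t v
  have S_meas: "S t \<in> borel_measurable (P x)" if "t > 0" for t x
    using subordinator[of x] that by (simp add: stable_subordinator_def)
  have H_meas: "H t \<in> borel_measurable borel" if "t > 0" for t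
    using S_meas[OF that] unfolding H_def[abs_def]
    by (intro borel_measurable_prob_le P0.prob_space_axioms) (auto simp: P0_def)
  have Qs: "measure lebesgue G - subordinate_heat_content P W S G t = (\<integral>p. H t (T p) \<partial>M)" if t: "t > 0" for t
    unfolding subordinate_heat_content_def
  proof (rule content)
    note [measurable] = H_meas[OF t] S_meas[OF t]
    show "integrable M (\<lambda>p. H t (T p))"
    proof (rule M.integrable_const_bound[of _ 1])
      show "(\<lambda>p. H t (T p)) \<in> borel_measurable M"
        by (rule measurable_compose[OF T H_meas[OF t]])
    qed (simp add: H_def)
    fix x assume x: "x \<in> G"
    interpret Px: prob_space "P x" by (rule brownian_motionD(1)[OF BM])
    have "measure (P x) {\<omega> \<in> space (P x). exit_time G (\<lambda>s. W s \<omega>) > ereal (S t \<omega>)}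
        = measure (P x) (space (P x) - {\<omega> \<in> space (P x). \<tau> x \<omega> \<le> ereal (S t \<omega>)})"
    proof (rule measure_eq_AE)
      show "AE \<omega> in P x. \<omega> \<in> {\<omega> \<in> space (P x). exit_time G (\<lambda>s. W s \<omega>) > ereal (S t \<omega>)}
          \<longleftrightarrow> \<omega> \<in> space (P x) - {\<omega> \<in> space (P x). \<tau> x \<omega> \<le> ereal (S t \<omega>)}"
        using start[of x] by eventually_elim (auto simp: not_le)
    qed measurable
    also have "\<dots> = 1 - measure (P x) {\<omega> \<in> space (P x). \<tau> x \<omega> \<le> ereal (S t \<omega>)}"
      by (rule Px.prob_compl) measurable
    \<comment> \<open>Independence is used while still under \<open>P x\<close>. Afterwards the tail
      of \<open>S t\<close> and the law of the exit time are exchanged separately for those under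
      \<open>P 0\<close>.\<close>
    also have "measure (P x) {\<omega> \<in> space (P x). \<tau> x \<omega> \<le> ereal (S t \<omega>)}
        = (\<integral>\<omega>. measure (P x) {\<omega>'\<in>space (P x). \<tau> x \<omega> \<le> ereal (S t \<omega>')} \<partial>P x)"
      using indep_var_exit_time_subordinator[OF BM subordinator independent opG less_imp_le[OF t], of x x]
      unfolding \<tau>_def by (rule Px.prob_le_eq_expectation_tail)
    also have "\<dots> = (\<integral>\<omega>. H t (\<tau> x \<omega>) \<partial>P x)"
    proof (intro Bochner_Integration.integral_cong refl)
      fix \<omega> assume \<omega>: "\<omega> \<in> space (P x)"
      show "measure (P x) {\<omega>'\<in>space (P x). \<tau> x \<omega> \<le> ereal (S t \<omega>')} = H t (\<tau> x \<omega>)"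
      proof (cases "\<tau> x \<omega>")
        case (real v)
        then have "v > 0" using \<tau>_pos[OF x \<omega>] by simp
        from stable_subordinator_tail_eq[OF subordinator[of x] subordinator[of 0] less_imp_le[OF t] this]
        show ?thesis by (simp add: H_def P0_def real)
      qed (use \<tau>_pos[OF x \<omega>] in \<open>auto simp: H_def\<close>)
    qed
    also have "\<dots> = (\<integral>v. H t v \<partial>distr (P x) borel (\<tau> x))"
      by (rule integral_distr[symmetric]) measurable
    also have "\<dots> = (\<integral>\<omega>. H t (\<tau> x \<omega>) \<partial>P0)"
      unfolding law[OF x] by (rule integral_distr) (simp_all add: P0_def H_meas[OF t])
    finally show "measure (P x) {\<omega> \<in> space (P x). exit_time G (\<lambda>s. W s \<omega>) > ereal (S t \<omega>)}
        = 1 - (\<integral>\<omega>. H t (T (x, \<omega>)) \<partial>P0)" by (simp add: T_def)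
  qed
  obtain K where K: "K \<ge> 0"
    and exit_le: "\<And>(M :: 'w measure) (W :: real \<Rightarrow> 'w \<Rightarrow> 'a) y D x \<delta> u. brownian_motion M c y W \<Longrightarrow>
      open D \<Longrightarrow> ball x \<delta> \<subseteq> D \<Longrightarrow> \<delta> > 0 \<Longrightarrow> u > 0 \<Longrightarrow>
      measure M {\<omega>\<in>space M. exit_time D (\<lambda>s. x + W s \<omega> - W 0 \<omega>) \<le> ereal u} \<le> K * u\<^sup>2 / \<delta> ^ 4"
    by (rule brownian_exit_time_le[OF c_pos]) blast
  \<comment> \<open>The expectation of \<tau>^(-\<beta>) / \<beta> for start \<open>x\<close>, kept
    as a double integral so that \<open>nn_integral_layer\<close> applies both at fixed
    \<open>x\<close> and over the product.\<close>
  define \<Phi> where "\<Phi> x = (\<integral>\<^sup>+\<omega>. (\<integral>\<^sup>+u. ennreal (u powr (- 1 - \<beta>)) *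
    (if 0 < u \<and> \<tau> x \<omega> \<le> ereal u then 1 else 0) \<partial>lborel) \<partial>P0)" for x
  have \<Phi>_le: "\<Phi> x \<le> ennreal ((K + 1 / \<beta>) * \<delta> powr (- \<alpha>))" if \<delta>: "ball x \<delta> \<subseteq> G" "\<delta> > 0" for x \<delta>
  proof -
    have "\<Phi> x = (\<integral>\<^sup>+u\<in>{0<..}. ennreal (u powr (- 1 - \<beta>)) * emeasure P0 {\<omega>\<in>space P0. \<tau> x \<omega> \<le> ereal u} \<partial>lborel)"
      unfolding \<Phi>_def
      by (rule nn_integral_layer) (auto simp: P0_def intro: P0.sigma_finite_measure_axioms[unfolded P0_def])
    also have "\<dots> \<le> ennreal ((K + 1 / \<beta>) * \<delta> powr (- (2 * \<beta>)))"
    proof (rule nn_integral_exit_bound[OF \<beta> \<delta>(2) K])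
      fix u :: real assume "u > 0"
      from exit_le[OF BM[of 0] opG \<delta> this]
      have "measure P0 {\<omega>\<in>space P0. \<tau> x \<omega> \<le> ereal u} \<le> K * u\<^sup>2 / \<delta> ^ 4"
        unfolding \<tau>_def P0_def .
      then show "emeasure P0 {\<omega>\<in>space P0. \<tau> x \<omega> \<le> ereal u} \<le> ennreal (K * u\<^sup>2 / \<delta> ^ 4)"
        unfolding P0.emeasure_eq_measure by (rule ennreal_leI)
    qed (simp add: P0.emeasure_eq_measure)
    finally show ?thesis by (simp add: \<beta>_def)
  qed
  have "(\<integral>\<^sup>+x\<in>G. \<Phi> x \<partial>lborel) < \<infinity>"
    unfolding G_def
  proof (rule nn_integral_infdist_self_similar_finite[OF similitudes C11 bdd sum_lt \<alpha>_range(1) \<alpha>1])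
    show "0 \<le> K + 1 / \<beta>" using K \<beta> by simp
    \<comment> \<open>The ball around \<open>x\<close> with the distance to the complement of
      \<open>D\<close> as radius lies in \<open>D\<close>, hence in \<open>G\<close>, so the bound
      for exits from \<open>G\<close> applies with this radius.\<close>
    fix D x assume D: "D \<subseteq> self_similar_set R N G0" "0 < infdist x (- D)"
    show "\<Phi> x \<le> ennreal ((K + 1 / \<beta>) * infdist x (- D) powr - \<alpha>)"
      using D ball_infdist_Compl_subset[of x D] by (intro \<Phi>_le) (auto simp: G_def)
  qed
  moreover have "(\<integral>\<^sup>+x\<in>G. \<Phi> x \<partial>lborel) = (\<integral>\<^sup>+x. \<Phi> x \<partial>L)"
    unfolding L_def by (simp add: nn_integral_restrict_space)
  moreover have "(\<integral>\<^sup>+x. \<Phi> x \<partial>L) = (\<integral>\<^sup>+p. (\<integral>\<^sup>+u. ennreal (u powr (- 1 - \<beta>)) *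
      (if 0 < u \<and> T p \<le> ereal u then 1 else 0) \<partial>lborel) \<partial>M)"
  proof -
    have "(\<lambda>p. \<integral>\<^sup>+u. ennreal (u powr (- 1 - \<beta>)) * (if 0 < u \<and> T p \<le> ereal u then 1 else 0) \<partial>lborel)
        \<in> borel_measurable M"
      by measurable
    then show ?thesis
      unfolding \<Phi>_def M_def by (subst P0.nn_integral_fst[symmetric]) (simp_all add: T_def)
  qed
  moreover have "\<dots> = (\<integral>\<^sup>+u\<in>{0<..}. ennreal (u powr (- 1 - \<beta>)) * emeasure M {p\<in>space M. T p \<le> ereal u} \<partial>lborel)"
    by (rule nn_integral_layer) (auto intro: M.sigma_finite_measure_axioms)
  ultimately have fin: "(\<integral>\<^sup>+u\<in>{0<..}. ennreal (u powr (- 1 - \<beta>)) * emeasure M {p\<in>space M. T p \<le> ereal u} \<partial>lborel) < \<infinity>"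
    by simp
  have S0: "stable_subordinator P0 \<beta> S" unfolding P0_def \<beta>_def by (rule subordinator)
  note lim = subordinator_limit[OF M.finite_measure_axioms T Tpos S0 \<beta> H_meas[unfolded H_def[abs_def]] fin]
  have "((\<lambda>t. (measure lebesgue G - subordinate_heat_content P W S G t) / t) \<longlongrightarrow>
      \<beta> / Gamma (1 - \<beta>) * (LINT u:{0<..}|lborel. measure M {p\<in>space M. T p \<le> ereal u} * u powr (- 1 - \<beta>)))
    (at_right 0)"
  proof (rule Lim_transform_eventually[OF lim(2)])
    show "\<forall>\<^sub>F t in at_right 0. (\<integral>p. measure P0 {\<omega>\<in>space P0. T p \<le> ereal (S t \<omega>)} \<partial>M) / t
        = (measure lebesgue G - subordinate_heat_content P W S G t) / t"
      using eventually_at_right_less[of 0] by eventually_elim (simp only: Qs H_def)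
  qed
  then show ?thesis
    using lim(1) unfolding Q \<beta>_def by simp
qed

end
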